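(* Let $D\subseteq\mathbb{C}$ be a domain and let $P$ and $Q$ be polynomials with $1\leq\deg(P)<\deg(Q)=l$. Let $\mathcal{F}$ be the family of all meromorphic functions $f$ on $D$ such that neither $f-P$ nor $(f-Q)^{(l)}$ has a zero in $D$. Then $\mathcal{F}$ is normal in $D$.
   Context: A family $\mathcal{F}$ of meromorphic functions on a domain $D$ is normal in $D$ if every sequence of members of $\mathcal{F}$ contains a subsequence that converges locally uniformly in $D$ with respect to the spherical metric. The notation $(\cdot)^{(l)}$ denotes the $l$-th derivative. *)

theory Defs
  imports "HOL-Complex_Analysis.Complex_Analysis"
begin

text \<open>
  The Riemann sphere is \<^typ>\<open>complex option\<close>, with \<^term>\<open>None\<close> as the point at infinity.
  It is embedded as the unit sphere of \<^typ>\<open>complex \<times> real\<close> by stereographic projection, and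
  the spherical metric is the great-circle distance, i.e. the angle between unit vectors.
\<close>

fun stereo :: "complex option \<Rightarrow> complex \<times> real" where
  "stereo None = (0, 1)"
| "stereo (Some z) = (of_real (2 / (1 + (cmod z)\<^sup>2)) * z, ((cmod z)\<^sup>2 - 1) / ((cmod z)\<^sup>2 + 1))"

definition spherical_dist :: "complex option \<Rightarrow> complex option \<Rightarrow> real" where
  "spherical_dist p q = arccos (stereo p \<bullet> stereo q)"

text \<open>
  A meromorphic function on \<open>D\<close> is rendered as a function satisfying
  \<^const>\<open>nicely_meromorphic_on\<close>: it has no removable singularities in \<open>D\<close>, and its value at
  a pole is the dummy \<open>0\<close>.  The actual value there, as a map into the sphere, is infinity.
\<close>

definition sphere_val :: "(complex \<Rightarrow> complex) \<Rightarrow> complex \<Rightarrow> complex option" where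
  "sphere_val f z = (if is_pole f z then None else Some (f z))"

text \<open>
  The pole condition keeps the dummy value of a meromorphic function, or of an expression built
  from one, from counting as a zero.
\<close>

definition has_zero_in :: "(complex \<Rightarrow> complex) \<Rightarrow> complex set \<Rightarrow> bool" where
  "has_zero_in g D \<longleftrightarrow> (\<exists>z\<in>D. \<not> is_pole g z \<and> g z = 0)"

definition converges_loc_unif_spherical ::
    "(nat \<Rightarrow> complex \<Rightarrow> complex) \<Rightarrow> (complex \<Rightarrow> complex option) \<Rightarrow> complex set \<Rightarrow> bool" where
  "converges_loc_unif_spherical F g D \<longleftrightarrow>
     (\<forall>z\<in>D. \<exists>r>0. \<forall>\<epsilon>>0. \<exists>N. \<forall>n\<ge>N. \<forall>w\<in>ball z r \<inter> D.
        spherical_dist (sphere_val (F n) w) (g w) < \<epsilon>)"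

text \<open>
  The limit is any map into the sphere; in particular the constant infinity is allowed.
\<close>

definition normal_family_on :: "(complex \<Rightarrow> complex) set \<Rightarrow> complex set \<Rightarrow> bool" where
  "normal_family_on \<F> D \<longleftrightarrow>
     (\<forall>F. (\<forall>n. F n \<in> \<F>) \<longrightarrow>
        (\<exists>(r :: nat \<Rightarrow> nat) g. strict_mono r \<and> converges_loc_unif_spherical (\<lambda>n. F (r n)) g D))"

end

theory Submission
  imports Defs "HOL-Computational_Algebra.Fundamental_Theorem_Algebra" "HOL-Library.Diagonal_Subsequence"
begin

text \<open>
  Since \<open>deg P < l\<close>, the function \<open>g = f - P\<close> is zero-free and \<open>g\<^sup>(\<^sup>l\<^sup>)\<close> omits a
  constant \<open>c \<noteq> 0\<close>, so \<open>h = 1/g\<close> is holomorphic.  If the spherical derivatives of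
  these \<open>h\<close> were not locally bounded, a Zalcman--Pang rescaling \<open>t\<^sup>l h(z + t \<zeta>)\<close>
  would converge to a nonconstant entire function \<open>h\<close> with bounded spherical derivative, hence of exponential
  type, for which \<open>(1/h)\<^sup>(\<^sup>l\<^sup>)\<close> still omits \<open>c\<close>.  Such a function does not exist.
  Here Nevanlinna theory is replaced by pointwise estimates: a function of exponential type has only
  \<open>O(r)\<close> zeros in a disc of radius \<open>r\<close>, so its logarithmic derivative is \<open>O(r)\<close> on suitable
  circles of radii between \<open>R\<close> and \<open>2R\<close>, for every large \<open>R\<close>.  On these circles one
  bounds certain differential expressions in \<open>h\<close> which turn out to be entire, hence polynomials, and \<open>l \<ge> 2\<close>
  forces \<open>h\<close> itself to be a polynomial.
\<close>

section \<open>Positive harmonic functions and the Clunie--Hayman growth bound\<close>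

text \<open>The factor t^l in the rescaling is dictated by invariance: the l-th derivative of 1/(t^l
  h(z + t \<zeta>)) is that of 1/h at z + t \<zeta>, so the same value c is omitted at every scale
  and, by Hurwitz, in the limit. The limit is shown to be a polynomial by solving for it. With T the
  logarithmic derivative of (1/h)^(l) - c, two expressions u and V multiply T by enough factors to
  cancel every pole, and the relation V h = u^4 (T^2 - (l+1) T') returns h once u and V are known to
  be polynomials. The exceptional cases u = 0 and V = 0 are differential equations with explicit
  solutions. A bound for the spherical derivative of h is not yet one for f = P + 1/h. The passage
  goes through the homogeneous coordinates (1 + P h : h), which have no common zero and treat poles
  of f like other points.\<close>

lemma Re_pos_Schwarz:
  assumes holf: "f holomorphic_on ball a R" and R: "0 < R"
    and pos: "\<And>z. z \<in> ball a R \<Longrightarrow> 0 < Re (f z)"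
  shows "z \<in> ball a R \<Longrightarrow> R * \<bar>Re (f z) - Re (f a)\<bar> \<le> dist a z * (Re (f z) + Re (f a))"
    and "R * cmod (deriv f a) \<le> 2 * Re (f a)"
proof -
  \<comment> \<open>A Cayley transform of \<open>f\<close>: it sends the right half-plane to the
    unit disc and \<open>f a\<close> to 0. The two conclusions of the Schwarz lemma become a
    division-free Harnack inequality and the gradient bound at the centre.\<close>
  define w where "w \<zeta> = (f (a + of_real R * \<zeta>) - f a) / (f (a + of_real R * \<zeta>) + cnj (f a))" for \<zeta>
  have inb: "a + of_real R * \<zeta> \<in> ball a R" if "norm \<zeta> < 1" for \<zeta>
    using that R by (simp add: dist_norm norm_mult)
  have a_in: "a \<in> ball a R" using R by simp
  have den: "f (a + of_real R * \<zeta>) + cnj (f a) \<noteq> 0" if "norm \<zeta> < 1" for \<zeta>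
  proof -
    have "0 < Re (f (a + of_real R * \<zeta>) + cnj (f a))"
      using pos[OF inb[OF that]] pos[OF a_in] by simp
    then show ?thesis by (metis less_irrefl zero_complex.simps(1))
  qed
  have holc: "(\<lambda>\<zeta>. f (a + of_real R * \<zeta>)) holomorphic_on ball 0 1"
    by (rule holomorphic_on_compose_gen[OF _ holf, unfolded o_def])
       (auto intro!: holomorphic_intros inb)
  have holw: "w holomorphic_on ball 0 1"
    unfolding w_def by (intro holomorphic_intros holc) (use den in auto)
  have w0: "w 0 = 0" by (simp add: w_def)
  have key: "norm (w \<zeta>) < 1" if "norm \<zeta> < 1" for \<zeta>
  proof -
    let ?u = "f (a + of_real R * \<zeta>)"
    have "(norm (?u + cnj (f a)))\<^sup>2 - (norm (?u - f a))\<^sup>2 = 4 * (Re ?u * Re (f a))"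
      unfolding cmod_power2 by (simp add: power2_eq_square algebra_simps)
    moreover have "0 < Re ?u * Re (f a)"
      using pos[OF inb[OF that]] pos[OF a_in] by simp
    ultimately have "(norm (?u - f a))\<^sup>2 < (norm (?u + cnj (f a)))\<^sup>2" by linarith
    then have "norm (?u - f a) < norm (?u + cnj (f a))"
      by (rule power2_less_imp_less) simp
    then show ?thesis using den[OF that]
      by (simp add: w_def norm_divide divide_simps)
  qed
  show "R * \<bar>Re (f z) - Re (f a)\<bar> \<le> dist a z * (Re (f z) + Re (f a))" if z: "z \<in> ball a R"
  proof -
    define \<zeta> where "\<zeta> = (z - a) / of_real R"
    have n\<zeta>: "norm \<zeta> = dist a z / R"
      using R by (simp add: \<zeta>_def norm_divide dist_norm norm_minus_commute)
    have lt: "norm \<zeta> < 1" using z R n\<zeta> by simp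
    have ze: "a + of_real R * \<zeta> = z" using R by (simp add: \<zeta>_def)
    define \<rho> where "\<rho> = norm \<zeta>"
    have \<rho>: "0 \<le> \<rho>" "\<rho> < 1" using lt by (auto simp: \<rho>_def)
    have "norm (w \<zeta>) \<le> \<rho>" unfolding \<rho>_def
      using Schwarz_Lemma(1)[OF holw w0 key lt] .
    then have "norm (f z - f a) \<le> \<rho> * norm (f z + cnj (f a))"
      using den[OF lt] unfolding w_def ze by (simp add: norm_divide divide_le_eq)
    then have "(norm (f z - f a))\<^sup>2 \<le> \<rho>\<^sup>2 * (norm (f z + cnj (f a)))\<^sup>2"
      by (metis norm_ge_zero power_mono power_mult_distrib)
    then have "(Re (f z) - Re (f a))\<^sup>2 + (Im (f z) - Im (f a))\<^sup>2
        \<le> \<rho>\<^sup>2 * ((Re (f z) + Re (f a))\<^sup>2) + \<rho>\<^sup>2 * (Im (f z) - Im (f a))\<^sup>2"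
      by (simp add: cmod_power2 algebra_simps)
    \<comment> \<open>The difference of the imaginary parts enters both moduli in the same way, so
      \<open>\<rho> \<le> 1\<close> allows it to be dropped.\<close>
    moreover have "\<rho>\<^sup>2 * (Im (f z) - Im (f a))\<^sup>2 \<le> 1 * (Im (f z) - Im (f a))\<^sup>2"
      using \<rho> by (intro mult_right_mono) (auto simp: power_le_one)
    ultimately have "(Re (f z) - Re (f a))\<^sup>2 \<le> (\<rho> * (Re (f z) + Re (f a)))\<^sup>2"
      by (simp add: power_mult_distrib)
    then have "\<bar>Re (f z) - Re (f a)\<bar> \<le> \<bar>\<rho> * (Re (f z) + Re (f a))\<bar>"
      by (simp add: abs_le_square_iff)
    also have "\<dots> = \<rho> * (Re (f z) + Re (f a))"
      using \<rho> pos[OF z] pos[OF a_in] by simp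
    finally show ?thesis using R by (simp add: \<rho>_def n\<zeta> field_simps)
  qed
  show "R * cmod (deriv f a) \<le> 2 * Re (f a)"
  proof -
    have fd: "(f has_field_derivative deriv f a) (at a)"
      using holf a_in by (intro holomorphic_derivI) auto
    have "((\<lambda>\<zeta>. f (a + of_real R * \<zeta>)) has_field_derivative deriv f a * of_real R) (at 0)"
      by (rule DERIV_chain2) (auto intro!: derivative_eq_intros simp: fd)
    note d1 = this
    have nz: "f a + cnj (f a) \<noteq> 0" using den[of 0] by simp
    have "(w has_field_derivative deriv f a * of_real R / (f a + cnj (f a))) (at 0)"
      unfolding w_def
      by (rule derivative_eq_intros d1 refl | use nz in simp)+
    then have "deriv w 0 = deriv f a * of_real R / (f a + cnj (f a))"
      by (rule DERIV_imp_deriv)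
    moreover have "norm (deriv w 0) \<le> 1" using Schwarz_Lemma(2)[OF holw w0 key, of 0] by simp
    moreover have "norm (f a + cnj (f a)) = 2 * Re (f a)"
      using pos[OF a_in] by (simp add: complex_add_cnj)
    ultimately show ?thesis using pos[OF a_in] R
      by (simp add: norm_divide norm_mult field_simps)
  qed
qed

lemma holomorphic_branch_log_ball:
  fixes G :: "complex \<Rightarrow> complex"
  assumes "G holomorphic_on ball a R" "\<And>z. z \<in> ball a R \<Longrightarrow> G z \<noteq> 0"
  obtains L where "L holomorphic_on ball a R" "\<And>z. z \<in> ball a R \<Longrightarrow> G z = exp (L z)"
    "\<And>z. z \<in> ball a R \<Longrightarrow> Re (L z) = ln (cmod (G z))"
    "\<And>z. z \<in> ball a R \<Longrightarrow> deriv G z = G z * deriv L z"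
proof -
  obtain L where L: "L holomorphic_on ball a R" "\<And>z. z \<in> ball a R \<Longrightarrow> G z = exp (L z)"
    using contractible_imp_holomorphic_log[OF assms(1) convex_imp_contractible assms(2)] by auto
  have 1: "Re (L z) = ln (cmod (G z))" if "z \<in> ball a R" for z
    using L(2)[OF that] by simp
  have 2: "deriv G z = G z * deriv L z" if z: "z \<in> ball a R" for z
  proof -
    have "deriv G z = deriv (\<lambda>z. exp (L z)) z"
      by (rule deriv_cong_ev) (use L(2) z in \<open>auto simp: eventually_nhds intro!: exI[of _ "ball a R"]\<close>)
    moreover have "(L has_field_derivative deriv L z) (at z)"
      using L(1) z by (intro holomorphic_derivI) auto
    then have "((\<lambda>z. exp (L z)) has_field_derivative exp (L z) * deriv L z) (at z)"
      by (rule DERIV_fun_exp)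
    ultimately show ?thesis using L(2)[OF z] DERIV_imp_deriv by fastforce
  qed
  show thesis using that L 1 2 by blast
qed

text \<open>Compare the decay of \<open>ln |H|\<close> at the boundary of the largest disc around \<open>a\<close> in which
  \<open>|H| > 1\<close> (Harnack) with the bound on the derivative there.\<close>
lemma spherical_derivative_bound_imp_exp_bound:
  fixes H :: "complex \<Rightarrow> complex"
  assumes hol: "H holomorphic_on ball 0 A"
    and sph: "\<And>z. z \<in> ball 0 A \<Longrightarrow> cmod (deriv H z) \<le> M * (1 + (cmod (H z))\<^sup>2)"
    and b: "cmod (H b) \<le> 1" and ab: "cmod a + dist a b < A"
  shows "cmod (H a) \<le> exp (4 * M * dist a b)"
proof -
  have sub: "cball a (dist a b) \<subseteq> ball 0 A"
  proof
    fix z assume "z \<in> cball a (dist a b)"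
    then have "dist a z \<le> dist a b" by simp
    moreover have "dist 0 z \<le> dist 0 a + dist a z" by (rule dist_triangle)
    ultimately show "z \<in> ball 0 A" using ab by simp
  qed
  have a_in: "a \<in> ball 0 A" using ab zero_le_dist[of a b] by (simp, linarith)
  have M0: "0 \<le> M"
  proof -
    have "0 \<le> M * (1 + (cmod (H a))\<^sup>2)" using sph[OF a_in] norm_ge_zero order_trans by blast
    moreover have "0 < 1 + (cmod (H a))\<^sup>2" by (simp add: add_pos_nonneg)
    ultimately show ?thesis by (simp add: zero_le_mult_iff)
  qed
  show ?thesis
  proof (cases "cmod (H a) \<le> 1")
    case True
    moreover have "1 \<le> exp (4 * M * dist a b)" using M0 by simp
    ultimately show ?thesis by linarith
  next
    case False
    have cont: "continuous_on (cball a (dist a b)) H"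
      using hol sub holomorphic_on_imp_continuous_on continuous_on_subset by blast
    define Z where "Z = {z \<in> cball a (dist a b). cmod (H z) \<le> 1}"
    have "continuous_on (cball a (dist a b)) (\<lambda>z. cmod (H z))"
      by (intro continuous_intros cont)
    then have "closed (cball a (dist a b) \<inter> (\<lambda>z. cmod (H z)) -` {..1})"
      by (rule continuous_closed_preimage) auto
    moreover have Zeq: "Z = cball a (dist a b) \<inter> (\<lambda>z. cmod (H z)) -` {..1}"
      by (auto simp: Z_def)
    ultimately have "compact Z"
      using compact_Int_closed[OF compact_cball] by (metis Int_left_absorb)
    moreover have "Z \<noteq> {}" using b by (auto simp: Z_def)
    ultimately obtain p where p: "p \<in> Z" and pmin: "\<And>z. z \<in> Z \<Longrightarrow> dist a p \<le> dist a z"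
      using distance_attains_inf[of Z a] compact_imp_closed by metis
    define R where "R = dist a p"
    have "p \<noteq> a" using False p by (auto simp: Z_def)
    then have R: "0 < R" by (simp add: R_def)
    have Rle: "R \<le> dist a b" using p by (auto simp: Z_def R_def)
    have subR: "ball a R \<subseteq> cball a (dist a b)" using Rle by auto
    have gt1: "1 < cmod (H z)" if "z \<in> ball a R" for z
      using pmin[of z] that Rle by (force simp: Z_def R_def)
    have "H holomorphic_on ball a R" using hol sub subR holomorphic_on_subset by blast
    then obtain L where L: "L holomorphic_on ball a R"
      "\<And>z. z \<in> ball a R \<Longrightarrow> Re (L z) = ln (cmod (H z))"
      using holomorphic_branch_log_ball[of H a R] gt1
      by (metis norm_zero not_one_less_zero)
    have Lpos: "0 < Re (L z)" if "z \<in> ball a R" for z using gt1[OF that] L(2)[OF that] ln_gt_zero by metis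
    \<comment> \<open>The points \<open>q n\<close> approach \<open>p\<close> along the radius from
      \<open>a\<close>, at distance \<open>s * R\<close> with \<open>s = 1 / (n + 1)\<close>.
      Harnack gives \<open>s * ln |H a| \<le> 2 * ln |H (q n)|\<close>, and
      \<open>ln x \<le> x - 1\<close> bounds the right side by \<open>2 * |H (q n) - H p|\<close>.
      Dividing by \<open>s\<close> leaves a difference quotient that tends to the derivative at
      \<open>p\<close>.\<close>
    define q where "q n = p + of_real (inverse (real (Suc n))) * (a - p)" for n
    have dq: "dist a (q n) = R * (1 - inverse (real (Suc n)))" for n
    proof -
      have "a - q n = of_real (1 - inverse (real (Suc n))) * (a - p)"
        by (simp add: q_def algebra_simps)
      then have "dist a (q n) = \<bar>1 - inverse (real (Suc n))\<bar> * R"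
        by (simp add: dist_norm norm_mult R_def del: of_real_diff)
      then show ?thesis by (simp add: inverse_le_1_iff mult.commute)
    qed
    have qin: "q n \<in> ball a R" for n
      using R by (simp add: dq mult_less_cancel_left2 del: of_nat_Suc)
    have qlim: "q \<longlonglongrightarrow> p"
    proof -
      have "(\<lambda>n. p + of_real (inverse (real (Suc n))) * (a - p)) \<longlonglongrightarrow> p + of_real 0 * (a - p)"
        by (intro tendsto_intros LIMSEQ_inverse_real_of_nat)
      then show ?thesis by (simp add: q_def[abs_def])
    qed
    have qne: "q n \<noteq> p" for n using qin[of n] by (auto simp: R_def)
    have p_in: "p \<in> ball 0 A" using p sub by (auto simp: Z_def)
    have Hd: "(H has_field_derivative deriv H p) (at p)"
      using hol p_in by (intro holomorphic_derivI) auto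
    have Hq: "(\<lambda>n. H (q n)) \<longlonglongrightarrow> H p"
      using qlim Hd DERIV_isCont isCont_tendsto_compose by blast
    have Hp1: "cmod (H p) = 1"
    proof (rule antisym)
      show "cmod (H p) \<le> 1" using p by (simp add: Z_def)
      show "1 \<le> cmod (H p)"
        by (rule LIMSEQ_le_const[OF tendsto_norm[OF Hq]]) (use gt1 qin in \<open>auto intro: less_imp_le\<close>)
    qed
    have key: "ln (cmod (H a)) \<le> 2 * (R * cmod ((H (q n) - H p) / (q n - p)))" for n
    proof -
      define s where "s = inverse (real (Suc n))"
      have s: "0 < s" "s \<le> 1" by (auto simp: s_def inverse_le_1_iff)
      let ?u = "Re (L (q n))" and ?v = "Re (L a)"
      have ain: "a \<in> ball a R" using R by simp
      have "R * \<bar>?u - ?v\<bar> \<le> R * (1 - s) * (?u + ?v)"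
        using Re_pos_Schwarz(1)[OF L(1) R Lpos qin[of n]] by (simp add: dq s_def)
      then have "\<bar>?u - ?v\<bar> \<le> (1 - s) * (?u + ?v)" using R by (simp add: mult.assoc)
      then have "s * ?v \<le> (2 - s) * ?u" by (simp add: algebra_simps abs_le_iff)
      also have "\<dots> \<le> 2 * ?u" using s Lpos[OF qin[of n]] by (simp add: algebra_simps)
      also have "?u \<le> cmod (H (q n)) - 1"
        using L(2)[OF qin[of n]] gt1[OF qin[of n]] ln_le_minus_one[of "cmod (H (q n))"] by linarith
      also have "\<dots> \<le> cmod (H (q n) - H p)" using Hp1 norm_triangle_ineq2 by metis
      finally have "s * ?v \<le> 2 * cmod (H (q n) - H p)" by simp
      moreover have "q n - p = of_real s * (a - p)" by (simp add: q_def s_def)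
      then have "cmod (q n - p) = s * R"
        using s by (simp add: norm_mult R_def dist_norm)
      ultimately have "?v \<le> 2 * (R * cmod ((H (q n) - H p) / (q n - p)))"
        using s R by (simp add: norm_divide field_simps)
      then show ?thesis using L(2)[OF ain] by simp
    qed
    have "(\<lambda>n. (H (q n) - H p) / (q n - p)) \<longlonglongrightarrow> deriv H p"
      using Hd qlim qne unfolding has_field_derivative_iff tendsto_at_iff_sequentially comp_def by auto
    then have "(\<lambda>n. 2 * (R * cmod ((H (q n) - H p) / (q n - p)))) \<longlonglongrightarrow> 2 * (R * cmod (deriv H p))"
      by (intro tendsto_intros)
    then have "ln (cmod (H a)) \<le> 2 * (R * cmod (deriv H p))"
      by (rule LIMSEQ_le_const) (use key in auto)
    \<comment> \<open>At \<open>p\<close> the modulus is 1, so the hypothesis reads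
      \<open>cmod (deriv H p) \<le> 2 * M\<close>; with the 2 from Harnack this makes the 4 of the
      conclusion.\<close>
    also have "\<dots> \<le> 2 * (dist a b * (2 * M))"
      using sph[OF p_in] Hp1 Rle M0 R by (intro mult_left_mono mult_mono) auto
    finally have "ln (cmod (H a)) \<le> 4 * M * dist a b" by (simp add: algebra_simps)
    moreover have "0 < cmod (H a)" using False by linarith
    ultimately show ?thesis by (metis exp_le_cancel_iff exp_ln)
  qed
qed

section \<open>Functions of exponential type and their logarithmic derivatives\<close>

text \<open>The summand 1 in the exponent makes one constant serve the whole plane, so that
  constants and polynomials qualify and the closure rules need no exceptional disc.\<close>

definition exp_type :: "(complex \<Rightarrow> complex) \<Rightarrow> bool" where
  "exp_type f \<longleftrightarrow> f holomorphic_on UNIV \<and> (\<exists>C. \<forall>z. cmod (f z) \<le> exp (C * (1 + cmod z)))"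

lemma exp_type_holomorphic: "exp_type f \<Longrightarrow> f holomorphic_on A"
  unfolding exp_type_def using holomorphic_on_subset by blast

lemma exp_typeE:
  assumes "exp_type f"
  obtains C where "0 \<le> C" "\<And>z. cmod (f z) \<le> exp (C * (1 + cmod z))"
proof -
  obtain C where C: "\<And>z. cmod (f z) \<le> exp (C * (1 + cmod z))"
    using assms unfolding exp_type_def by blast
  have "cmod (f z) \<le> exp (\<bar>C\<bar> * (1 + cmod z))" for z
    by (rule order_trans[OF C]) (simp add: mult_right_mono)
  then show thesis using that[of "\<bar>C\<bar>"] by simp
qed

lemma exp_type_const: "exp_type (\<lambda>_. c)"
proof -
  have "cmod c \<le> exp (cmod c * (1 + cmod z))" for z
  proof -
    have "cmod c \<le> exp (cmod c)" using exp_ge_add_one_self[of "cmod c"] by linarith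
    also have "\<dots> \<le> exp (cmod c * (1 + cmod z))" by (simp add: algebra_simps)
    finally show ?thesis .
  qed
  then show ?thesis unfolding exp_type_def by auto
qed

lemma exp_type_ident: "exp_type (\<lambda>z. z)"
proof -
  have "cmod z \<le> exp (1 * (1 + cmod z))" for z
    using exp_ge_add_one_self[of "1 + cmod z"] by simp
  then show ?thesis unfolding exp_type_def by (intro conjI exI[of _ 1]) (auto intro: holomorphic_intros)
qed

lemma exp_type_mult:
  assumes "exp_type f" "exp_type g" shows "exp_type (\<lambda>z. f z * g z)"
proof -
  obtain C D where C: "\<And>z. cmod (f z) \<le> exp (C * (1 + cmod z))"
    and D: "\<And>z. cmod (g z) \<le> exp (D * (1 + cmod z))" using assms exp_typeE by metis
  have "cmod (f z * g z) \<le> exp ((C + D) * (1 + cmod z))" for z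
    using mult_mono[OF C D, of z z] by (simp add: norm_mult exp_add[symmetric] algebra_simps)
  then show ?thesis using assms unfolding exp_type_def by (auto intro!: holomorphic_intros)
qed

lemma exp_type_add:
  assumes "exp_type f" "exp_type g" shows "exp_type (\<lambda>z. f z + g z)"
proof -
  obtain C D where C: "0 \<le> C" "\<And>z. cmod (f z) \<le> exp (C * (1 + cmod z))"
    and D: "0 \<le> D" "\<And>z. cmod (g z) \<le> exp (D * (1 + cmod z))" using assms exp_typeE by metis
  have "cmod (f z + g z) \<le> exp ((C + D + 1) * (1 + cmod z))" for z
  proof -
    let ?m = "exp ((C + D) * (1 + cmod z))"
    have "cmod (f z) \<le> ?m" by (rule order_trans[OF C(2)]) (simp add: mult_right_mono D)
    moreover have "cmod (g z) \<le> ?m" by (rule order_trans[OF D(2)]) (simp add: mult_right_mono C)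
    ultimately have "cmod (f z + g z) \<le> 2 * ?m" using norm_triangle_ineq[of "f z" "g z"] by linarith
    also have "\<dots> \<le> exp (1 + cmod z) * ?m"
    proof (rule mult_right_mono)
      show "2 \<le> exp (1 + cmod z)"
        using exp_ge_add_one_self[of "1 + cmod z"] norm_ge_zero[of z] by linarith
    qed simp
    finally show ?thesis by (simp add: exp_add[symmetric] algebra_simps)
  qed
  then show ?thesis using assms unfolding exp_type_def by (auto intro!: holomorphic_intros)
qed

lemma exp_type_diff:
  assumes "exp_type f" "exp_type g" shows "exp_type (\<lambda>z. f z - g z)"
  using exp_type_add[OF assms(1) exp_type_mult[OF exp_type_const[of "-1"] assms(2)]] by simp

lemma exp_type_power: "exp_type f \<Longrightarrow> exp_type (\<lambda>z. f z ^ n)"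
  by (induction n) (auto intro: exp_type_mult exp_type_const)

lemma exp_type_prod:
  "(\<And>f. f \<in> S \<Longrightarrow> exp_type f) \<Longrightarrow> exp_type (\<lambda>z. \<Prod>f\<in>S. f z)"
  by (induction S rule: infinite_finite_induct) (auto intro: exp_type_mult exp_type_const)

lemma exp_type_poly: "exp_type (poly p)"
  by (induction p) (auto intro!: exp_type_mult exp_type_const exp_type_add exp_type_ident)

lemma exp_type_deriv:
  assumes "exp_type f" shows "exp_type (deriv f)"
proof -
  obtain C where C: "0 \<le> C" "\<And>z. cmod (f z) \<le> exp (C * (1 + cmod z))"
    using assms exp_typeE by metis
  have "cmod (deriv f z) \<le> exp (2 * C * (1 + cmod z))" for z
  proof -
    have "cmod ((deriv ^^ 1) f z) \<le> fact 1 * exp (2 * C * (1 + cmod z)) / 1 ^ 1"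
    proof (rule Cauchy_inequality)
      fix w assume w: "cmod (z - w) = 1"
      have "cmod w \<le> cmod z + 1" using norm_triangle_ineq4[of z "z - w"] w by simp
      then have "C * (1 + cmod w) \<le> 2 * C * (1 + cmod z)"
        unfolding mult.assoc mult.left_commute[of 2]
        using C(1) by (intro mult_left_mono) (simp_all, use norm_ge_zero[of z] in linarith)
      then show "cmod (f w) \<le> exp (2 * C * (1 + cmod z))"
        using C(2)[of w] by (meson exp_le_cancel_iff order_trans)
    qed (use exp_type_holomorphic[OF assms] holomorphic_on_imp_continuous_on in auto)
    then show ?thesis by simp
  qed
  then show ?thesis using assms unfolding exp_type_def
    by (auto intro!: holomorphic_deriv[of f UNIV])
qed

lemma exp_type_shift:
  assumes "exp_type f" shows "exp_type (\<lambda>z. f (a + z))"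
proof -
  obtain C where C: "0 \<le> C" "\<And>z. cmod (f z) \<le> exp (C * (1 + cmod z))"
    using assms exp_typeE by metis
  have "cmod (f (a + z)) \<le> exp (C * (1 + cmod a) * (1 + cmod z))" for z
  proof -
    have "0 \<le> cmod a * cmod z" by simp
    then have "1 + cmod (a + z) \<le> (1 + cmod a) * (1 + cmod z)"
      unfolding distrib_left distrib_right using norm_triangle_ineq[of a z] by linarith
    then have "C * (1 + cmod (a + z)) \<le> C * (1 + cmod a) * (1 + cmod z)"
      unfolding mult.assoc using C(1) by (rule mult_left_mono)
    then show ?thesis using C(2)[of "a + z"] by (meson exp_le_cancel_iff order_trans)
  qed
  moreover have "(\<lambda>z. f (a + z)) holomorphic_on UNIV"
    using holomorphic_on_compose[of "\<lambda>z. a + z" UNIV f, unfolded o_def] exp_type_holomorphic[OF assms]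
    by (simp add: holomorphic_on_add holomorphic_on_ident)
  ultimately show ?thesis unfolding exp_type_def by blast
qed

text \<open>A substitute for Jensen's formula, with linear factors in place of Blaschke factors. On
  the circle of radius \<open>4 * R\<close> each factor \<open>z - a i\<close> has modulus at least
  \<open>3 * R\<close>, at the origin at most \<open>R\<close>; the maximum principle for
  \<open>G\<close> on the large disc then bounds the number of zeros through
  \<open>3 ^ n * cmod (F 0) \<le> M\<close>.\<close>

lemma factor_out_zeros:
  fixes F :: "complex \<Rightarrow> complex"
  assumes hol: "F holomorphic_on UNIV" and F0: "F 0 \<noteq> 0" and R: "0 < R"
    and M: "\<And>z. z \<in> cball 0 (4 * R) \<Longrightarrow> cmod (F z) \<le> M"
  obtains n a G where "G holomorphic_on UNIV"
    "\<forall>i<n. a i \<in> cball 0 R \<and> F (a i) = 0"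
    "\<forall>z. F z = (\<Prod>i<n. z - a i) * G z" "\<forall>z\<in>cball 0 R. G z \<noteq> 0"
    "3 ^ n * cmod (F 0) \<le> M" "\<forall>z\<in>cball 0 R. cmod (G z) \<le> M / (3 * R) ^ n"
    "cmod (F 0) \<le> R ^ n * cmod (G 0)"
proof -
  define P where "P n a G \<longleftrightarrow> G holomorphic_on UNIV \<and> (\<forall>i<n. a i \<in> cball 0 R) \<and>
     (\<forall>z. F z = (\<Prod>i<n. z - a i) * G z)" for n and a :: "nat \<Rightarrow> complex" and G
  have b1: "cmod (G z) \<le> M / (3 * R) ^ n" if P: "P n a G" and z: "z \<in> cball 0 (4 * R)" for n a G z
  proof (rule maximum_modulus_frontier[of G "cball 0 (4 * R)"])
    show "G holomorphic_on interior (cball 0 (4 * R))" "continuous_on (closure (cball 0 (4 * R))) G"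
      using P unfolding P_def
      by (auto intro: holomorphic_on_subset holomorphic_on_imp_continuous_on continuous_on_subset)
    show "bounded (cball (0::complex) (4 * R))" "z \<in> cball 0 (4 * R)" using z by auto
    fix w :: complex assume "w \<in> frontier (cball 0 (4 * R))"
    then have w: "cmod w = 4 * R" using R by (simp add: frontier_cball)
    have "(3 * R) ^ n = (\<Prod>i<n. 3 * R)" by simp
    also have "\<dots> \<le> (\<Prod>i<n. cmod (w - a i))"
    proof (rule prod_mono)
      fix i assume "i \<in> {..<n}"
      then have "cmod (a i) \<le> R" using P by (auto simp: P_def)
      then show "0 \<le> 3 * R \<and> 3 * R \<le> cmod (w - a i)"
        using norm_triangle_ineq2[of w "a i"] w R by auto
    qed
    finally have "(3 * R) ^ n * cmod (G w) \<le> (\<Prod>i<n. cmod (w - a i)) * cmod (G w)"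
      by (rule mult_right_mono) simp
    also have "\<dots> = cmod (F w)" using P unfolding P_def by (metis norm_mult prod_norm)
    also have "\<dots> \<le> M" using M w by simp
    finally show "cmod (G w) \<le> M / (3 * R) ^ n" using R by (simp add: field_simps)
  qed
  have b2: "cmod (F 0) \<le> R ^ n * cmod (G 0)" if P: "P n a G" for n a G
  proof -
    have "(\<Prod>i<n. cmod (0 - a i)) \<le> (\<Prod>i<n. R)"
      using P by (intro prod_mono) (auto simp: P_def)
    then have "(\<Prod>i<n. cmod (0 - a i)) * cmod (G 0) \<le> R ^ n * cmod (G 0)"
      by (simp add: mult_right_mono)
    moreover have "cmod (F 0) = (\<Prod>i<n. cmod (0 - a i)) * cmod (G 0)"
      using P unfolding P_def by (metis norm_mult prod_norm)
    ultimately show ?thesis by simp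
  qed
  have b3: "3 ^ n * cmod (F 0) \<le> M" if P: "P n a G" for n a G
  proof -
    have "cmod (F 0) \<le> R ^ n * (M / (3 * R) ^ n)"
      using b2[OF P] b1[OF P, of 0] R
      by (meson mult_left_mono order_trans zero_le_power less_imp_le centre_in_cball mult_nonneg_nonneg zero_le_numeral)
    then show ?thesis using R by (simp add: power_mult_distrib field_simps)
  qed
  define b where "b = nat \<lceil>M / cmod (F 0)\<rceil>"
  have P0: "\<exists>a G. P 0 a G" using hol by (auto simp: P_def)
  have bdd: "\<forall>n. (\<exists>a G. P n a G) \<longrightarrow> n \<le> b"
  proof (intro allI impI)
    fix n assume "\<exists>a G. P n a G"
    then have "3 ^ n * cmod (F 0) \<le> M" using b3 by blast
    then have "3 ^ n \<le> M / cmod (F 0)" using F0 by (simp add: field_simps)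
    moreover have "real n \<le> 3 ^ n"
      using Bernoulli_inequality[of 2 n] by simp
    ultimately have "real n \<le> M / cmod (F 0)" by linarith
    then show "n \<le> b" unfolding b_def by linarith
  qed
  \<comment> \<open>The bound on \<open>n\<close> makes a maximal factorisation exist. Its cofactor
    cannot vanish on \<open>cball 0 R\<close>, since one more linear factor could be split
    off.\<close>
  define n where "n = (GREATEST n. \<exists>a G. P n a G)"
  have max: "m \<le> n" if "\<exists>a G. P m a G" for m
    unfolding n_def by (rule Greatest_le_nat[of "\<lambda>n. \<exists>a G. P n a G" m b]) (use that bdd in auto)
  have "\<exists>a G. P n a G"
    unfolding n_def by (rule GreatestI_nat[of "\<lambda>n. \<exists>a G. P n a G" 0 b]) (use P0 bdd in auto)
  then obtain a G where P: "P n a G" by blast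
  have nz: "G c \<noteq> 0" if c: "c \<in> cball 0 R" for c
  proof
    assume Gc: "G c = 0"
    define G' where "G' z = (if z = c then deriv G c else (G z - G c) / (z - c))" for z
    have "G' holomorphic_on UNIV"
      unfolding G'_def using P by (intro pole_lemma_open) (auto simp: P_def)
    moreover have "G z = (z - c) * G' z" for z using Gc by (simp add: G'_def)
    ultimately have "P (Suc n) (a(n := c)) G'"
      using P c unfolding P_def by (auto simp: less_Suc_eq mult.assoc)
    then show False using max[of "Suc n"] by auto
  qed
  have z: "F (a i) = 0" if "i < n" for i
  proof -
    have "(\<Prod>j<n. a i - a j) = 0" using that by (intro prod_zero) auto
    then show ?thesis using P by (simp add: P_def)
  qed
  show thesis
    by (rule that[of G n a]) (use P nz z b1[OF P] b2[OF P] b3[OF P] R in \<open>auto simp: P_def\<close>)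
qed

lemma has_field_derivative_prod_linear:
  fixes a :: "nat \<Rightarrow> complex"
  assumes "\<And>i. i < n \<Longrightarrow> z \<noteq> a i"
  shows "((\<lambda>z. \<Prod>i<n. z - a i) has_field_derivative (\<Prod>i<n. z - a i) * (\<Sum>i<n. 1 / (z - a i))) (at z)"
  using assms
proof (induction n)
  case (Suc n)
  then have IH: "((\<lambda>z. \<Prod>i<n. z - a i) has_field_derivative (\<Prod>i<n. z - a i) * (\<Sum>i<n. 1 / (z - a i))) (at z)"
    by simp
  have "z - a n \<noteq> 0" using Suc.prems by simp
  then show ?case
    by (auto intro!: derivative_eq_intros IH simp: field_simps)
qed simp

text \<open>Take \<open>F\<close> as \<open>n\<close> linear factors times a zero-free
  \<open>G\<close>. The factors contribute at most \<open>n / d\<close> to the logarithmic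
  derivative, with \<open>n = O(r)\<close> by the Jensen-type bound. A constant minus
  \<open>log G\<close> has positive real part, of size \<open>O(r)\<close> at the origin, so Harnack
  and the gradient estimate on a disc of radius comparable to \<open>r\<close> bound its derivative
  by a constant.\<close>

lemma exp_type_zeros_and_log_deriv:
  assumes F: "exp_type F" and F0: "F 0 \<noteq> 0"
  shows "\<exists>K::real. 0 \<le> K \<and> (\<forall>r::real. 1 \<le> r \<longrightarrow> finite {z \<in> cball 0 (4 * r). F z = 0} \<and>
     real (card {z \<in> cball 0 (4 * r). F z = 0}) \<le> K * r \<and>
     (\<forall>d z. 0 < d \<longrightarrow> d \<le> 1 \<longrightarrow> cmod z \<le> 2 * r \<longrightarrow>
       (\<forall>a\<in>cball 0 (4 * r). F a = 0 \<longrightarrow> d \<le> cmod (z - a)) \<longrightarrow>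
       cmod (deriv F z) \<le> K * r / d * cmod (F z)))"
proof -
  obtain C where C: "0 \<le> C" "\<And>z. cmod (F z) \<le> exp (C * (1 + cmod z))"
    using F exp_typeE by metis
  have hol: "F holomorphic_on UNIV" using F exp_type_holomorphic by blast
  \<comment> \<open>\<open>F\<close> is estimated on the disc of radius
    \<open>4 * R = 16 * r\<close>, where the exponent is at most
    \<open>C * (1 + 16 * r) \<le> 17 * C * r\<close> because \<open>1 \<le> r\<close>.\<close>
  define K0 where "K0 = 17 * C + \<bar>ln (cmod (F 0))\<bar>"
  have K0: "0 \<le> K0" using C by (simp add: K0_def)
  \<comment> \<open>\<open>K0\<close> pays for the zeros and \<open>3 * (1 + K0)\<close> for the
    zero-free factor.\<close>
  define K where "K = 4 * K0 + 3"
  have main: "finite {z \<in> cball 0 (4 * r). F z = 0} \<and>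
     real (card {z \<in> cball 0 (4 * r). F z = 0}) \<le> K * r \<and>
     (\<forall>d z. 0 < d \<longrightarrow> d \<le> 1 \<longrightarrow> cmod z \<le> 2 * r \<longrightarrow>
       (\<forall>a\<in>cball 0 (4 * r). F a = 0 \<longrightarrow> d \<le> cmod (z - a)) \<longrightarrow>
       cmod (deriv F z) \<le> K * r / d * cmod (F z))" if r: "1 \<le> r" for r
  proof -
    define R where "R = 4 * r"
    have R: "0 < R" using r by (simp add: R_def)
    define M where "M = exp (C * (1 + 4 * R))"
    have MF: "cmod (F z) \<le> M" if "z \<in> cball 0 (4 * R)" for z
      by (rule order_trans[OF C(2)]) (use that C in \<open>auto simp: M_def intro!: mult_left_mono\<close>)
    obtain n a G where G: "G holomorphic_on UNIV"
      and facts: "\<forall>i<n. a i \<in> cball 0 R \<and> F (a i) = 0"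
        "\<forall>z. F z = (\<Prod>i<n. z - a i) * G z" "\<forall>z\<in>cball 0 R. G z \<noteq> 0"
        "\<forall>z\<in>cball 0 R. cmod (G z) \<le> M / (3 * R) ^ n"
      and n: "3 ^ n * cmod (F 0) \<le> M" and G0: "cmod (F 0) \<le> R ^ n * cmod (G 0)"
      by (rule factor_out_zeros[OF hol F0 R MF])
    have a: "a i \<in> cball 0 R" "F (a i) = 0" if "i < n" for i using facts(1) that by auto
    have eq: "F z = (\<Prod>i<n. z - a i) * G z" for z using facts(2) by blast
    have nz: "G z \<noteq> 0" and GM: "cmod (G z) \<le> M / (3 * R) ^ n" if "z \<in> cball 0 R" for z
      using facts(3,4) that by auto
    define \<Lambda> where "\<Lambda> = ln M - ln (cmod (F 0))"
    have Lam: "\<Lambda> \<le> K0 * r"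
    proof -
      have "\<Lambda> \<le> C * (1 + 16 * r) + \<bar>ln (cmod (F 0))\<bar>" by (simp add: \<Lambda>_def M_def R_def)
      also have "\<dots> \<le> C * (17 * r) + \<bar>ln (cmod (F 0))\<bar> * r"
        using r C by (intro add_mono mult_left_mono) (auto simp: mult_le_cancel_left1)
      finally show ?thesis by (simp add: K0_def algebra_simps)
    qed
    have M0: "0 < M" by (simp add: M_def)
    have nLam: "real n \<le> \<Lambda>"
    proof -
      have "ln (3 ^ n * cmod (F 0)) \<le> ln M" using n F0 M0 by (subst ln_le_cancel_iff) auto
      then have "real n * ln 3 \<le> \<Lambda>" using F0 by (simp add: \<Lambda>_def ln_mult ln_realpow)
      moreover have "real n * 1 \<le> real n * ln 3" using ln3_gt_1 by (intro mult_left_mono) auto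
      ultimately show ?thesis by linarith
    qed
    have Zsub: "{z \<in> cball 0 (4 * r). F z = 0} \<subseteq> a ` {..<n}"
    proof
      fix z assume "z \<in> {z \<in> cball 0 (4 * r). F z = 0}"
      then have "(\<Prod>i<n. z - a i) = 0" using eq[of z] nz[of z] by (auto simp: R_def)
      then show "z \<in> a ` {..<n}" by auto
    qed
    have fin: "finite {z \<in> cball 0 (4 * r). F z = 0}" using Zsub finite_subset by blast
    have "card {z \<in> cball 0 (4 * r). F z = 0} \<le> card (a ` {..<n})" using Zsub by (intro card_mono) auto
    also have "\<dots> \<le> n" using card_image_le[of "{..<n}" a] by simp
    finally have "real (card {z \<in> cball 0 (4 * r). F z = 0}) \<le> K0 * r" using nLam Lam by linarith
    moreover have "K0 * r \<le> K * r" using r K0 by (simp add: K_def)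
    ultimately have card: "real (card {z \<in> cball 0 (4 * r). F z = 0}) \<le> K * r" by linarith
    obtain L where L: "L holomorphic_on ball 0 R" "\<And>z. z \<in> ball 0 R \<Longrightarrow> Re (L z) = ln (cmod (G z))"
      "\<And>z. z \<in> ball 0 R \<Longrightarrow> deriv G z = G z * deriv L z"
    proof (rule holomorphic_branch_log_ball[of G 0 R])
      show "G holomorphic_on ball 0 R" using G holomorphic_on_subset by blast
      show "G z \<noteq> 0" if "z \<in> ball 0 R" for z using nz that by auto
    qed blast
    \<comment> \<open>The factor \<open>exp 1\<close> keeps the real part of \<open>f\<close> at
      least 1, hence positive even where \<open>G\<close> attains its bound.\<close>
    define B where "B = exp 1 * (M / (3 * R) ^ n)"
    have B0: "0 < B" using M0 R by (simp add: B_def)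
    have lnB: "ln B = 1 + ln (M / (3 * R) ^ n)" using M0 R unfolding B_def by (subst ln_mult) auto
    define f where "f z = of_real (ln B) - L z" for z
    have fhol: "f holomorphic_on ball 0 R" unfolding f_def by (intro holomorphic_intros L)
    have Ref: "Re (f z) = 1 + ln (M / (3 * R) ^ n) - ln (cmod (G z))" if "z \<in> ball 0 R" for z
      using L(2)[OF that] lnB by (simp add: f_def)
    have fpos: "0 < Re (f z)" if z: "z \<in> ball 0 R" for z
    proof -
      have "ln (cmod (G z)) \<le> ln (M / (3 * R) ^ n)"
        using GM[of z] nz[of z] z M0 R by (subst ln_le_cancel_iff) auto
      then show ?thesis using Ref[OF z] by linarith
    qed
    have f0: "Re (f 0) \<le> 1 + \<Lambda>"
    proof -
      have G00: "0 < cmod (G 0)" using nz[of 0] R by simp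
      have "ln (cmod (F 0)) \<le> ln (R ^ n * cmod (G 0))"
        using G0 F0 G00 R by (subst ln_le_cancel_iff) auto
      then have 1: "ln (cmod (F 0)) \<le> n * ln R + ln (cmod (G 0))"
        using R G00 by (simp add: ln_mult ln_realpow)
      have "ln (M / (3 * R) ^ n) = ln M - n * (ln 3 + ln R)"
        using M0 R by (simp add: ln_div ln_realpow ln_mult distrib_left del: mult_eq_0_iff)
      then have "ln (M / (3 * R) ^ n) \<le> ln M - n * ln R" using R by (simp add: distrib_left)
      then show ?thesis using 1 Ref[of 0] R by (simp add: \<Lambda>_def)
    qed
    have bound: "cmod (deriv F z) \<le> K * r / d * cmod (F z)"
      if d: "0 < d" "d \<le> 1" and z: "cmod z \<le> 2 * r"
        and far: "\<And>a. a \<in> cball 0 (4 * r) \<Longrightarrow> F a = 0 \<Longrightarrow> d \<le> cmod (z - a)" for d z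
    proof -
      have zR: "cmod z \<le> R / 2" using z by (simp add: R_def)
      have z_in: "z \<in> ball 0 R" using zR R by simp
      have "R * \<bar>Re (f z) - Re (f 0)\<bar> \<le> cmod z * (Re (f z) + Re (f 0))"
        using Re_pos_Schwarz(1)[OF fhol R fpos z_in] by simp
      also have "\<dots> \<le> R / 2 * (Re (f z) + Re (f 0))"
        using fpos[OF z_in] fpos[of 0] R zR by (intro mult_right_mono) auto
      finally have "R * \<bar>Re (f z) - Re (f 0)\<bar> \<le> R * ((Re (f z) + Re (f 0)) / 2)" by simp
      then have "\<bar>Re (f z) - Re (f 0)\<bar> \<le> (Re (f z) + Re (f 0)) / 2" using R by simp
      \<comment> \<open>On the disc of half the radius, Harnack costs the factor (1 + 1/2) / (1 -
        1/2) = 3.\<close>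
      then have f3: "Re (f z) \<le> 3 * Re (f 0)" using abs_ge_self[of "Re (f z) - Re (f 0)"] by argo
      have sub: "ball z (R / 2) \<subseteq> ball 0 R"
      proof
        fix w assume "w \<in> ball z (R / 2)"
        then show "w \<in> ball 0 R" using zR norm_triangle_ineq[of z "w - z"]
          by (simp add: dist_norm norm_minus_commute)
      qed
      have "R / 2 * cmod (deriv f z) \<le> 2 * Re (f z)"
        by (rule Re_pos_Schwarz(2)) (use fhol sub R fpos holomorphic_on_subset in auto)
      also have "\<dots> \<le> 6 * (1 + \<Lambda>)" using f3 f0 by argo
      finally have "R * cmod (deriv f z) \<le> 12 * (1 + \<Lambda>)" by simp
      moreover have "12 * (1 + \<Lambda>) \<le> 12 * ((1 + K0) * r)" using Lam r by (simp add: algebra_simps)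
      ultimately have "r * cmod (deriv f z) \<le> r * (3 * (1 + K0))" by (simp add: R_def algebra_simps)
      then have df: "cmod (deriv f z) \<le> 3 * (1 + K0)" using r by simp
      have Lz: "(L has_field_derivative deriv L z) (at z)"
        using L(1) z_in by (intro holomorphic_derivI) auto
      have "(f has_field_derivative - deriv L z) (at z)"
        unfolding f_def by (auto intro!: derivative_eq_intros Lz)
      then have dfL: "cmod (deriv f z) = cmod (deriv L z)" using DERIV_imp_deriv by fastforce
      have zne: "z \<noteq> a i" if "i < n" for i
        using far[of "a i"] a[OF that] d by (auto simp: R_def)
      have Gz: "(G has_field_derivative G z * deriv L z) (at z)"
        using G L(3)[OF z_in] by (metis UNIV_I holomorphic_derivI open_UNIV)
      have "F = (\<lambda>z. (\<Prod>i<n. z - a i) * G z)" using eq by blast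
      then have "(F has_field_derivative F z * ((\<Sum>i<n. 1 / (z - a i)) + deriv L z)) (at z)"
        using DERIV_mult[OF has_field_derivative_prod_linear[OF zne, of n] Gz]
        by (simp add: algebra_simps)
      then have "deriv F z = F z * ((\<Sum>i<n. 1 / (z - a i)) + deriv L z)" by (rule DERIV_imp_deriv)
      moreover have "cmod ((\<Sum>i<n. 1 / (z - a i)) + deriv L z) \<le> K * r / d"
      proof -
        have "cmod (\<Sum>i<n. 1 / (z - a i)) \<le> (\<Sum>i<n. 1 / d)"
        proof (rule sum_norm_le)
          fix i assume "i \<in> {..<n}"
          then have "d \<le> cmod (z - a i)" using far a by (auto simp: R_def)
          then show "cmod (1 / (z - a i)) \<le> 1 / d"
            using d by (simp add: norm_divide frac_le)
        qed
        also have "\<dots> = n / d" by simp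
        also have "\<dots> \<le> K0 * r / d" using nLam Lam d by (intro divide_right_mono) auto
        finally have "cmod ((\<Sum>i<n. 1 / (z - a i)) + deriv L z) \<le> K0 * r / d + 3 * (1 + K0)"
          using norm_triangle_ineq[of "\<Sum>i<n. 1 / (z - a i)" "deriv L z"] df dfL by linarith
        moreover have "3 * (1 + K0) \<le> 3 * (1 + K0) * (r / d)"
        proof -
          have "1 \<le> r / d" using r d by simp
          then have "3 * (1 + K0) * 1 \<le> 3 * (1 + K0) * (r / d)"
            using K0 by (intro mult_left_mono) auto
          then show ?thesis by simp
        qed
        moreover have "K0 * r / d + 3 * (1 + K0) * (r / d) = K * r / d"
          by (simp add: K_def add_divide_distrib algebra_simps)
        ultimately show ?thesis by linarith
      qed
      ultimately show ?thesis
        using mult_left_mono[of "cmod ((\<Sum>i<n. 1 / (z - a i)) + deriv L z)" "K * r / d" "cmod (F z)"]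
        by (simp add: norm_mult mult.commute)
    qed
    show ?thesis using fin card bound by blast
  qed
  moreover have "0 \<le> K" using K0 by (simp add: K_def)
  ultimately show ?thesis by blast
qed

text \<open>A measure argument: the intervals of radius \<open>d\<close> around the points of
  \<open>Z\<close> have total length at most \<open>2 * d * card Z\<close>, too little to cover
  \<open>{r..2 * r}\<close>.\<close>

lemma radius_avoiding_finite:
  fixes Z :: "real set" and d r :: real
  assumes "finite Z" "2 * d * card Z < r" "0 < d"
  obtains \<rho> where "r \<le> \<rho>" "\<rho> \<le> 2 * r" "\<And>x. x \<in> Z \<Longrightarrow> d \<le> \<bar>\<rho> - x\<bar>"
proof -
  have "0 \<le> 2 * d * card Z" using assms(3) by simp
  then have r: "0 < r" using assms(2) by linarith
  have "\<not> {r..2 * r} \<subseteq> (\<Union>x\<in>Z. {x - d<..<x + d})"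
  proof
    assume sub: "{r..2 * r} \<subseteq> (\<Union>x\<in>Z. {x - d<..<x + d})"
    have "ennreal r = emeasure lborel {r..2 * r}" using r by simp
    also have "\<dots> \<le> emeasure lborel (\<Union>x\<in>Z. {x - d<..<x + d})"
      using sub assms(1) by (intro emeasure_mono) (auto intro!: sets.finite_UN)
    also have "\<dots> \<le> (\<Sum>x\<in>Z. emeasure lborel {x - d<..<x + d})"
      using assms(1) by (intro emeasure_subadditive_finite) auto
    also have "\<dots> = (\<Sum>x\<in>Z. ennreal (2 * d))" using assms(3) by (intro sum.cong) auto
    also have "\<dots> = ennreal (2 * d * card Z)"
      using assms(3) by (simp add: ennreal_mult ennreal_of_nat_eq_real_of_nat mult.commute)
    finally show False using assms(2,3) r by (simp add: ennreal_le_iff2)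
  qed
  then obtain \<rho> where \<rho>: "\<rho> \<in> {r..2 * r}" "\<rho> \<notin> (\<Union>x\<in>Z. {x - d<..<x + d})" by blast
  show thesis
  proof (rule that[of \<rho>])
    show "d \<le> \<bar>\<rho> - x\<bar>" if "x \<in> Z" for x using \<rho>(2) that by (force simp: abs_if not_less)
  qed (use \<rho> in auto)
qed

text \<open>Used to choose a common centre for the circles: a finite union of countable zero sets
  misses some point of the plane.\<close>

lemma exp_type_countable_zeros:
  assumes "exp_type F" "F \<noteq> (\<lambda>_. 0)"
  shows "countable {z. F z = 0}"
proof -
  show ?thesis
  proof (cases "F constant_on UNIV")
    case True
    then obtain c where "\<And>z. F z = c" unfolding constant_on_def by auto
    moreover from this have "c \<noteq> 0" using assms(2) by auto
    ultimately show ?thesis by simp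
  next
    case False
    then show ?thesis
      using holomorphic_countable_zeros[of F UNIV] exp_type_holomorphic[OF assms(1)]
        by (simp add: connected_UNIV)
  qed
qed

section \<open>Polynomial bounds on circles\<close>

text \<open>One centre, and one circle in every range from \<open>R\<close> to \<open>2 * R\<close>:
  this is what the maximum principle needs. Recording a set of points rather than of radii lets
  pointwise bounds be combined by simple closure rules.\<close>

definition circle_set :: "complex set \<Rightarrow> bool" where
  "circle_set G \<longleftrightarrow> (\<exists>z0 R0. \<forall>R\<ge>R0. \<exists>r. R \<le> r \<and> r \<le> 2 * R \<and> sphere z0 r \<subseteq> G)"

definition poly_bounded_on :: "complex set \<Rightarrow> (complex \<Rightarrow> complex) \<Rightarrow> bool" where
  "poly_bounded_on G f \<longleftrightarrow> (\<exists>C N. 0 \<le> C \<and> (\<forall>z\<in>G. cmod (f z) \<le> C * (1 + cmod z) ^ N))"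

lemma poly_bounded_onI:
  assumes "0 \<le> C" "\<And>z. z \<in> G \<Longrightarrow> cmod (f z) \<le> C * (1 + cmod z) ^ N"
  shows "poly_bounded_on G f"
  using assms unfolding poly_bounded_on_def by blast

lemma poly_bounded_on_cong:
  assumes "poly_bounded_on G f" "\<And>z. z \<in> G \<Longrightarrow> f z = g z" shows "poly_bounded_on G g"
  using assms unfolding poly_bounded_on_def by simp

lemma poly_bounded_on_subset: "poly_bounded_on G f \<Longrightarrow> G' \<subseteq> G \<Longrightarrow> poly_bounded_on G' f"
  unfolding poly_bounded_on_def by blast

lemma poly_bounded_on_const: "poly_bounded_on G (\<lambda>_. c)"
  by (rule poly_bounded_onI[of "cmod c" _ _ 0]) auto

lemma poly_bounded_on_ident: "poly_bounded_on G (\<lambda>z. z)"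
  by (rule poly_bounded_onI[of 1 _ _ 1]) auto

lemma poly_bounded_on_mult:
  assumes "poly_bounded_on G f" "poly_bounded_on G g"
  shows "poly_bounded_on G (\<lambda>z. f z * g z)"
proof -
  obtain C N where C: "0 \<le> C" "\<And>z. z \<in> G \<Longrightarrow> cmod (f z) \<le> C * (1 + cmod z) ^ N"
    using assms(1) unfolding poly_bounded_on_def by blast
  obtain D M where D: "0 \<le> D" "\<And>z. z \<in> G \<Longrightarrow> cmod (g z) \<le> D * (1 + cmod z) ^ M"
    using assms(2) unfolding poly_bounded_on_def by blast
  show ?thesis
  proof (rule poly_bounded_onI[of "C * D" _ _ "N + M"])
    fix z assume z: "z \<in> G"
    have "cmod (f z) * cmod (g z) \<le> (C * (1 + cmod z) ^ N) * (D * (1 + cmod z) ^ M)"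
      using C D z by (intro mult_mono) auto
    then show "cmod (f z * g z) \<le> C * D * (1 + cmod z) ^ (N + M)"
      by (simp add: norm_mult power_add algebra_simps)
  qed (use C D in auto)
qed

lemma poly_bounded_on_add:
  assumes "poly_bounded_on G f" "poly_bounded_on G g"
  shows "poly_bounded_on G (\<lambda>z. f z + g z)"
proof -
  obtain C N where C: "0 \<le> C" "\<And>z. z \<in> G \<Longrightarrow> cmod (f z) \<le> C * (1 + cmod z) ^ N"
    using assms(1) unfolding poly_bounded_on_def by blast
  obtain D M where D: "0 \<le> D" "\<And>z. z \<in> G \<Longrightarrow> cmod (g z) \<le> D * (1 + cmod z) ^ M"
    using assms(2) unfolding poly_bounded_on_def by blast
  show ?thesis
  proof (rule poly_bounded_onI[of "C + D" _ _ "N + M"])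
    fix z assume z: "z \<in> G"
    have "cmod (f z) \<le> C * (1 + cmod z) ^ (N + M)"
      by (rule order_trans[OF C(2)[OF z]]) (use C in \<open>auto intro!: mult_left_mono power_increasing\<close>)
    moreover have "cmod (g z) \<le> D * (1 + cmod z) ^ (N + M)"
      by (rule order_trans[OF D(2)[OF z]]) (use D in \<open>auto intro!: mult_left_mono power_increasing\<close>)
    ultimately show "cmod (f z + g z) \<le> (C + D) * (1 + cmod z) ^ (N + M)"
      using norm_triangle_ineq[of "f z" "g z"] by (simp add: distrib_right)
  qed (use C D in auto)
qed

lemma poly_bounded_on_diff:
  assumes "poly_bounded_on G f" "poly_bounded_on G g"
  shows "poly_bounded_on G (\<lambda>z. f z - g z)"
  using poly_bounded_on_add[OF assms(1) poly_bounded_on_mult[OF poly_bounded_on_const[of _ "-1"] assms(2)]]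
  by simp

lemma poly_bounded_on_power: "poly_bounded_on G f \<Longrightarrow> poly_bounded_on G (\<lambda>z. f z ^ n)"
  by (induction n) (auto intro: poly_bounded_on_mult poly_bounded_on_const)

lemma poly_bounded_on_poly: "poly_bounded_on G (poly p)"
  by (induction p)
     (auto intro!: poly_bounded_on_mult poly_bounded_on_add poly_bounded_on_const poly_bounded_on_ident)

lemmas poly_bounded_intros = poly_bounded_on_const poly_bounded_on_ident poly_bounded_on_mult
  poly_bounded_on_add poly_bounded_on_diff poly_bounded_on_power poly_bounded_on_poly

lemma circle_set_Int_outside_ball:
  assumes "circle_set G" shows "circle_set (G \<inter> {z. A \<le> cmod z})"
proof -
  obtain z0 R0 where G: "\<And>R. R0 \<le> R \<Longrightarrow> \<exists>r. R \<le> r \<and> r \<le> 2 * R \<and> sphere z0 r \<subseteq> G"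
    using assms unfolding circle_set_def by blast
  have "\<exists>r. R \<le> r \<and> r \<le> 2 * R \<and> sphere z0 r \<subseteq> G \<inter> {z. A \<le> cmod z}"
    if R: "max R0 (A + cmod z0) \<le> R" for R
  proof -
    obtain r where r: "R \<le> r" "r \<le> 2 * R" "sphere z0 r \<subseteq> G" using G[of R] R by auto
    have "A \<le> cmod z" if "z \<in> sphere z0 r" for z
      using that r R norm_triangle_ineq4[of z z0] by (simp add: dist_norm norm_minus_commute)
    then show ?thesis using r by blast
  qed
  then show ?thesis unfolding circle_set_def by blast
qed

text \<open>For large \<open>z\<close>, the maximum principle on a circle of radius between
  \<open>2 * cmod z\<close> and \<open>4 * cmod z\<close> carries the bound to \<open>z\<close>, and
  Liouville's theorem for polynomial growth applies. The 6 in the proof is 1 + 1 + 4, from the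
  constant, the centre and the radius.\<close>

lemma entire_poly_bounded_on_circles_imp_poly:
  assumes hol: "f holomorphic_on UNIV" and G: "circle_set G" and pb: "poly_bounded_on G f"
  obtains p where "f = poly p"
proof -
  obtain z0 R0 where circ: "\<And>R. R0 \<le> R \<Longrightarrow> \<exists>r. R \<le> r \<and> r \<le> 2 * R \<and> sphere z0 r \<subseteq> G"
    using G unfolding circle_set_def by blast
  obtain C N where C: "0 \<le> C" "\<And>z. z \<in> G \<Longrightarrow> cmod (f z) \<le> C * (1 + cmod z) ^ N"
    using pb unfolding poly_bounded_on_def by blast
  define A where "A = \<bar>R0\<bar> + cmod z0 + 1"
  have bound: "cmod (f z) \<le> C * 6 ^ N * cmod z ^ N" if z: "A \<le> cmod z" for z
  proof -
    have big: "R0 \<le> 2 * cmod z" "cmod z0 \<le> cmod z" "1 \<le> cmod z"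
      using z norm_ge_zero[of z0] abs_ge_self[of R0] abs_ge_zero[of R0] norm_ge_zero[of z]
      unfolding A_def by linarith+
    obtain r where r: "2 * cmod z \<le> r" "r \<le> 2 * (2 * cmod z)" "sphere z0 r \<subseteq> G"
      using circ[OF big(1)] by blast
    have r0: "0 < r" using r big by linarith
    show ?thesis
    proof (rule maximum_modulus_frontier[of f "cball z0 r"])
      show "f holomorphic_on interior (cball z0 r)" "continuous_on (closure (cball z0 r)) f"
        using hol by (auto intro: holomorphic_on_subset holomorphic_on_imp_continuous_on continuous_on_subset)
      show "z \<in> cball z0 r"
        using norm_triangle_ineq4[of z0 z] big r by (simp add: dist_norm)
      fix w assume "w \<in> frontier (cball z0 r)"
      then have w: "w \<in> sphere z0 r" using r0 by (simp add: frontier_cball)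
      then have "cmod w \<le> cmod z0 + r" using norm_triangle_ineq[of z0 "w - z0"]
        by (simp add: dist_norm norm_minus_commute)
      then have "1 + cmod w \<le> 6 * cmod z" using r big by linarith
      then have "(1 + cmod w) ^ N \<le> (6 * cmod z) ^ N" by (intro power_mono) auto
      then have "C * (1 + cmod w) ^ N \<le> C * (6 * cmod z) ^ N" using C(1) by (rule mult_left_mono)
      then show "cmod (f w) \<le> C * 6 ^ N * cmod z ^ N"
        using C(2)[of w] w r(3) by (fastforce simp: power_mult_distrib)
    qed auto
  qed
  have "f z = poly (\<Sum>k\<le>N. monom ((deriv ^^ k) f 0 / fact k) k) z" for z
    using Liouville_polynomial[OF hol bound, where \<xi> = z] by (simp add: poly_sum poly_monom)
  then show thesis using that by blast
qed

lemma poly_bounded_below: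
  fixes p :: "complex poly"
  assumes "p \<noteq> 0"
  obtains A d where "0 < d" "\<And>z. A \<le> cmod z \<Longrightarrow> d \<le> cmod (poly p z)"
proof (cases "degree p = 0")
  case True
  then obtain c where c: "p = [:c:]" by (rule degree_eq_zeroE)
  then have "c \<noteq> 0" using assms by auto
  then show thesis using that[of "cmod c" 0] c by simp
next
  case False
  then have "filterlim (poly p) at_infinity at_infinity"
    by (intro filterlim_poly_at_infinity) auto
  then have "\<forall>\<^sub>F z in at_infinity. 1 \<le> cmod (poly p z)"
    using filterlim_at_infinity[of 0 "poly p"] by force
  then obtain A where "\<And>z. A \<le> cmod z \<Longrightarrow> 1 \<le> cmod (poly p z)"
    unfolding eventually_at_infinity by blast
  then show thesis using that[of 1] by force
qed

text \<open>Radii at which all logarithmic derivatives are bounded pointwise, so that no mean values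
  over circles (and no Nevanlinna theory) are needed.\<close>
lemma exp_type_circle_set:
  assumes fin: "finite S" and S: "\<And>F. F \<in> S \<Longrightarrow> exp_type F"
  obtains G where "circle_set G"
    "\<forall>F\<in>S. poly_bounded_on G (\<lambda>z. deriv F z / F z)"
    "\<forall>F\<in>S. F \<noteq> (\<lambda>_. 0) \<longrightarrow> (\<forall>z\<in>G. F z \<noteq> 0)"
proof -
  \<comment> \<open>The zero function has no isolated zeros to avoid and is set aside; its
    logarithmic derivative is 0 by the convention for division.\<close>
  define T where "T = {F \<in> S. F \<noteq> (\<lambda>_. 0)}"
  have T: "finite T" "\<And>F. F \<in> T \<Longrightarrow> exp_type F" "\<And>F. F \<in> T \<Longrightarrow> F \<noteq> (\<lambda>_. 0)"
    using fin S by (auto simp: T_def)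
  have "countable (\<Union>F\<in>T. {z. F z = 0})"
    by (rule countable_UN[OF countable_finite[OF T(1)]]) (use T exp_type_countable_zeros in blast)
  then have "(\<Union>F\<in>T. {z. F z = 0}) \<noteq> UNIV" using uncountable_UNIV_complex by metis
  then obtain z0 where z0: "\<And>F. F \<in> T \<Longrightarrow> F z0 \<noteq> 0" by blast
  have sh: "exp_type (\<lambda>z. F (z0 + z))" if "F \<in> T" for F using exp_type_shift T(2)[OF that] by blast
  \<comment> \<open>One product carries the zeros of all members of \<open>T\<close>, so a single
    radius avoids them all. The shift ensures \<open>\<Phi> 0 \<noteq> 0\<close>, which the zero
    count requires.\<close>
  define \<Phi> where "\<Phi> z = (\<Prod>F\<in>T. F (z0 + z))" for z
  have \<Phi>: "exp_type \<Phi>"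
  proof -
    have "exp_type (\<lambda>z. (\<Prod>F\<in>T. F z))" using T by (intro exp_type_prod) auto
    then show ?thesis unfolding \<Phi>_def by (rule exp_type_shift)
  qed
  have \<Phi>0: "\<Phi> 0 \<noteq> 0" using T(1) z0 by (simp add: \<Phi>_def)
  obtain K1 where K1: "0 \<le> K1"
    "\<And>r. 1 \<le> r \<Longrightarrow> finite {z \<in> cball 0 (4 * r). \<Phi> z = 0}"
    "\<And>r. 1 \<le> r \<Longrightarrow> real (card {z \<in> cball 0 (4 * r). \<Phi> z = 0}) \<le> K1 * r"
    using exp_type_zeros_and_log_deriv[OF \<Phi> \<Phi>0] by blast
  define Q where "Q F K \<longleftrightarrow> 0 \<le> K \<and> (\<forall>r d z. 1 \<le> r \<longrightarrow> 0 < d \<longrightarrow> d \<le> 1 \<longrightarrow> cmod z \<le> 2 * r \<longrightarrow>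
        (\<forall>a\<in>cball 0 (4 * r). F (z0 + a) = 0 \<longrightarrow> d \<le> cmod (z - a))
      \<longrightarrow> cmod (deriv F (z0 + z)) \<le> K * r / d * cmod (F (z0 + z)))" for F and K :: real
  have "\<exists>K. Q F K" if F: "F \<in> T" for F
  proof -
    have F0: "F (z0 + 0) \<noteq> 0" using z0[OF F] by simp
    have "((\<lambda>z. F (z0 + z)) has_field_derivative deriv F (z0 + z)) (at z)" for z
    proof -
      have "(F has_field_derivative deriv F (z0 + z)) (at (z0 + z))"
        using exp_type_holomorphic[OF T(2)[OF F], of UNIV] by (simp add: holomorphic_derivI)
      then have "((\<lambda>z. F (z0 + z)) has_field_derivative deriv F (z0 + z) * 1) (at z)"
        by (rule DERIV_chain2) (auto intro!: derivative_eq_intros)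
      then show ?thesis by simp
    qed
    then have "deriv (\<lambda>z. F (z0 + z)) z = deriv F (z0 + z)" for z by (rule DERIV_imp_deriv)
    then have dF: "deriv (\<lambda>z. F (z0 + z)) = (\<lambda>z. deriv F (z0 + z))" by blast
    show ?thesis
      using exp_type_zeros_and_log_deriv[OF sh[OF F] F0] unfolding dF Q_def by blast
  qed
  then obtain K where KQ: "\<And>F. F \<in> T \<Longrightarrow> Q F (K F)" by metis
  then have K: "0 \<le> K F" "\<And>r d z. \<lbrakk>1 \<le> r; 0 < d; d \<le> 1; cmod z \<le> 2 * r;
        \<forall>a\<in>cball 0 (4 * r). F (z0 + a) = 0 \<longrightarrow> d \<le> cmod (z - a)\<rbrakk>
      \<Longrightarrow> cmod (deriv F (z0 + z)) \<le> K F * r / d * cmod (F (z0 + z))" if "F \<in> T" for F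
    using that unfolding Q_def by simp_all
  \<comment> \<open>With at most \<open>K1 * R\<close> zeros, the excluded radii have total length
    at most \<open>2 * d * K1 * R\<close>, which this \<open>d\<close> keeps below
    \<open>R\<close>.\<close>
  define d where "d = 1 / (4 * (K1 + 1))"
  have d: "0 < d" "d \<le> 1" using K1 by (auto simp: d_def)
  define K' where "K' = (\<Sum>F\<in>T. K F) / d"
  have Kle: "K F / d \<le> K'" if "F \<in> T" for F
    unfolding K'_def using d T(1) K(1) that
    by (intro divide_right_mono member_le_sum) auto
  have K'0: "0 \<le> K'" using K(1) d by (auto simp: K'_def intro!: divide_nonneg_pos sum_nonneg)
  define G where "G = {z. \<forall>F\<in>S. (F \<noteq> (\<lambda>_. 0) \<longrightarrow> F z \<noteq> 0) \<and>
      cmod (deriv F z) \<le> K' * cmod (z - z0) * cmod (F z)}"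
  have "\<exists>r. R \<le> r \<and> r \<le> 2 * R \<and> sphere z0 r \<subseteq> G" if R: "1 \<le> R" for R
  proof -
    define Z where "Z = {z \<in> cball 0 (4 * R). \<Phi> z = 0}"
    have Z: "finite Z" "real (card Z) \<le> K1 * R" using K1 R by (auto simp: Z_def)
    have "real (card (cmod ` Z)) \<le> K1 * R" using Z card_image_le[of Z cmod] by linarith
    then have "2 * d * card (cmod ` Z) \<le> 2 * d * (K1 * R)" using d by (intro mult_left_mono) auto
    moreover have "0 < R * 4 + K1 * (R * 2)" using K1(1) R by (intro add_pos_nonneg) auto
    then have "2 * d * (K1 * R) < R" using K1(1) by (simp add: d_def field_simps)
    ultimately obtain \<rho> where \<rho>: "R \<le> \<rho>" "\<rho> \<le> 2 * R" "\<And>x. x \<in> cmod ` Z \<Longrightarrow> d \<le> \<bar>\<rho> - x\<bar>"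
      using radius_avoiding_finite[of "cmod ` Z" d R] Z d by (metis finite_imageI order_le_less_trans)
    \<comment> \<open>The distance to a zero is at least the difference of the moduli, so it is
      enough that the radius avoids the moduli of the zeros.\<close>
    have far: "d \<le> cmod ((z - z0) - a)" if "cmod (z - z0) = \<rho>" "a \<in> Z" for z a
      using \<rho>(3)[of "cmod a"] that norm_triangle_ineq3[of "z - z0" a] by (auto intro: order_trans)
    have main: "F z \<noteq> 0 \<and> cmod (deriv F z) \<le> K' * \<rho> * cmod (F z)"
      if z: "cmod (z - z0) = \<rho>" and F: "F \<in> T" for F z
    proof -
      have zz: "z0 + (z - z0) = z" by simp
      have inZ: "a \<in> Z" if "a \<in> cball 0 (4 * R)" "F (z0 + a) = 0" for a
        using that F T(1) by (auto simp: Z_def \<Phi>_def)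
      have 1: "F z \<noteq> 0"
      proof
        assume "F z = 0"
        then have "z - z0 \<in> Z" using z \<rho> R by (intro inZ) auto
        then show False using far[OF z, of "z - z0"] d by simp
      qed
      have "cmod (deriv F (z0 + (z - z0))) \<le> K F * R / d * cmod (F (z0 + (z - z0)))"
        by (rule K(2)[OF F R d]) (use z \<rho> far[OF z] inZ in auto)
      also have "K F * R / d * cmod (F (z0 + (z - z0))) = K F / d * R * cmod (F z)" by simp
      also have "\<dots> \<le> K' * \<rho> * cmod (F z)"
        using Kle[OF F] K'0 \<rho> R by (intro mult_right_mono mult_mono) auto
      finally show ?thesis using 1 by simp
    qed
    have "z \<in> G" if "z \<in> sphere z0 \<rho>" for z
    proof -
      have z: "cmod (z - z0) = \<rho>" using that by (simp add: dist_norm norm_minus_commute)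
      have "(F \<noteq> (\<lambda>_. 0) \<longrightarrow> F z \<noteq> 0) \<and> cmod (deriv F z) \<le> K' * \<rho> * cmod (F z)" if F: "F \<in> S" for F
      proof (cases "F = (\<lambda>_. 0)")
        case False
        then show ?thesis using main[OF z, of F] F by (simp add: T_def)
      qed simp
      then show ?thesis unfolding G_def mem_Collect_eq z by (rule ballI)
    qed
    then have "sphere z0 \<rho> \<subseteq> G" by (rule subsetI)
    then show ?thesis using \<rho>(1,2) by (intro exI[of _ \<rho>] conjI)
  qed
  then have "circle_set G" unfolding circle_set_def by blast
  moreover have "poly_bounded_on G (\<lambda>z. deriv F z / F z)" if F: "F \<in> S" for F
  proof (rule poly_bounded_onI[of "K' * (1 + cmod z0)" _ _ 1])
    fix z assume "z \<in> G"
    then have "cmod (deriv F z) \<le> K' * cmod (z - z0) * cmod (F z)" using F by (auto simp: G_def)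
    then have "cmod (deriv F z / F z) \<le> K' * cmod (z - z0)"
      using K'0 by (cases "F z = 0") (auto simp: norm_divide field_simps)
    also have "\<dots> \<le> K' * ((1 + cmod z0) * (1 + cmod z))"
    proof (rule mult_left_mono[OF _ K'0])
      have "0 \<le> cmod z0 * cmod z" by simp
      then show "cmod (z - z0) \<le> (1 + cmod z0) * (1 + cmod z)"
        unfolding distrib_left distrib_right using norm_triangle_ineq4[of z z0] by linarith
    qed
    finally show "cmod (deriv F z / F z) \<le> K' * (1 + cmod z0) * (1 + cmod z) ^ 1" by (simp add: mult.assoc)
  qed (use K'0 in auto)
  moreover have "F z \<noteq> 0" if "F \<in> S" "F \<noteq> (\<lambda>_. 0)" "z \<in> G" for F z
    using that by (auto simp: G_def)
  ultimately show thesis using that by blast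
qed

section \<open>Vanishing derivatives of a reciprocal, and extension over isolated zeros\<close>

lemma higher_deriv_eqI:
  assumes "open S" "\<And>z. z \<in> S \<Longrightarrow> f z = F 0 z"
    "\<And>j z. z \<in> S \<Longrightarrow> (F j has_field_derivative F (Suc j) z) (at z)"
  shows "z \<in> S \<Longrightarrow> (deriv ^^ j) f z = F j z"
proof (induction j arbitrary: z)
  case (Suc j)
  have "deriv ((deriv ^^ j) f) z = deriv (F j) z"
    by (rule deriv_cong_ev) (use Suc assms(1) in \<open>auto simp: eventually_nhds intro!: exI[of _ S]\<close>)
  also have "\<dots> = F (Suc j) z" using assms(3)[OF Suc.prems] by (rule DERIV_imp_deriv)
  finally show ?case by simp
qed (use assms(2) in auto)

lemma entire_eqI_on_ball:
  assumes "f holomorphic_on UNIV" "g holomorphic_on UNIV" "0 < r" "\<And>z. z \<in> ball w r \<Longrightarrow> f z = g z"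
  shows "f z = g (z::complex)"
  by (rule analytic_continuation_open[of "ball w r" UNIV f g]) (use assms in auto)

text \<open>On the ball \<open>1/h\<close> is a polynomial \<open>p\<close>, and
  \<open>p h = 1\<close> continues to the whole plane; so \<open>p\<close> has no zero and is
  constant. This disposes of the degenerate cases in which a derived expression vanishes or is
  constant.\<close>

lemma entire_with_polynomial_inverse_constant:
  assumes h: "h holomorphic_on UNIV" and r: "0 < r"
    and nz: "\<And>z. z \<in> ball w r \<Longrightarrow> h z \<noteq> 0"
    and d0: "\<And>z. z \<in> ball w r \<Longrightarrow> (deriv ^^ n) (\<lambda>z. 1 / h z) z = 0"
  shows "h constant_on UNIV"
proof -
  define g where "g z = 1 / h z" for z
  have ghol: "g holomorphic_on ball w r"
    unfolding g_def using nz by (intro holomorphic_intros holomorphic_on_subset[OF h]) auto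
  have d0': "(deriv ^^ (n + m)) g z = 0" if "z \<in> ball w r" for m z
  proof -
    have "(deriv ^^ m) ((deriv ^^ n) g) z = (\<lambda>_ _. 0) m z"
      by (rule higher_deriv_eqI[of "ball w r"]) (use d0 that in \<open>auto simp: g_def[abs_def]\<close>)
    then show ?thesis by (simp add: add.commute[of n] funpow_add)
  qed
  define p where "p = (\<Sum>i<n. monom ((deriv ^^ i) g w / fact i) i) \<circ>\<^sub>p [:-w, 1:]"
  have pz: "poly p z = g z" if z: "z \<in> ball w r" for z
  proof -
    have "((\<lambda>i. (deriv ^^ i) g w / fact i * (z - w) ^ i) sums g z)"
      by (rule holomorphic_power_series[OF ghol z])
    moreover have "((\<lambda>i. (deriv ^^ i) g w / fact i * (z - w) ^ i) sums
        (\<Sum>i<n. (deriv ^^ i) g w / fact i * (z - w) ^ i))"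
    proof (rule sums_finite)
      fix i assume "i \<notin> {..<n}"
      then have "(deriv ^^ i) g w = 0" using d0'[of w "i - n"] r by simp
      then show "(deriv ^^ i) g w / fact i * (z - w) ^ i = 0" by simp
    qed simp
    ultimately have "g z = (\<Sum>i<n. (deriv ^^ i) g w / fact i * (z - w) ^ i)" using sums_unique2 by blast
    then show ?thesis by (simp add: p_def poly_pcompose poly_sum poly_monom)
  qed
  have ph: "poly p z * h z = 1" for z
  proof (rule entire_eqI_on_ball[of "\<lambda>z. poly p z * h z" "\<lambda>_. 1" r w])
    show "(\<lambda>z. poly p z * h z) holomorphic_on UNIV" by (intro holomorphic_intros h)
  qed (use r pz nz in \<open>auto simp: g_def\<close>)
  then have "\<And>z. poly p z \<noteq> 0" by (metis mult_zero_left zero_neq_one)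
  then have "constant (poly p)" using Fundamental_Theorem_Algebra.fundamental_theorem_of_algebra[of p] by blast
  then have "poly p z = poly p 0" for z unfolding constant_def by metis
  then have "h z = 1 / poly p 0" for z using ph[of z] by (metis nonzero_eq_divide_eq mult_zero_left zero_neq_one mult.commute)
  then show ?thesis unfolding constant_on_def by blast
qed

text \<open>The zeros of a nonconstant \<open>h\<close> are isolated, so the singularities of
  \<open>f\<close> can be filled one at a time, each value being taken from the local function at
  its own centre.\<close>

lemma holomorphic_extension_over_zeros:
  assumes h: "h holomorphic_on UNIV" "\<not> h constant_on UNIV"
    and f: "f holomorphic_on {z. h z \<noteq> 0}"
    and loc: "\<And>z0. h z0 = 0 \<Longrightarrow> \<exists>r>0. \<exists>\<phi>. \<phi> holomorphic_on ball z0 r \<and> (\<forall>w\<in>ball z0 r - {z0}. f w = \<phi> w)"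
  obtains F where "F holomorphic_on UNIV" "\<And>z. h z \<noteq> 0 \<Longrightarrow> F z = f z"
proof -
  obtain r \<phi> where r: "\<And>z0. h z0 = 0 \<Longrightarrow> 0 < r z0"
    and \<phi>: "\<And>z0. h z0 = 0 \<Longrightarrow> \<phi> z0 holomorphic_on ball z0 (r z0)"
    and eq: "\<And>z0 w. h z0 = 0 \<Longrightarrow> w \<in> ball z0 (r z0) - {z0} \<Longrightarrow> f w = \<phi> z0 w"
    using loc by metis
  define F where "F z = (if h z = 0 then \<phi> z z else f z)" for z
  have op: "open {z. h z \<noteq> 0}"
    using open_Collect_neq[of h "\<lambda>_. 0"] h(1) holomorphic_on_imp_continuous_on by auto
  have "\<exists>e>0. F holomorphic_on ball z e" for z
  proof (cases "h z = 0")
    case True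
    obtain b where "h b \<noteq> 0" using h(2) unfolding constant_on_def by metis
    then obtain e where e: "0 < e" "\<And>w. w \<in> ball z e - {z} \<Longrightarrow> h w \<noteq> 0"
      using isolated_zeros[OF h(1) open_UNIV connected_UNIV _ True, of b] by auto
    define e' where "e' = min e (r z)"
    have "F holomorphic_on ball z e'"
    proof (rule holomorphic_transform[of "\<phi> z"])
      show "\<phi> z holomorphic_on ball z e'"
        using \<phi>[OF True] by (rule holomorphic_on_subset) (auto simp: e'_def)
      show "\<phi> z w = F w" if "w \<in> ball z e'" for w
        using eq[OF True, of w] e(2)[of w] that True by (cases "w = z") (auto simp: F_def e'_def)
    qed
    then show ?thesis using e(1) r[OF True] by (intro exI[of _ e']) (auto simp: e'_def)
  next
    case False
    then obtain e where e: "0 < e" "ball z e \<subseteq> {z. h z \<noteq> 0}" using op openE by blast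
    have "F holomorphic_on ball z e"
      by (rule holomorphic_transform[OF holomorphic_on_subset[OF f e(2)]]) (use e in \<open>auto simp: F_def\<close>)
    then show ?thesis using e by blast
  qed
  then have "F analytic_on UNIV" unfolding analytic_on_def by blast
  then have "F holomorphic_on UNIV" by (rule analytic_imp_holomorphic)
  then show thesis using that[of F] by (simp add: F_def)
qed

section \<open>Derivatives of a reciprocal\<close>

text \<open>The numerator of the \<open>j\<close>-th derivative of \<open>1/h\<close> over
  \<open>h ^ (j + 1)\<close>; the recursion is the quotient rule after cancelling
  \<open>h ^ j\<close>. Being differential polynomials in \<open>h\<close>, the numerators are
  entire although \<open>1/h\<close> has poles.\<close>

primrec reciprocal_deriv_num :: "(complex \<Rightarrow> complex) \<Rightarrow> nat \<Rightarrow> complex \<Rightarrow> complex" where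
  "reciprocal_deriv_num h 0 = (\<lambda>_. 1)"
| "reciprocal_deriv_num h (Suc j) = (\<lambda>z. h z * deriv (reciprocal_deriv_num h j) z
      - of_nat (Suc j) * deriv h z * reciprocal_deriv_num h j z)"

lemma exp_type_reciprocal_deriv_num:
  "exp_type h \<Longrightarrow> exp_type (reciprocal_deriv_num h j)"
  by (induction j) (auto intro!: exp_type_const exp_type_diff exp_type_mult exp_type_deriv)

lemma holomorphic_reciprocal_deriv_num:
  "h holomorphic_on UNIV \<Longrightarrow> reciprocal_deriv_num h j holomorphic_on UNIV"
proof (induction j)
  case (Suc j)
  then show ?case
    using holomorphic_deriv[of h UNIV] holomorphic_deriv[of "reciprocal_deriv_num h j" UNIV]
    by (auto intro!: holomorphic_intros)
qed simp

lemma open_nonzero_set: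
  assumes "h holomorphic_on UNIV" shows "open {z::complex. h z \<noteq> (0::complex)}"
  using open_Collect_neq[of h "\<lambda>_. 0"] assms holomorphic_on_imp_continuous_on by auto

lemma higher_deriv_reciprocal:
  assumes h: "h holomorphic_on UNIV" and z: "h z \<noteq> 0"
  shows "(deriv ^^ j) (\<lambda>z. 1 / h z) z = reciprocal_deriv_num h j z / h z ^ (j + 1)"
proof (rule higher_deriv_eqI[of "{z. h z \<noteq> 0}" _ "\<lambda>j z. reciprocal_deriv_num h j z / h z ^ (j + 1)"])
  show "open {z. h z \<noteq> 0}" using open_nonzero_set[OF h] .
  show "z \<in> {z. h z \<noteq> 0}" using z by simp
  fix j z assume "z \<in> {z. h z \<noteq> 0}"
  then have hz: "h z \<noteq> 0" by simp
  let ?P = "reciprocal_deriv_num h j"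
  have P: "(?P has_field_derivative deriv ?P z) (at z)"
    using holomorphic_derivI[OF holomorphic_reciprocal_deriv_num[OF h] open_UNIV] by simp
  have dh: "(h has_field_derivative deriv h z) (at z)" using h by (simp add: holomorphic_derivI)
  have dh': "((\<lambda>z. h z ^ (j + 1)) has_field_derivative of_nat (j + 1) * (deriv h z * h z ^ j)) (at z)"
    using DERIV_power[OF dh, of "j + 1"] by simp
  have "((\<lambda>z. ?P z / h z ^ (j + 1)) has_field_derivative
      (deriv ?P z * h z ^ (j + 1) - ?P z * (of_nat (j + 1) * (deriv h z * h z ^ j))) / (h z ^ (j + 1) * h z ^ (j + 1))) (at z)"
    by (rule DERIV_divide[OF P dh']) (use hz in simp)
  moreover have "(deriv ?P z * h z ^ (j + 1) - ?P z * (of_nat (j + 1) * (deriv h z * h z ^ j))) / (h z ^ (j + 1) * h z ^ (j + 1))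
      = reciprocal_deriv_num h (Suc j) z / h z ^ (Suc j + 1)"
    using hz by (simp add: field_simps)
  ultimately show "((\<lambda>z. ?P z / h z ^ (j + 1)) has_field_derivative
      reciprocal_deriv_num h (Suc j) z / h z ^ (Suc j + 1)) (at z)" by simp
qed auto

definition reciprocal_deriv_diff :: "nat \<Rightarrow> complex \<Rightarrow> (complex \<Rightarrow> complex) \<Rightarrow> complex \<Rightarrow> complex" where
  "reciprocal_deriv_diff k c h z = (deriv ^^ k) (\<lambda>z. 1 / h z) z - c"

lemma holomorphic_reciprocal_deriv_diff:
  assumes "h holomorphic_on UNIV"
  shows "reciprocal_deriv_diff k c h holomorphic_on {z. h z \<noteq> 0}"
proof -
  have "(\<lambda>z. 1 / h z) holomorphic_on {z. h z \<noteq> 0}"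
    by (intro holomorphic_intros holomorphic_on_subset[OF assms]) auto
  then show ?thesis unfolding reciprocal_deriv_diff_def[abs_def]
    by (intro holomorphic_on_diff holomorphic_on_const holomorphic_higher_deriv open_nonzero_set[OF assms])
qed

lemma deriv_reciprocal_deriv_diff:
  assumes "h holomorphic_on UNIV" "h z \<noteq> 0"
  shows "deriv (reciprocal_deriv_diff k c h) z = (deriv ^^ Suc k) (\<lambda>z. 1 / h z) z"
proof -
  have "(\<lambda>z. 1 / h z) holomorphic_on {z. h z \<noteq> 0}"
    by (intro holomorphic_intros holomorphic_on_subset[OF assms(1)]) auto
  then have "(deriv ^^ k) (\<lambda>z. 1 / h z) holomorphic_on {z. h z \<noteq> 0}"
    by (intro holomorphic_higher_deriv open_nonzero_set[OF assms(1)])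
  then have "((deriv ^^ k) (\<lambda>z. 1 / h z) has_field_derivative (deriv ^^ Suc k) (\<lambda>z. 1 / h z) z) (at z)"
    using assms(2) open_nonzero_set[OF assms(1)] by (simp add: holomorphic_derivI)
  then have "(reciprocal_deriv_diff k c h has_field_derivative (deriv ^^ Suc k) (\<lambda>z. 1 / h z) z - 0) (at z)"
    unfolding reciprocal_deriv_diff_def[abs_def] by (intro DERIV_diff DERIV_const)
  then show ?thesis using DERIV_imp_deriv by fastforce
qed

lemma has_field_derivative_power_mult:
  fixes b :: "complex \<Rightarrow> complex"
  assumes "(b has_field_derivative b') (at w)"
  shows "((\<lambda>v. C + (v - z0) ^ (n + 1) * b v) has_field_derivative
      of_nat (n + 1) * (w - z0) ^ n * b w + (w - z0) ^ (n + 1) * b') (at w)"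
proof -
  have "((\<lambda>v. v - z0) has_field_derivative 1) (at w)" by (auto intro!: derivative_eq_intros)
  from DERIV_add[OF DERIV_const DERIV_mult[OF DERIV_power[OF this, of "n + 1"] assms]]
  show ?thesis by (simp add: mult.commute)
qed

lemma has_field_derivative_divide_power:
  fixes a :: "complex \<Rightarrow> complex"
  assumes a: "(a has_field_derivative a') (at w)" and w: "w \<noteq> z0" and m: "0 < m"
  shows "((\<lambda>v. a v / (v - z0) ^ m) has_field_derivative
      ((w - z0) * a' - of_nat m * a w) / (w - z0) ^ Suc m) (at w)"
proof -
  obtain n where n: "m = Suc n" using m gr0_implies_Suc by blast
  have d: "w - z0 \<noteq> 0" using w by simp
  have "((\<lambda>v. v - z0) has_field_derivative 1) (at w)" by (auto intro!: derivative_eq_intros)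
  from DERIV_power[OF this, of m]
  have pw: "((\<lambda>v. (v - z0) ^ m) has_field_derivative of_nat m * (w - z0) ^ n) (at w)" by (simp add: n)
  have "(x * d ^ Suc n - y * (N * d ^ n)) / (d ^ Suc n * d ^ Suc n) = (d * x - N * y) / d ^ Suc (Suc n)"
    if "d \<noteq> 0" for x y N d :: complex using that by (simp add: field_simps)
  from this[OF d] show ?thesis using DERIV_divide[OF a pw] d unfolding n by simp
qed

text \<open>At a simple pole the Laurent expansion of the \<open>k\<close>-th derivative of \<open>1/h\<close> has no terms
  between order \<open>-(k+1)\<close> and the regular part, which is the last conclusion.\<close>
lemma reciprocal_deriv_local_form:
  assumes h: "h holomorphic_on UNIV" "\<not> h constant_on UNIV" and z0: "h z0 = 0"
  obtains m r h1 \<psi> where "0 < m" "0 < r" "h1 holomorphic_on ball z0 r" "\<psi> holomorphic_on ball z0 r"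
    "\<forall>w\<in>ball z0 r. h1 w \<noteq> 0 \<and> \<psi> w \<noteq> 0 \<and> h w = (w - z0) ^ m * h1 w"
    "\<forall>w\<in>ball z0 r - {z0}. reciprocal_deriv_diff k c h w = \<psi> w / (w - z0) ^ (m + k)"
    "m = 1 \<longrightarrow> (\<exists>b. b holomorphic_on ball z0 r \<and> (\<forall>w\<in>ball z0 r. \<psi> w = \<psi> z0 + (w - z0) ^ (k + 1) * b w))"
proof -
  obtain h1 r1 m where m: "0 < m" and r1: "0 < r1" and h1: "h1 holomorphic_on ball z0 r1"
    and heq: "\<And>w. w \<in> ball z0 r1 \<Longrightarrow> h w = (w - z0) ^ m * h1 w"
    and h1nz: "\<And>w. w \<in> ball z0 r1 \<Longrightarrow> h1 w \<noteq> 0"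
    by (rule holomorphic_factor_zero_nonconstant[OF h(1) open_UNIV connected_UNIV UNIV_I z0 h(2)]) blast
  \<comment> \<open>\<open>a j\<close> is the holomorphic numerator of the \<open>j\<close>-th
    derivative of \<open>1/h\<close> over \<open>(w - z0) ^ (m + j)\<close>. At \<open>z0\<close>
    the recursion only multiplies by \<open>- (m + j)\<close>, so the numerator stays nonzero there
    and the pole has full order.\<close>
  define a where "a = rec_nat (\<lambda>w. 1 / h1 w) (\<lambda>j aj w. (w - z0) * deriv aj w - of_nat (m + j) * aj w)"
  have a0: "a 0 = (\<lambda>w. 1 / h1 w)" by (simp add: a_def)
  have aS: "a (Suc j) = (\<lambda>w. (w - z0) * deriv (a j) w - of_nat (m + j) * a j w)" for j
    by (simp add: a_def)
  have ahol: "a j holomorphic_on ball z0 r1" for j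
  proof (induction j)
    case 0 show ?case unfolding a0 using h1nz by (intro holomorphic_intros h1) auto
  next
    case (Suc j)
    then show ?case unfolding aS by (intro holomorphic_intros holomorphic_deriv) auto
  qed
  have adv: "(a j has_field_derivative deriv (a j) w) (at w)" if "w \<in> ball z0 r1" for j w
    using ahol that by (intro holomorphic_derivI) auto
  have anz: "a j z0 \<noteq> 0" for j
  proof (induction j)
    case 0 show ?case using h1nz[of z0] r1 by (simp add: a0)
  next
    case (Suc j)
    have "of_nat (m + j) \<noteq> (0::complex)" using m by (metis add_gr_0 of_nat_0_less_iff of_nat_eq_0_iff less_irrefl)
    then show ?case using Suc by (simp add: aS)
  qed
  have hd: "(deriv ^^ k) (\<lambda>z. 1 / h z) w = a k w / (w - z0) ^ (m + k)" if "w \<in> ball z0 r1 - {z0}" for w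
  proof (rule higher_deriv_eqI[of "ball z0 r1 - {z0}" _ "\<lambda>j w. a j w / (w - z0) ^ (m + j)"])
    show "1 / h w = a 0 w / (w - z0) ^ (m + 0)" if "w \<in> ball z0 r1 - {z0}" for w
      using heq[of w] that by (simp add: a0)
    fix j w assume w: "w \<in> ball z0 r1 - {z0}"
    show "((\<lambda>w. a j w / (w - z0) ^ (m + j)) has_field_derivative a (Suc j) w / (w - z0) ^ (m + Suc j)) (at w)"
      using has_field_derivative_divide_power[OF adv[of w j], of z0 "m + j"] w m by (simp add: aS)
  qed (use that in auto)
  define \<psi> where "\<psi> w = a k w - c * (w - z0) ^ (m + k)" for w
  have \<psi>hol: "\<psi> holomorphic_on ball z0 r1" unfolding \<psi>_def by (intro holomorphic_intros ahol)
  have "\<psi> z0 \<noteq> 0" using anz[of k] m by (simp add: \<psi>_def power_0_left)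
  then obtain r2 where r2: "0 < r2" "\<And>w. dist z0 w < r2 \<Longrightarrow> \<psi> w \<noteq> 0"
    using continuous_at_avoid[of z0 \<psi> 0] \<psi>hol r1
    by (metis centre_in_ball continuous_on_eq_continuous_at holomorphic_on_imp_continuous_on open_ball)
  define r where "r = min r1 r2"
  have sub: "ball z0 r \<subseteq> ball z0 r1" by (auto simp: r_def)
  show thesis
  proof (rule that[of m r h1 \<psi>])
    show "0 < r" using r1 r2 by (simp add: r_def)
    show "h1 holomorphic_on ball z0 r" "\<psi> holomorphic_on ball z0 r"
      using h1 \<psi>hol sub holomorphic_on_subset by blast+
    show "\<forall>w\<in>ball z0 r. h1 w \<noteq> 0 \<and> \<psi> w \<noteq> 0 \<and> h w = (w - z0) ^ m * h1 w"
      using h1nz heq r2 by (auto simp: r_def)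
    show "\<forall>w\<in>ball z0 r - {z0}. reciprocal_deriv_diff k c h w = \<psi> w / (w - z0) ^ (m + k)"
    proof
      fix w assume w: "w \<in> ball z0 r - {z0}"
      then have "w \<in> ball z0 r1 - {z0}" using sub by auto
      then show "reciprocal_deriv_diff k c h w = \<psi> w / (w - z0) ^ (m + k)"
        using hd[of w] w by (simp add: reciprocal_deriv_diff_def \<psi>_def diff_divide_distrib)
    qed
    show "m = 1 \<longrightarrow> (\<exists>b. b holomorphic_on ball z0 r \<and> (\<forall>w\<in>ball z0 r. \<psi> w = \<psi> z0 + (w - z0) ^ (k + 1) * b w))"
    proof
      assume m1: "m = 1"
      \<comment> \<open>For \<open>m = 1\<close> the factor \<open>j + 1\<close> from
        differentiating \<open>(w - z0) ^ (j + 1)\<close> equals the factor \<open>m + j\<close> in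
        the recursion. The terms in \<open>b\<close> cancel, only \<open>deriv b\<close> survives
        with one more power, and the gap after the leading term grows with each derivative.\<close>
      have "\<exists>b. b holomorphic_on ball z0 r1 \<and> (\<forall>w\<in>ball z0 r1. a j w = a j z0 + (w - z0) ^ (j + 1) * b w)" for j
      proof (induction j)
        case 0
        have "(\<lambda>z. if z = z0 then deriv (a 0) z0 else (a 0 z - a 0 z0) / (z - z0)) holomorphic_on ball z0 r1"
          by (rule pole_lemma_open) (use ahol in auto)
        then show ?case by (intro exI[of _ "\<lambda>z. if z = z0 then deriv (a 0) z0 else (a 0 z - a 0 z0) / (z - z0)"]) auto
      next
        case (Suc j)
        then obtain b where b: "b holomorphic_on ball z0 r1"
          and eq: "\<And>w. w \<in> ball z0 r1 \<Longrightarrow> a j w = a j z0 + (w - z0) ^ (j + 1) * b w" by blast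
        have "a (Suc j) w = a (Suc j) z0 + (w - z0) ^ (Suc j + 1) * deriv b w" if w: "w \<in> ball z0 r1" for w
        proof -
          have "(b has_field_derivative deriv b w) (at w)" using b w by (intro holomorphic_derivI) auto
          then have "((\<lambda>w. a j z0 + (w - z0) ^ (j + 1) * b w) has_field_derivative
              of_nat (j + 1) * (w - z0) ^ j * b w + (w - z0) ^ (j + 1) * deriv b w) (at w)"
            by (rule has_field_derivative_power_mult)
          moreover have "deriv (a j) w = deriv (\<lambda>w. a j z0 + (w - z0) ^ (j + 1) * b w) w"
            by (rule deriv_cong_ev) (use eq w in \<open>auto simp: eventually_nhds intro!: exI[of _ "ball z0 r1"]\<close>)
          ultimately have dA: "deriv (a j) w = of_nat (j + 1) * (w - z0) ^ j * b w + (w - z0) ^ (j + 1) * deriv b w"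
            using DERIV_imp_deriv by fastforce
          have "a (Suc j) w = (w - z0) * deriv (a j) w - of_nat (j + 1) * a j w"
            by (simp add: aS m1)
          also have "\<dots> = (w - z0) * (of_nat (j + 1) * (w - z0) ^ j * b w + (w - z0) ^ (j + 1) * deriv b w)
              - of_nat (j + 1) * (a j z0 + (w - z0) ^ (j + 1) * b w)"
            by (simp only: dA eq[OF w])
          also have "d * (N * d ^ j * B + d ^ (j + 1) * B') - N * (A + d ^ (j + 1) * B)
              = - N * A + d ^ (Suc j + 1) * B'" for d N A B B' :: complex
            by (simp add: algebra_simps)
          also have "- of_nat (j + 1) * a j z0 = a (Suc j) z0" by (simp add: aS m1 algebra_simps)
          finally show ?thesis .
        qed
        then show ?case using holomorphic_deriv[OF b] by blast
      qed
      then obtain b where b: "b holomorphic_on ball z0 r1"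
          and eq: "\<And>w. w \<in> ball z0 r1 \<Longrightarrow> a k w = a k z0 + (w - z0) ^ (k + 1) * b w" by blast
      show "\<exists>b. b holomorphic_on ball z0 r \<and> (\<forall>w\<in>ball z0 r. \<psi> w = \<psi> z0 + (w - z0) ^ (k + 1) * b w)"
      \<comment> \<open>For \<open>m = 1\<close> the subtracted term
        \<open>c * (w - z0) ^ (m + k)\<close> has exactly the exponent at which the gap
        ends.\<close>
      proof (intro exI[of _ "\<lambda>w. b w - c"] conjI ballI)
        show "(\<lambda>w. b w - c) holomorphic_on ball z0 r"
          using b sub by (intro holomorphic_intros) (auto intro: holomorphic_on_subset)
        show "\<psi> w = \<psi> z0 + (w - z0) ^ (k + 1) * (b w - c)" if "w \<in> ball z0 r" for w
          using eq[of w] that sub m1 by (auto simp: \<psi>_def algebra_simps)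
      qed
    qed
  qed (use m in auto)
qed

definition reciprocal_log_deriv :: "nat \<Rightarrow> complex \<Rightarrow> (complex \<Rightarrow> complex) \<Rightarrow> complex \<Rightarrow> complex" where
  "reciprocal_log_deriv k c h z = deriv (reciprocal_deriv_diff k c h) z / reciprocal_deriv_diff k c h z"

text \<open>At a pole of order \<open>m + k\<close> the logarithmic derivative
  \<open>T = \<tau> / (w - z0)\<close> has residue \<open>- (m + k)\<close>. For
  \<open>m = 1\<close> the gap in the expansion yields
  \<open>\<tau> = - (k + 1) + O((w - z0)^3)\<close>. The combination in the last conclusion is
  \<open>(w - z0)^2 * (T^2 - (k + 1) * T')\<close>, and its constant terms cancel.\<close>

lemma reciprocal_log_deriv_local_form:
  assumes h: "h holomorphic_on UNIV" "\<not> h constant_on UNIV" and z0: "h z0 = 0" and k: "2 \<le> k"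
  obtains m r h1 \<tau> \<omega> where "0 < m" "0 < r" "h1 holomorphic_on ball z0 r" "\<tau> holomorphic_on ball z0 r"
    "\<omega> holomorphic_on ball z0 r"
    "\<forall>w\<in>ball z0 r. h w = (w - z0) ^ m * h1 w"
    "\<forall>w\<in>ball z0 r - {z0}. 1 / reciprocal_deriv_diff k c h w = \<omega> w"
    "\<forall>w\<in>ball z0 r - {z0}. reciprocal_log_deriv k c h w = \<tau> w / (w - z0)"
    "\<forall>w\<in>ball z0 r - {z0}. deriv (reciprocal_log_deriv k c h) w = deriv \<tau> w / (w - z0) - \<tau> w / (w - z0)\<^sup>2"
    "m = 1 \<longrightarrow> (\<exists>\<sigma>. \<sigma> holomorphic_on ball z0 r \<and> (\<forall>w\<in>ball z0 r.
       (\<tau> w)\<^sup>2 + of_nat (k + 1) * \<tau> w - of_nat (k + 1) * (w - z0) * deriv \<tau> w = (w - z0) ^ 3 * \<sigma> w))"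
proof -
  obtain m r h1 \<psi> where m: "0 < m" and r: "0 < r" and h1: "h1 holomorphic_on ball z0 r" and \<psi>: "\<psi> holomorphic_on ball z0 r"
    and nz: "\<forall>w\<in>ball z0 r. h1 w \<noteq> 0 \<and> \<psi> w \<noteq> 0 \<and> h w = (w - z0) ^ m * h1 w"
    and W: "\<forall>w\<in>ball z0 r - {z0}. reciprocal_deriv_diff k c h w = \<psi> w / (w - z0) ^ (m + k)"
    and m1: "m = 1 \<longrightarrow> (\<exists>b. b holomorphic_on ball z0 r \<and> (\<forall>w\<in>ball z0 r. \<psi> w = \<psi> z0 + (w - z0) ^ (k + 1) * b w))"
    by (rule reciprocal_deriv_local_form[OF h z0])
  define \<kappa> where "\<kappa> w = deriv \<psi> w / \<psi> w" for w
  define \<tau> where "\<tau> w = - of_nat (m + k) + (w - z0) * \<kappa> w" for w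
  define \<omega> where "\<omega> w = (w - z0) ^ (m + k) / \<psi> w" for w
  have \<kappa>: "\<kappa> holomorphic_on ball z0 r" unfolding \<kappa>_def
    using nz by (intro holomorphic_intros holomorphic_deriv \<psi>) auto
  have \<tau>: "\<tau> holomorphic_on ball z0 r" unfolding \<tau>_def by (intro holomorphic_intros \<kappa>)
  have \<omega>: "\<omega> holomorphic_on ball z0 r" unfolding \<omega>_def
    using nz by (intro holomorphic_intros \<psi>) auto
  have op: "open (ball z0 r - {z0})" by (simp add: open_delete)
  have T: "reciprocal_log_deriv k c h w = \<tau> w / (w - z0)" if w: "w \<in> ball z0 r - {z0}" for w
  proof -
    have d: "w - z0 \<noteq> 0" and wi: "w \<in> ball z0 r" using w by auto
    have \<psi>d: "(\<psi> has_field_derivative deriv \<psi> w) (at w)" using \<psi> wi by (intro holomorphic_derivI) auto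
    have "((\<lambda>w. \<psi> w / (w - z0) ^ (m + k)) has_field_derivative
       ((w - z0) * deriv \<psi> w - of_nat (m + k) * \<psi> w) / (w - z0) ^ Suc (m + k)) (at w)"
      using w m by (intro has_field_derivative_divide_power[OF \<psi>d]) auto
    moreover have "deriv (reciprocal_deriv_diff k c h) w = deriv (\<lambda>w. \<psi> w / (w - z0) ^ (m + k)) w"
      by (rule deriv_cong_ev) (use W w op in \<open>auto simp: eventually_nhds intro!: exI[of _ "ball z0 r - {z0}"]\<close>)
    ultimately have "deriv (reciprocal_deriv_diff k c h) w =
       ((w - z0) * deriv \<psi> w - of_nat (m + k) * \<psi> w) / (w - z0) ^ Suc (m + k)"
      using DERIV_imp_deriv by fastforce
    moreover have "reciprocal_deriv_diff k c h w = \<psi> w / (w - z0) ^ (m + k)" using W w by blast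
    moreover have "(d * p' - N * p) / d ^ Suc n / (p / d ^ n) = (- N + d * (p' / p)) / d"
      if "d \<noteq> 0" "p \<noteq> 0" for p p' d N :: complex and n
      using that by (simp add: field_simps)
    ultimately show ?thesis
      unfolding reciprocal_log_deriv_def \<tau>_def \<kappa>_def using d nz wi by metis
  qed
  have Tball: "\<forall>w\<in>ball z0 r - {z0}. reciprocal_log_deriv k c h w = \<tau> w / (w - z0)" using T by blast
  have T': "deriv (reciprocal_log_deriv k c h) w = deriv \<tau> w / (w - z0) - \<tau> w / (w - z0)\<^sup>2"
    if w: "w \<in> ball z0 r - {z0}" for w
  proof -
    have d: "w - z0 \<noteq> 0" and wi: "w \<in> ball z0 r" using w by auto
    have \<tau>d: "(\<tau> has_field_derivative deriv \<tau> w) (at w)" using \<tau> wi by (intro holomorphic_derivI) auto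
    have "((\<lambda>w. \<tau> w / (w - z0)) has_field_derivative deriv \<tau> w / (w - z0) - \<tau> w / (w - z0)\<^sup>2) (at w)"
    proof -
      have "((\<lambda>w. w - z0) has_field_derivative 1) (at w)" by (auto intro!: derivative_eq_intros)
      from DERIV_divide[OF \<tau>d this d] show ?thesis
        using d by (simp add: diff_divide_distrib power2_eq_square)
    qed
    moreover have "deriv (reciprocal_log_deriv k c h) w = deriv (\<lambda>w. \<tau> w / (w - z0)) w"
      by (rule deriv_cong_ev) (use Tball w op in \<open>auto simp: eventually_nhds intro!: exI[of _ "ball z0 r - {z0}"]\<close>)
    ultimately show ?thesis using DERIV_imp_deriv by fastforce
  qed
  have \<sigma>: "\<exists>\<sigma>. \<sigma> holomorphic_on ball z0 r \<and> (\<forall>w\<in>ball z0 r.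
       (\<tau> w)\<^sup>2 + of_nat (k + 1) * \<tau> w - of_nat (k + 1) * (w - z0) * deriv \<tau> w = (w - z0) ^ 3 * \<sigma> w)"
    if meq: "m = 1"
  proof -
    obtain b where b: "b holomorphic_on ball z0 r"
      and eq: "\<And>w. w \<in> ball z0 r \<Longrightarrow> \<psi> w = \<psi> z0 + (w - z0) ^ (k + 1) * b w"
      using m1 meq by blast
    \<comment> \<open>The derivative of the gap term has the factor \<open>(w - z0) ^ k\<close>;
      \<open>2 \<le> k\<close> allows two powers to be split off.\<close>
    define \<beta> where "\<beta> w = (w - z0) ^ (k - 2) * (of_nat (k + 1) * b w + (w - z0) * deriv b w) / \<psi> w" for w
    have \<beta>: "\<beta> holomorphic_on ball z0 r" unfolding \<beta>_def
      using nz by (intro holomorphic_intros holomorphic_deriv b \<psi>) auto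
    have \<kappa>eq: "\<kappa> w = (w - z0)\<^sup>2 * \<beta> w" if w: "w \<in> ball z0 r" for w
    proof -
      have "(b has_field_derivative deriv b w) (at w)" using b w by (intro holomorphic_derivI) auto
      then have "((\<lambda>w. \<psi> z0 + (w - z0) ^ (k + 1) * b w) has_field_derivative
          of_nat (k + 1) * (w - z0) ^ k * b w + (w - z0) ^ (k + 1) * deriv b w) (at w)"
        by (rule has_field_derivative_power_mult)
      moreover have "deriv \<psi> w = deriv (\<lambda>w. \<psi> z0 + (w - z0) ^ (k + 1) * b w) w"
        by (rule deriv_cong_ev) (use eq w in \<open>auto simp: eventually_nhds intro!: exI[of _ "ball z0 r"]\<close>)
      ultimately have "deriv \<psi> w = of_nat (k + 1) * (w - z0) ^ k * b w + (w - z0) ^ (k + 1) * deriv b w"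
        using DERIV_imp_deriv by fastforce
      also have "\<dots> = (w - z0) ^ k * (of_nat (k + 1) * b w + (w - z0) * deriv b w)"
        by (simp add: algebra_simps)
      also have "(w - z0) ^ k = (w - z0)\<^sup>2 * (w - z0) ^ (k - 2)"
        using k by (metis le_add_diff_inverse power_add)
      finally show ?thesis by (simp add: \<kappa>_def \<beta>_def)
    qed
    define \<sigma> where "\<sigma> w = - 4 * of_nat (k + 1) * \<beta> w + (w - z0) ^ 3 * (\<beta> w)\<^sup>2
        - of_nat (k + 1) * (w - z0) * deriv \<beta> w" for w
    have "\<sigma> holomorphic_on ball z0 r" unfolding \<sigma>_def
      by (intro holomorphic_intros holomorphic_deriv \<beta>) auto
    moreover have "(\<tau> w)\<^sup>2 + of_nat (k + 1) * \<tau> w - of_nat (k + 1) * (w - z0) * deriv \<tau> w = (w - z0) ^ 3 * \<sigma> w"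
      if w: "w \<in> ball z0 r" for w
    proof -
      have \<tau>eq: "\<tau> v = - of_nat (k + 1) + (v - z0) ^ 3 * \<beta> v" if "v \<in> ball z0 r" for v
        using \<kappa>eq[OF that] \<open>m = 1\<close> by (simp add: \<tau>_def power2_eq_square power3_eq_cube)
      have "(\<beta> has_field_derivative deriv \<beta> w) (at w)" using \<beta> w by (intro holomorphic_derivI) auto
      then have "((\<lambda>v. - of_nat (k + 1) + (v - z0) ^ 3 * \<beta> v) has_field_derivative
          3 * (w - z0)\<^sup>2 * \<beta> w + (w - z0) ^ 3 * deriv \<beta> w) (at w)"
        using has_field_derivative_power_mult[of \<beta> "deriv \<beta> w" w "- of_nat (k + 1)" z0 2] by simp
      moreover have "deriv \<tau> w = deriv (\<lambda>v. - of_nat (k + 1) + (v - z0) ^ 3 * \<beta> v) w"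
        by (rule deriv_cong_ev) (use \<tau>eq w in \<open>auto simp: eventually_nhds intro!: exI[of _ "ball z0 r"]\<close>)
      ultimately have "deriv \<tau> w = 3 * (w - z0)\<^sup>2 * \<beta> w + (w - z0) ^ 3 * deriv \<beta> w"
        using DERIV_imp_deriv by fastforce
      moreover have "(- N + d ^ 3 * B)\<^sup>2 + N * (- N + d ^ 3 * B) - N * d * (3 * d\<^sup>2 * B + d ^ 3 * B')
         = d ^ 3 * (- 4 * N * B + d ^ 3 * B\<^sup>2 - N * d * B')" for N d B B' :: complex
        by (simp add: power2_eq_square power3_eq_cube algebra_simps)
      ultimately show ?thesis unfolding \<tau>eq[OF w] \<sigma>_def by metis
    qed
    ultimately show ?thesis by blast
  qed
  show thesis
    by (rule that[OF m r h1 \<tau> \<omega>]) (use nz W T T' \<sigma> in \<open>auto simp: \<omega>_def\<close>)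
qed

section \<open>Hayman's alternative for reciprocals of exponential type\<close>

lemma nonconstant_obtain_nonzero:
  fixes h :: "complex \<Rightarrow> complex"
  assumes "\<not> h constant_on UNIV" obtains w where "h w \<noteq> 0"
  using assms unfolding constant_on_def by metis

text \<open>The reciprocal of \<open>(1/p)\<^sup>(\<^sup>k\<^sup>) - c\<close> extends to an entire function with limit
  \<open>-1/c\<close> at infinity.\<close>
lemma poly_reciprocal_deriv_omits_imp_constant:
  fixes p :: "complex poly"
  assumes c: "c \<noteq> 0" and k: "2 \<le> k"
    and om: "\<And>z. poly p z \<noteq> 0 \<Longrightarrow> (deriv ^^ k) (\<lambda>z. 1 / poly p z) z \<noteq> c"
  shows "poly p constant_on UNIV"
proof (rule ccontr)
  assume nc: "\<not> poly p constant_on UNIV"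
  have h: "poly p holomorphic_on UNIV" by (intro holomorphic_intros)
  let ?W = "reciprocal_deriv_diff k c (poly p)"
  have Wnz: "?W z \<noteq> 0" if "poly p z \<noteq> 0" for z
    using om[OF that] by (simp add: reciprocal_deriv_diff_def)
  have "(\<lambda>z. 1 / ?W z) holomorphic_on {z. poly p z \<noteq> 0}"
    by (intro holomorphic_intros holomorphic_reciprocal_deriv_diff[OF h]) (use Wnz in auto)
  moreover have "\<exists>r>0. \<exists>\<phi>. \<phi> holomorphic_on ball z0 r \<and> (\<forall>w\<in>ball z0 r - {z0}. 1 / ?W w = \<phi> w)"
    if "poly p z0 = 0" for z0
    by (rule reciprocal_log_deriv_local_form[OF h nc that k, of c]) blast
  ultimately obtain F where F: "F holomorphic_on UNIV" "\<And>z. poly p z \<noteq> 0 \<Longrightarrow> F z = 1 / ?W z"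
    using holomorphic_extension_over_zeros[OF h nc] by blast
  have deg: "0 < degree p"
  proof (rule ccontr)
    assume "\<not> 0 < degree p"
    then obtain a where "p = [:a:]" using degree_eq_zeroE by blast
    then show False using nc by (auto simp: constant_on_def)
  qed
  \<comment> \<open>Cauchy's estimate on a unit disc where \<open>B \<le> cmod (poly p w)\<close>
    bounds the \<open>k\<close>-th derivative of \<open>1/p\<close> by
    \<open>fact k / B = cmod c / 2\<close>, half the modulus of the omitted value.\<close>
  define B where "B = 2 * fact k / cmod c"
  have B: "0 < B" using c by (simp add: B_def)
  have "filterlim (poly p) at_infinity at_infinity" using deg by (intro filterlim_poly_at_infinity)
  then have "\<forall>\<^sub>F z in at_infinity. B + 1 \<le> cmod (poly p z)"
    using filterlim_at_infinity[of 0 "poly p"] B by force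
  then obtain A where A: "\<And>z. A \<le> cmod z \<Longrightarrow> B + 1 \<le> cmod (poly p z)"
    unfolding eventually_at_infinity by blast
  have far: "cmod (F z) \<le> 2 / cmod c" if z: "A + 1 \<le> cmod z" for z
  proof -
    have big: "B + 1 \<le> cmod (poly p w)" if "w \<in> cball z 1" for w
    proof (rule A)
      have "cmod (z - w) \<le> 1" using that by (simp add: dist_norm)
      then show "A \<le> cmod w" using z norm_triangle_ineq2[of z w] by linarith
    qed
    have nz: "poly p w \<noteq> 0" if "w \<in> cball z 1" for w using big[OF that] B by auto
    have "cmod ((deriv ^^ k) (\<lambda>z. 1 / poly p z) z) \<le> fact k * (1 / B) / 1 ^ k"
    proof (rule Cauchy_inequality)
      show "(\<lambda>z. 1 / poly p z) holomorphic_on ball z 1"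
        by (intro holomorphic_intros) (use nz in auto)
      show "continuous_on (cball z 1) (\<lambda>z. 1 / poly p z)"
        by (intro continuous_intros) (use nz in auto)
      fix w assume "cmod (z - w) = 1"
      then have "w \<in> cball z 1" by (simp add: dist_norm)
      then have "B \<le> cmod (poly p w)" using big by fastforce
      then show "cmod (1 / poly p w) \<le> 1 / B" using B by (simp add: norm_divide frac_le)
    qed auto
    also have "\<dots> = cmod c / 2" using c by (simp add: B_def)
    finally have "cmod (?W z + c) \<le> cmod c / 2" by (simp add: reciprocal_deriv_diff_def)
    then have "cmod c / 2 \<le> cmod (?W z)" using norm_triangle_ineq4[of "?W z + c" "?W z"] by simp
    moreover have "0 < cmod c / 2" using c by simp
    ultimately have "1 / cmod (?W z) \<le> 1 / (cmod c / 2)" by (intro frac_le) auto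
    then show ?thesis using F(2)[OF nz[of z]] by (simp add: norm_divide)
  qed
  have "bounded (F ` cball 0 (A + 1))"
    using F(1) by (intro compact_imp_bounded compact_continuous_image) (auto intro: holomorphic_on_imp_continuous_on continuous_on_subset)
  then obtain M where "\<forall>z\<in>cball 0 (A + 1). cmod (F z) \<le> M" unfolding bounded_iff by blast
  then have M: "cmod (F z) \<le> M" if "cmod z \<le> A + 1" for z using that by simp
  have "bounded (range F)" unfolding bounded_iff
    by (rule exI[of _ "max M (2 / cmod c)"]) (metis (no_types) M far rangeE le_max_iff_disj linear)
  then obtain b where b: "\<And>z. F z = b"
    using Liouville_theorem[OF F(1)] unfolding constant_on_def by auto
  have Wc: "?W z = 1 / b" if "poly p z \<noteq> 0" for z using F(2)[OF that] b by simp
  obtain w where w: "poly p w \<noteq> 0" using nonconstant_obtain_nonzero[OF nc] .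
  then obtain r where r: "0 < r" "ball w r \<subseteq> {z. poly p z \<noteq> 0}"
    using open_nonzero_set[OF h] openE by blast
  have "(deriv ^^ Suc k) (\<lambda>z. 1 / poly p z) z = 0" if z: "z \<in> ball w r" for z
  proof -
    have "deriv ?W z = deriv (\<lambda>_. 1 / b) z"
      by (rule deriv_cong_ev) (use Wc r z in \<open>auto simp: eventually_nhds intro!: exI[of _ "ball w r"]\<close>)
    then show ?thesis using deriv_reciprocal_deriv_diff[OF h, of z k c] r z by auto
  qed
  then have "poly p constant_on UNIV"
    using r by (intro entire_with_polynomial_inverse_constant[OF h r(1), of w "Suc k"]) auto
  then show False using nc by blast
qed

text \<open>With \<open>g = 1/h\<close>, \<open>W = g\<^sup>(\<^sup>k\<^sup>) - c\<close> and \<open>T = W'/W\<close> one has \<open>c h T = (g\<^sup>(\<^sup>k\<^sup>)/g) T - g\<^sup>(\<^sup>k\<^sup>+\<^sup>1\<^sup>)/g\<close>, so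
  the entire function \<open>u = h T\<close> is polynomially bounded on good circles.  Locally \<open>W = y\<^sup>-\<^sup>(\<^sup>k\<^sup>+\<^sup>1\<^sup>)\<close>,
  and \<open>T\<^sup>2 - (k+1) T'\<close> is a multiple of \<open>y''/y\<close>, which vanishes at the simple zeros of \<open>h\<close>; hence
  \<open>V = u\<^sup>3 T (T\<^sup>2 - (k+1) T')\<close> is entire, and again a polynomial.\<close>
theorem exp_type_reciprocal_deriv_omits_imp_constant:
  assumes et: "exp_type h" and k: "2 \<le> k" and c: "c \<noteq> 0"
    and om: "\<And>z. h z \<noteq> 0 \<Longrightarrow> (deriv ^^ k) (\<lambda>z. 1 / h z) z \<noteq> c"
  shows "h constant_on UNIV"
proof (rule ccontr)
  assume nc: "\<not> h constant_on UNIV"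
  have h: "h holomorphic_on UNIV" using exp_type_holomorphic[OF et] .
  let ?\<Omega> = "{z. h z \<noteq> 0}"
  note op = open_nonzero_set[OF h]
  obtain w0 where w0: "h w0 \<noteq> 0" using nonconstant_obtain_nonzero[OF nc] .
  have nopoly: "h \<noteq> poly p" for p
    using poly_reciprocal_deriv_omits_imp_constant[OF c k, of p] om nc by metis
  define P where "P = reciprocal_deriv_num h"
  define W where "W = reciprocal_deriv_diff k c h"
  define T where "T = reciprocal_log_deriv k c h"
  \<comment> \<open>The numerator of \<open>W\<close>. It is again of exponential type, so
    \<open>T = E'/E - (k + 1) * h'/h\<close> consists of logarithmic derivatives that are controlled
    on good circles.\<close>
  define E where "E z = P k z - c * h z ^ (k + 1)" for z
  have W: "W z = E z / h z ^ (k + 1)" if "h z \<noteq> 0" for z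
    using higher_deriv_reciprocal[OF h that, of k] that
    by (simp add: W_def reciprocal_deriv_diff_def E_def P_def diff_divide_distrib)
  have Wnz: "W z \<noteq> 0" if "h z \<noteq> 0" for z
    using om[OF that] by (simp add: W_def reciprocal_deriv_diff_def)
  have Whol: "W holomorphic_on ?\<Omega>" unfolding W_def by (rule holomorphic_reciprocal_deriv_diff[OF h])
  have W': "deriv W z = P (Suc k) z / h z ^ (k + 2)" if "h z \<noteq> 0" for z
    using deriv_reciprocal_deriv_diff[OF h that, of k c] higher_deriv_reciprocal[OF h that, of "Suc k"]
    by (simp add: W_def P_def del: reciprocal_deriv_num.simps)
  have TW: "T z = deriv W z / W z" for z by (simp add: T_def W_def reciprocal_log_deriv_def)
  have Thol: "T holomorphic_on ?\<Omega>"
  proof -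
    have "(\<lambda>z. deriv W z / W z) holomorphic_on ?\<Omega>"
      by (intro holomorphic_on_divide holomorphic_deriv Whol op) (use Wnz in auto)
    then show ?thesis using TW by (metis (no_types, lifting) holomorphic_transform)
  qed
  have Ehol: "E holomorphic_on UNIV" unfolding E_def P_def
    by (intro holomorphic_intros holomorphic_reciprocal_deriv_num h)
  have hd: "(h has_field_derivative deriv h z) (at z)" for z using holomorphic_derivI[OF h open_UNIV] by simp
  have T_log: "T z = deriv E z / E z - of_nat (k + 1) * (deriv h z / h z)" if z: "h z \<noteq> 0" for z
  proof -
    have Ed: "(E has_field_derivative deriv E z) (at z)" using holomorphic_derivI[OF Ehol open_UNIV] by simp
    have "((\<lambda>z. E z / h z ^ (k + 1)) has_field_derivative
        (deriv E z * h z ^ (k + 1) - E z * (of_nat (k + 1) * (deriv h z * h z ^ k))) / (h z ^ (k + 1) * h z ^ (k + 1))) (at z)"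
      using DERIV_divide[OF Ed DERIV_power[OF hd, of "k + 1"]] z by simp
    moreover have "deriv W z = deriv (\<lambda>z. E z / h z ^ (k + 1)) z"
      by (rule deriv_cong_ev) (use W z op in \<open>auto simp: eventually_nhds intro!: exI[of _ ?\<Omega>]\<close>)
    ultimately have "deriv W z = (deriv E z * h z ^ (k + 1) - E z * (of_nat (k + 1) * (deriv h z * h z ^ k))) / (h z ^ (k + 1) * h z ^ (k + 1))"
      using DERIV_imp_deriv by fastforce
    moreover have "E z \<noteq> 0" using W[OF z] Wnz[OF z] by auto
    moreover have "(e' * x ^ (k + 1) - e * (N * (x' * x ^ k))) / (x ^ (k + 1) * x ^ (k + 1)) / (e / x ^ (k + 1))
        = e' / e - N * (x' / x)" if "x \<noteq> 0" "e \<noteq> 0" for e e' x x' N :: complex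
      using that by (simp add: field_simps)
    ultimately show ?thesis using z by (simp only: TW W[OF z] )
  qed
  have "(\<lambda>z. h z * T z) holomorphic_on ?\<Omega>"
    by (intro holomorphic_intros Thol holomorphic_on_subset[OF h]) auto
  moreover have "\<exists>r>0. \<exists>\<phi>. \<phi> holomorphic_on ball z0 r \<and> (\<forall>w\<in>ball z0 r - {z0}. h w * T w = \<phi> w)"
    if z0: "h z0 = 0" for z0
  proof (rule reciprocal_log_deriv_local_form[OF h nc z0 k, of c])
    fix m r h1 \<tau> \<omega> assume m: "0 < m" and "0 < r" and h1: "h1 holomorphic_on ball z0 r" and \<tau>: "\<tau> holomorphic_on ball z0 r"
      and heq: "\<forall>w\<in>ball z0 r. h w = (w - z0) ^ m * h1 w"
      and Teq: "\<forall>w\<in>ball z0 r - {z0}. reciprocal_log_deriv k c h w = \<tau> w / (w - z0)"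
    have "(\<lambda>w. (w - z0) ^ (m - 1) * h1 w * \<tau> w) holomorphic_on ball z0 r" by (intro holomorphic_intros h1 \<tau>)
    moreover have "h w * T w = (w - z0) ^ (m - 1) * h1 w * \<tau> w" if w: "w \<in> ball z0 r - {z0}" for w
    proof -
      have "(w - z0) ^ m = (w - z0) ^ (m - 1) * (w - z0)" using m by (metis power_minus_mult)
      moreover have "T w = \<tau> w / (w - z0)" "h w = (w - z0) ^ m * h1 w" using Teq heq w by (auto simp: T_def)
      ultimately show ?thesis using w by simp
    qed
    ultimately show ?thesis using \<open>0 < r\<close> by blast
  qed
  ultimately obtain u where uhol: "u holomorphic_on UNIV" and u: "\<And>z. h z \<noteq> 0 \<Longrightarrow> u z = h z * T z"
    using holomorphic_extension_over_zeros[OF h nc] by blast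
  have c_u: "c * u z = P k z / h z ^ k * T z - P (Suc k) z / h z ^ (k + 1)" if z: "h z \<noteq> 0" for z
  proof -
    have "P k z / h z ^ k = h z * (W z + c)"
      using z by (simp add: W[OF z] E_def field_simps)
    moreover have "P (Suc k) z / h z ^ (k + 1) = h z * deriv W z" using z by (simp add: W'[OF z])
    moreover have "deriv W z = W z * T z" using Wnz[OF z] by (simp add: TW)
    ultimately show ?thesis unfolding u[OF z] by (simp add: algebra_simps)
  qed
  have etP: "exp_type (P j)" for j unfolding P_def by (rule exp_type_reciprocal_deriv_num[OF et])
  have etE: "exp_type E" unfolding E_def
    by (intro exp_type_diff exp_type_mult exp_type_const exp_type_power etP et)
  have h0: "h \<noteq> (\<lambda>_. 0)" using w0 by auto
  have "\<exists>p. u = poly p"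
  proof -
    define S where "S = insert h (insert E (P ` {..k}))"
    have S: "finite S" "\<And>F. F \<in> S \<Longrightarrow> exp_type F" using et etE etP by (auto simp: S_def)
    obtain G where G: "circle_set G"
      and pb0: "\<forall>F\<in>S. poly_bounded_on G (\<lambda>z. deriv F z / F z)"
      and nz0: "\<forall>F\<in>S. F \<noteq> (\<lambda>_. 0) \<longrightarrow> (\<forall>z\<in>G. F z \<noteq> 0)"
      by (rule exp_type_circle_set[OF S])
    have pb: "poly_bounded_on G (\<lambda>z. deriv F z / F z)" if "F \<in> S" for F using pb0 that by blast
    have nz: "F z \<noteq> 0" if "F \<in> S" "F \<noteq> (\<lambda>_. 0)" "z \<in> G" for F z using nz0 that by blast
    have hz: "h z \<noteq> 0" if "z \<in> G" for z using nz[of h] h0 that by (simp add: S_def)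
    have pbh: "poly_bounded_on G (\<lambda>z. deriv h z / h z)" and pbE: "poly_bounded_on G (\<lambda>z. deriv E z / E z)"
      using pb[of h] pb[of E] by (simp_all add: S_def)
    have "poly_bounded_on G (\<lambda>z. deriv E z / E z - of_nat (k + 1) * (deriv h z / h z))"
      by (intro poly_bounded_intros pbh pbE)
    then have pbT: "poly_bounded_on G T" by (rule poly_bounded_on_cong) (rule T_log[OF hz, symmetric])
    \<comment> \<open>With \<open>g = 1/h\<close>, this quotient is the \<open>j\<close>-th
      derivative of \<open>g\<close> divided by \<open>g\<close>. The recursion expresses the next
      one through the logarithmic derivatives of \<open>P j\<close> and \<open>h\<close>, so the
      bound propagates.\<close>
    have pbP: "poly_bounded_on G (\<lambda>z. P j z / h z ^ j)" if "j \<le> Suc k" for j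
      using that
    proof (induction j)
      case 0 then show ?case by (simp add: P_def poly_bounded_on_const)
    next
      case (Suc j)
      have Pj: "poly_bounded_on G (\<lambda>z. deriv (P j) z / P j z)" using pb[of "P j"] Suc.prems by (simp add: S_def)
      have "poly_bounded_on G (\<lambda>z. (deriv (P j) z / P j z) * (P j z / h z ^ j)
          - of_nat (Suc j) * (deriv h z / h z) * (P j z / h z ^ j))"
        using Suc by (intro poly_bounded_intros Pj pbh) auto
      then show ?case
      proof (rule poly_bounded_on_cong)
        fix z assume z: "z \<in> G"
        have d: "deriv (P j) z / P j z * P j z = deriv (P j) z"
        proof (cases "P j = (\<lambda>_. 0)")
          case False
          then have "P j z \<noteq> 0" using nz[of "P j" z] z Suc.prems by (simp add: S_def)
          then show ?thesis by simp
        qed simp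
        have PS: "P (Suc j) z = h z * deriv (P j) z - of_nat (Suc j) * deriv h z * P j z"
          by (simp add: P_def)
        have "(x * p' - N * x' * p) / x ^ Suc j = p' / x ^ j - N * (x' / x) * (p / x ^ j)" if "x \<noteq> 0" for x x' p p' N :: complex
          using that by (simp add: field_simps)
        then have "P (Suc j) z / h z ^ Suc j = deriv (P j) z / h z ^ j - of_nat (Suc j) * (deriv h z / h z) * (P j z / h z ^ j)"
          unfolding PS using hz[OF z] by blast
        moreover have "deriv (P j) z / h z ^ j = (deriv (P j) z / P j z) * (P j z / h z ^ j)"
          using d by (metis times_divide_eq_right)
        ultimately show "(deriv (P j) z / P j z) * (P j z / h z ^ j)
          - of_nat (Suc j) * (deriv h z / h z) * (P j z / h z ^ j) = P (Suc j) z / h z ^ Suc j" by simp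
      qed
    qed
    have "poly_bounded_on G (\<lambda>z. 1 / c * (P k z / h z ^ k * T z - P (Suc k) z / h z ^ Suc k))"
      by (intro poly_bounded_intros pbP pbT) auto
    then have "poly_bounded_on G u"
      by (rule poly_bounded_on_cong) (use c_u hz c in \<open>auto simp: field_simps\<close>)
    then show ?thesis using entire_poly_bounded_on_circles_imp_poly[OF uhol G] by blast
  qed
  then obtain p where up: "u = poly p" by blast
  \<comment> \<open>If \<open>u\<close> vanished wherever \<open>h\<close> does not,
    \<open>W\<close> would have derivative 0 and \<open>1/h\<close> would have vanishing derivative
    of order \<open>k + 1\<close>.\<close>
  have u0: "\<exists>z. h z \<noteq> 0 \<and> u z \<noteq> 0"
  proof (rule ccontr)
    assume "\<nexists>z. h z \<noteq> 0 \<and> u z \<noteq> 0"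
    then have "T z = 0" if "h z \<noteq> 0" for z using u[OF that] that by auto
    then have "deriv W z = 0" if "h z \<noteq> 0" for z using TW[of z] Wnz[OF that] that by auto
    then have d0: "(deriv ^^ Suc k) (\<lambda>z. 1 / h z) z = 0" if "h z \<noteq> 0" for z
      using deriv_reciprocal_deriv_diff[OF h that, of k c] that by (simp add: W_def)
    obtain r where r: "0 < r" "ball w0 r \<subseteq> ?\<Omega>" using op w0 openE by blast
    have "h constant_on UNIV"
      by (rule entire_with_polynomial_inverse_constant[OF h r(1), of w0 "Suc k"]) (use r d0 in auto)
    then show False using nc by blast
  qed
  \<comment> \<open>The cube serves the multiple zeros of \<open>h\<close>: there \<open>u\<close>
    vanishes to order \<open>m - 1 \<ge> 1\<close>, so \<open>u^3\<close> absorbs the simple pole of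
    \<open>T\<close> and the double pole of the bracket. At a simple zero \<open>u\<close> does not
    help, but the bracket vanishes and cancels the pole of \<open>T\<close>. The separate factor
    \<open>T\<close> makes \<open>V * h = u^4 * (T^2 - (k + 1) * T')\<close>.\<close>
  define Vf where "Vf z = (h z * T z) ^ 3 * T z * ((T z)\<^sup>2 - of_nat (k + 1) * deriv T z)" for z
  have "Vf holomorphic_on ?\<Omega>" unfolding Vf_def
    by (intro holomorphic_intros Thol holomorphic_deriv op holomorphic_on_subset[OF h]) auto
  moreover have "\<exists>r>0. \<exists>\<phi>. \<phi> holomorphic_on ball z0 r \<and> (\<forall>w\<in>ball z0 r - {z0}. Vf w = \<phi> w)"
    if z0: "h z0 = 0" for z0
  proof (rule reciprocal_log_deriv_local_form[OF h nc z0 k, of c])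
    fix m r h1 \<tau> \<omega> assume m: "0 < m" and r: "0 < r" and h1: "h1 holomorphic_on ball z0 r" and \<tau>: "\<tau> holomorphic_on ball z0 r"
      and heq: "\<forall>w\<in>ball z0 r. h w = (w - z0) ^ m * h1 w"
      and Teq: "\<forall>w\<in>ball z0 r - {z0}. reciprocal_log_deriv k c h w = \<tau> w / (w - z0)"
      and T'eq: "\<forall>w\<in>ball z0 r - {z0}. deriv (reciprocal_log_deriv k c h) w = deriv \<tau> w / (w - z0) - \<tau> w / (w - z0)\<^sup>2"
      and m1: "m = 1 \<longrightarrow> (\<exists>\<sigma>. \<sigma> holomorphic_on ball z0 r \<and> (\<forall>w\<in>ball z0 r.
       (\<tau> w)\<^sup>2 + of_nat (k + 1) * \<tau> w - of_nat (k + 1) * (w - z0) * deriv \<tau> w = (w - z0) ^ 3 * \<sigma> w))"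
    define \<rho> where "\<rho> w = (\<tau> w)\<^sup>2 + of_nat (k + 1) * \<tau> w - of_nat (k + 1) * (w - z0) * deriv \<tau> w" for w
    have \<rho>: "\<rho> holomorphic_on ball z0 r" unfolding \<rho>_def by (intro holomorphic_intros \<tau> holomorphic_deriv) auto
    have Veq: "Vf w = ((w - z0) ^ (m - 1) * h1 w * \<tau> w) ^ 3 * \<tau> w * \<rho> w / (w - z0) ^ 3" if w: "w \<in> ball z0 r - {z0}" for w
    proof -
      have "(w - z0) ^ m = (w - z0) ^ (m - 1) * (w - z0)" using m by (metis power_minus_mult)
      moreover have 1: "T w = \<tau> w / (w - z0)" "h w = (w - z0) ^ m * h1 w" using Teq heq w by (auto simp: T_def)
      ultimately have 2: "h w * T w = (w - z0) ^ (m - 1) * h1 w * \<tau> w" using w by simp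
      have 3: "deriv T w = deriv \<tau> w / (w - z0) - \<tau> w / (w - z0)\<^sup>2" using T'eq w by (simp add: T_def)
      have "(t / d)\<^sup>2 - N * (t' / d - t / d\<^sup>2) = (t\<^sup>2 + N * t - N * d * t') / d\<^sup>2" if "d \<noteq> 0" for t t' d N :: complex
        using that by (simp add: field_simps power2_eq_square)
      then have 4: "(T w)\<^sup>2 - of_nat (k + 1) * deriv T w = \<rho> w / (w - z0)\<^sup>2"
        unfolding 1 3 \<rho>_def using w by simp
      have "Vf w = ((w - z0) ^ (m - 1) * h1 w * \<tau> w) ^ 3 * T w * (\<rho> w / (w - z0)\<^sup>2)"
        unfolding Vf_def 2 4 ..
      then show ?thesis by (simp add: 1(1) power3_eq_cube power2_eq_square)
    qed
    show ?thesis
    proof (cases "m = 1")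
      case True
      then obtain \<sigma> where \<sigma>: "\<sigma> holomorphic_on ball z0 r" "\<And>w. w \<in> ball z0 r \<Longrightarrow> \<rho> w = (w - z0) ^ 3 * \<sigma> w"
        using m1 unfolding \<rho>_def by blast
      have "(\<lambda>w. (h1 w * \<tau> w) ^ 3 * \<tau> w * \<sigma> w) holomorphic_on ball z0 r" by (intro holomorphic_intros h1 \<tau> \<sigma>)
      moreover have "Vf w = (h1 w * \<tau> w) ^ 3 * \<tau> w * \<sigma> w" if "w \<in> ball z0 r - {z0}" for w
        using Veq[OF that] \<sigma>(2)[of w] that True by simp
      ultimately show ?thesis using r by blast
    next
      case False
      have "(\<lambda>w. ((w - z0) ^ (m - 2) * h1 w * \<tau> w) ^ 3 * \<tau> w * \<rho> w) holomorphic_on ball z0 r"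
        by (intro holomorphic_intros h1 \<tau> \<rho>)
      moreover have "Vf w = ((w - z0) ^ (m - 2) * h1 w * \<tau> w) ^ 3 * \<tau> w * \<rho> w" if w: "w \<in> ball z0 r - {z0}" for w
      proof -
        have "m - 1 = Suc (m - 2)" using m False by simp
        then have "(w - z0) ^ (m - 1) = (w - z0) * (w - z0) ^ (m - 2)" by simp
        then show ?thesis using Veq[OF w] w by (simp add: power_mult_distrib)
      qed
      ultimately show ?thesis using r by blast
    qed
  qed
  ultimately obtain V where Vhol: "V holomorphic_on UNIV" and V: "\<And>z. h z \<noteq> 0 \<Longrightarrow> V z = Vf z"
    using holomorphic_extension_over_zeros[OF h nc] by blast
  have unz: "u \<noteq> (\<lambda>_. 0)" using u0 by auto
  \<comment> \<open>New circles are chosen because \<open>deriv T\<close> involves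
    \<open>u'/u\<close>; that \<open>u\<close> is of exponential type is known only now that it is a
    polynomial.\<close>
  have S: "finite {h, E, u}" "\<And>F. F \<in> {h, E, u} \<Longrightarrow> exp_type F"
    using et etE exp_type_poly[of p] up by auto
  obtain G where G: "circle_set G"
    and pb: "\<forall>F\<in>{h, E, u}. poly_bounded_on G (\<lambda>z. deriv F z / F z)"
    and nz: "\<forall>F\<in>{h, E, u}. F \<noteq> (\<lambda>_. 0) \<longrightarrow> (\<forall>z\<in>G. F z \<noteq> 0)"
    by (rule exp_type_circle_set[OF S])
  have hz: "h z \<noteq> 0" and uz: "u z \<noteq> 0" if "z \<in> G" for z using nz h0 unz that by auto
  have Tuh: "T z = u z / h z" if "h z \<noteq> 0" for z using u[OF that] that by simp
  have T'uh: "deriv T z = T z * (deriv u z / u z - deriv h z / h z)" if z: "h z \<noteq> 0" "u z \<noteq> 0" for z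
  proof -
    have ud: "(u has_field_derivative deriv u z) (at z)" using holomorphic_derivI[OF uhol open_UNIV] by simp
    have "((\<lambda>z. u z / h z) has_field_derivative (deriv u z * h z - u z * deriv h z) / (h z * h z)) (at z)"
      using DERIV_divide[OF ud hd z(1)] by simp
    moreover have "deriv T z = deriv (\<lambda>z. u z / h z) z"
      by (rule deriv_cong_ev) (use Tuh z op in \<open>auto simp: eventually_nhds intro!: exI[of _ ?\<Omega>]\<close>)
    ultimately have "deriv T z = (deriv u z * h z - u z * deriv h z) / (h z * h z)"
      using DERIV_imp_deriv by fastforce
    moreover have "(b' * a - b * a') / (a * a) = b / a * (b' / b - a' / a)"
      if "a \<noteq> 0" "b \<noteq> 0" for a a' b b' :: complex
      using that by (simp add: field_simps)
    ultimately show ?thesis using z unfolding Tuh[OF z(1)] by metis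
  qed
  have pbh: "poly_bounded_on G (\<lambda>z. deriv h z / h z)" and pbE: "poly_bounded_on G (\<lambda>z. deriv E z / E z)"
    and pbu': "poly_bounded_on G (\<lambda>z. deriv u z / u z)" using pb by auto
  have pbu: "poly_bounded_on G u" unfolding up by (rule poly_bounded_on_poly)
  have "poly_bounded_on G (\<lambda>z. deriv E z / E z - of_nat (k + 1) * (deriv h z / h z))"
    by (intro poly_bounded_intros pbh pbE)
  then have pbT: "poly_bounded_on G T" by (rule poly_bounded_on_cong) (rule T_log[OF hz, symmetric])
  have "poly_bounded_on G (\<lambda>z. T z * (deriv u z / u z - deriv h z / h z))"
    by (intro poly_bounded_intros pbh pbu' pbT)
  then have pbT': "poly_bounded_on G (deriv T)" by (rule poly_bounded_on_cong) (rule T'uh[OF hz uz, symmetric])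
  have Vu: "V z = u z ^ 3 * T z * ((T z)\<^sup>2 - of_nat (k + 1) * deriv T z)" if "h z \<noteq> 0" for z
    using V[OF that] u[OF that] by (simp add: Vf_def)
  have "poly_bounded_on G (\<lambda>z. u z ^ 3 * T z * ((T z)\<^sup>2 - of_nat (k + 1) * deriv T z))"
    by (intro poly_bounded_intros pbu pbT pbT')
  then have "poly_bounded_on G V" by (rule poly_bounded_on_cong) (use Vu hz in auto)
  then obtain v where v: "V = poly v" using entire_poly_bounded_on_circles_imp_poly[OF Vhol G] by blast
  show False
  proof (cases "v = 0")
    \<comment> \<open>If \<open>V = 0\<close>, then \<open>T^2 = (k + 1) * T'\<close> near a point
      where \<open>u\<close> and \<open>h\<close> do not vanish. With \<open>T = u / h\<close> this
      says that \<open>h / u\<close> has derivative \<open>- 1 / (k + 1)\<close>, so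
      \<open>h\<close> is \<open>u\<close> times a linear function, a polynomial.\<close>
    case True
    obtain w where w: "h w \<noteq> 0" "u w \<noteq> 0" using u0 by blast
    have "open (?\<Omega> \<inter> {z. u z \<noteq> 0})" using op open_nonzero_set[OF uhol] by blast
    then obtain r where r: "0 < r" "ball w r \<subseteq> ?\<Omega> \<inter> {z. u z \<noteq> 0}" using w openE by blast
    have rel: "deriv h z * u z - h z * deriv u z = - (u z)\<^sup>2 / of_nat (k + 1)" if z: "z \<in> ball w r" for z
    proof -
      have hu: "h z \<noteq> 0" "u z \<noteq> 0" using r z by auto
      then have Tz: "T z \<noteq> 0" by (simp add: Tuh)
      have "(T z)\<^sup>2 = of_nat (k + 1) * deriv T z"
        using Vu[OF hu(1)] hu(2) Tz True v by simp
      then have "T z = of_nat (k + 1) * (deriv u z / u z - deriv h z / h z)"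
        unfolding T'uh[OF hu] using Tz by (simp add: power2_eq_square)
      then have e: "u z / h z = of_nat (k + 1) * (deriv u z / u z - deriv h z / h z)" using Tuh[OF hu(1)] by simp
      have N: "of_nat (k + 1) \<noteq> (0::complex)" using of_nat_neq_0[of k] by simp
      have "x' * y - x * y' = - y\<^sup>2 / N" if "y / x = N * (y' / y - x' / x)" "x \<noteq> 0" "y \<noteq> 0" "N \<noteq> 0" for x x' y y' N :: complex
        using that by (simp add: field_simps power2_eq_square)
      from this[OF e hu N] show ?thesis .
    qed
    define q where "q z = h z / u z + z / of_nat (k + 1)" for z
    have "(q has_field_derivative 0) (at z within ball w r)" if z: "z \<in> ball w r" for z
    proof -
      have hu: "h z \<noteq> 0" "u z \<noteq> 0" using r z by auto
      have ud: "(u has_field_derivative deriv u z) (at z)" using holomorphic_derivI[OF uhol open_UNIV] by simp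
      have "(q has_field_derivative (deriv h z * u z - h z * deriv u z) / (u z * u z) + 1 / of_nat (k + 1)) (at z)"
        unfolding q_def by (intro DERIV_add DERIV_divide[OF hd ud hu(2)] DERIV_cdivide DERIV_ident)
      moreover have "(deriv h z * u z - h z * deriv u z) / (u z * u z) + 1 / of_nat (k + 1) = 0"
        unfolding rel[OF z] using hu by (simp add: power2_eq_square)
      ultimately show ?thesis using has_field_derivative_at_within by metis
    qed
    then obtain \<kappa> where \<kappa>: "\<And>z. z \<in> ball w r \<Longrightarrow> q z = \<kappa>"
      using has_field_derivative_zero_constant[of "ball w r" q] by auto
    have "h z = u z * (\<kappa> - z / of_nat (k + 1))" for z
    proof (rule entire_eqI_on_ball[OF h _ r(1)])
      show "(\<lambda>z. u z * (\<kappa> - z / of_nat (k + 1))) holomorphic_on UNIV"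
        by (intro holomorphic_intros uhol) simp
      show "h z = u z * (\<kappa> - z / of_nat (k + 1))" if z: "z \<in> ball w r" for z
      proof -
        have "u z \<noteq> 0" using r z by auto
        then show ?thesis using \<kappa>[OF z] by (simp add: q_def field_simps)
      qed
    qed
    then have "h z = poly (p * [:\<kappa>, - 1 / of_nat (k + 1):]) z" for z by (simp add: up algebra_simps)
    then show False using nopoly by blast
  next
    \<comment> \<open>Otherwise \<open>V * h = u^4 * (T^2 - (k + 1) * T')\<close> is solved for
      \<open>h\<close> on the part of the good circles where the polynomial \<open>V\<close> is
      bounded away from 0.\<close>
    case False
    obtain A d where d: "0 < d" "\<And>z. A \<le> cmod z \<Longrightarrow> d \<le> cmod (poly v z)"
      using poly_bounded_below[OF False] by blast
    define G' where "G' = G \<inter> {z. A \<le> cmod z}"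
    have G': "circle_set G'" unfolding G'_def by (rule circle_set_Int_outside_ball[OF G])
    have sub: "G' \<subseteq> G" by (auto simp: G'_def)
    have inv: "poly_bounded_on G' (\<lambda>z. 1 / V z)"
    proof (rule poly_bounded_onI[of "1 / d" _ _ 0])
      fix z assume "z \<in> G'"
      then have "d \<le> cmod (V z)" using d(2) by (auto simp: G'_def v)
      then show "cmod (1 / V z) \<le> 1 / d * (1 + cmod z) ^ 0" using d(1) by (simp add: norm_divide frac_le)
    qed (use d in auto)
    have "poly_bounded_on G' (\<lambda>z. u z ^ 4 * ((T z)\<^sup>2 - of_nat (k + 1) * deriv T z) * (1 / V z))"
      by (intro poly_bounded_intros poly_bounded_on_subset[OF pbu sub] poly_bounded_on_subset[OF pbT sub]
          poly_bounded_on_subset[OF pbT' sub] inv)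
    then have "poly_bounded_on G' h"
    proof (rule poly_bounded_on_cong)
      fix z assume z: "z \<in> G'"
      then have hu: "h z \<noteq> 0" "u z \<noteq> 0" using hz uz sub by auto
      have "V z \<noteq> 0" using d z by (fastforce simp: G'_def v)
      moreover have "V z * h z = u z ^ 4 * ((T z)\<^sup>2 - of_nat (k + 1) * deriv T z)"
        unfolding Vu[OF hu(1)] using hu by (subst (1) Tuh[OF hu(1)]) (simp add: power_def numeral_eq_Suc)
      ultimately show "u z ^ 4 * ((T z)\<^sup>2 - of_nat (k + 1) * deriv T z) * (1 / V z) = h z"
        by (simp add: field_simps)
    qed
    then show False using entire_poly_bounded_on_circles_imp_poly[OF h G'] nopoly by metis
  qed
qed

section \<open>Rescaling and normality\<close>

text \<open>The rescaling of Zalcman and Pang.  The pair \<open>(\<rho>, z)\<close> is chosen with minimal \<open>\<rho>\<close> among those where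
  the function rescaled by \<open>\<rho> (1 - |z - z0|/R)\<close> has spherical derivative at least \<open>1\<close>
  at the origin.\<close>
lemma Zalcman_Pang_rescaling:
  fixes h :: "complex \<Rightarrow> complex" and A R :: real and k :: nat
  defines "\<rho>0 \<equiv> min 1 (R / (2 * A))"
  assumes D: "open D" "cball z0 R \<subseteq> D" and h: "h holomorphic_on D" and R: "0 < R" and A: "0 < A"
    and z1: "z1 \<in> ball z0 (R / 2)" and big: "(2 / \<rho>0) ^ (k + 1) * (1 + (cmod (h z1))\<^sup>2) \<le> cmod (deriv h z1)"
  obtains z t where "0 < t" "\<forall>\<zeta>\<in>ball 0 A. z + of_real t * \<zeta> \<in> ball z0 R"
    "t ^ (k + 1) * cmod (deriv h z) \<ge> 1 + t ^ (2 * k) * (cmod (h z))\<^sup>2"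
    "\<forall>\<zeta>\<in>ball 0 A. t ^ (k + 1) * cmod (deriv h (z + of_real t * \<zeta>))
       \<le> 2 ^ (k + 1) * (1 + t ^ (2 * k) * (cmod (h (z + of_real t * \<zeta>)))\<^sup>2)"
proof -
  have \<rho>0: "0 < \<rho>0" "\<rho>0 \<le> 1" "\<rho>0 * A \<le> R / 2"
  proof -
    show "0 < \<rho>0" "\<rho>0 \<le> 1" using R A by (auto simp: \<rho>0_def)
    have "\<rho>0 * A \<le> R / (2 * A) * A" using A by (intro mult_right_mono) (auto simp: \<rho>0_def)
    then show "\<rho>0 * A \<le> R / 2" using A by simp
  qed
  define s where "s p = fst p * (1 - cmod (snd p - z0) / R)" for p :: "real \<times> complex"
  \<comment> \<open>For \<open>p = (\<rho>, z)\<close> and \<open>s = s p\<close>, the condition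
    \<open>0 \<le> \<Phi> p\<close> says that \<open>s^k * h(z + s * \<zeta>)\<close> has spherical
    derivative at least 1 at the origin. Where \<open>s p = 0\<close> the value is negative, which
    keeps the extremal \<open>z\<close> off the boundary and the extremal \<open>\<rho>\<close>
    positive.\<close>
  define \<Phi> where "\<Phi> p = s p ^ (k + 1) * cmod (deriv h (snd p)) - (1 + s p ^ (2 * k) * (cmod (h (snd p)))\<^sup>2)" for p
  define K where "K = {0..\<rho>0} \<times> cball z0 R"
  define S where "S = {p \<in> K. 0 \<le> \<Phi> p}"
  have compK: "compact K" unfolding K_def by (intro compact_Times) auto
  have ch: "continuous_on (cball z0 R) h" "continuous_on (cball z0 R) (deriv h)"
    using continuous_on_subset[OF holomorphic_on_imp_continuous_on[OF h] D(2)]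
      continuous_on_subset[OF holomorphic_on_imp_continuous_on[OF holomorphic_deriv[OF h D(1)]] D(2)] by auto
  have snd: "continuous_on K snd" "snd ` K \<subseteq> cball z0 R"
    by (auto intro!: continuous_intros simp: K_def)
  have "continuous_on K (\<lambda>p. h (snd p))" "continuous_on K (\<lambda>p. deriv h (snd p))"
    by (rule continuous_on_compose2[OF ch(1) snd], rule continuous_on_compose2[OF ch(2) snd])
  then have cont: "continuous_on K \<Phi>" unfolding \<Phi>_def s_def
    by (intro continuous_on_diff continuous_on_add continuous_on_mult continuous_on_power continuous_on_norm
        continuous_on_divide continuous_on_const continuous_on_fst continuous_on_snd continuous_on_id)
       (use R in auto)
  have "closed (K \<inter> \<Phi> -` {0..})"
    by (rule continuous_closed_preimage[OF cont compact_imp_closed[OF compK]]) simp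
  moreover have "S = K \<inter> \<Phi> -` {0..}" by (auto simp: S_def)
  ultimately have compS: "compact S" using compact_Int_closed[OF compK] by (metis Int_left_absorb)
  \<comment> \<open>As \<open>z1\<close> lies in the disc of half the radius, its scale
    \<open>t\<close> is between \<open>\<rho>0 / 2\<close> and 1, and the factor
    \<open>(2 / \<rho>0) ^ (k + 1)\<close> in \<open>big\<close> makes up for
    \<open>t ^ (k + 1)\<close>.\<close>
  have "(\<rho>0, z1) \<in> S"
  proof -
    have d: "cmod (z1 - z0) \<le> R / 2" using z1 by (simp add: dist_norm norm_minus_commute)
    define t where "t = s (\<rho>0, z1)"
    have t: "\<rho>0 / 2 \<le> t" "t \<le> 1"
    proof -
      have "1 / 2 \<le> 1 - cmod (z1 - z0) / R" using d R by (simp add: field_simps)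
      then have "\<rho>0 * (1 / 2) \<le> t" unfolding t_def s_def using \<rho>0 by (simp add: mult_left_mono)
      then show "\<rho>0 / 2 \<le> t" by simp
      have "t \<le> 1 * 1" unfolding t_def s_def using \<rho>0 R \<open>1 / 2 \<le> 1 - cmod (z1 - z0) / R\<close> by (intro mult_mono) auto
      then show "t \<le> 1" by simp
    qed
    have t0: "0 < t" using t \<rho>0 by linarith
    have "1 + t ^ (2 * k) * (cmod (h z1))\<^sup>2 \<le> 1 + (cmod (h z1))\<^sup>2"
      using t t0 by (simp add: mult_left_le_one_le power_le_one)
    also have "\<dots> = (\<rho>0 / 2) ^ (k + 1) * ((2 / \<rho>0) ^ (k + 1) * (1 + (cmod (h z1))\<^sup>2))"
      unfolding mult.assoc[symmetric] power_mult_distrib[symmetric] using \<rho>0 by simp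
    also have "\<dots> \<le> t ^ (k + 1) * cmod (deriv h z1)"
      using t \<rho>0 big t0 by (intro mult_mono power_mono) (auto intro!: mult_nonneg_nonneg add_nonneg_nonneg)
    finally have "0 \<le> \<Phi> (\<rho>0, z1)" by (simp add: \<Phi>_def t_def)
    moreover have "z1 \<in> cball z0 R" using z1 R by auto
    ultimately show ?thesis using \<rho>0 by (simp add: S_def K_def)
  qed
  then have "S \<noteq> {}" by blast
  then obtain p where p: "p \<in> S" and pmin: "\<And>q. q \<in> S \<Longrightarrow> fst p \<le> fst q"
    using continuous_attains_inf[OF compS _ continuous_on_fst[OF continuous_on_id]] by blast
  obtain \<rho> z where pz: "p = (\<rho>, z)" by (cases p)
  define t where "t = s p"
  have \<Phi>p: "1 + t ^ (2 * k) * (cmod (h z))\<^sup>2 \<le> t ^ (k + 1) * cmod (deriv h z)"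
    using p by (simp add: S_def \<Phi>_def t_def pz)
  have \<rho>: "0 \<le> \<rho>" "\<rho> \<le> \<rho>0" and zR: "cmod (z - z0) \<le> R"
    using p by (auto simp: S_def K_def pz dist_norm norm_minus_commute)
  have tdef: "t = \<rho> * (1 - cmod (z - z0) / R)" by (simp add: t_def s_def pz)
  have "t \<noteq> 0"
  proof
    assume "t = 0"
    then have "1 + t ^ (2 * k) * (cmod (h z))\<^sup>2 \<le> 0" using \<Phi>p by simp
    moreover have "0 \<le> t ^ (2 * k) * (cmod (h z))\<^sup>2" by (simp add: power_mult)
    ultimately show False by linarith
  qed
  moreover have "0 \<le> t" unfolding tdef using \<rho> zR R by (intro mult_nonneg_nonneg) auto
  ultimately have t0: "0 < t" by simp
  then have \<rho>pos: "0 < \<rho>" using \<rho> tdef by (metis less_eq_real_def less_irrefl mult_zero_left)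
  have tR: "t * R = \<rho> * (R - cmod (z - z0))" unfolding tdef using R by (simp add: field_simps)
  have main: "z + of_real t * \<zeta> \<in> ball z0 R \<and> t ^ (k + 1) * cmod (deriv h (z + of_real t * \<zeta>))
       \<le> 2 ^ (k + 1) * (1 + t ^ (2 * k) * (cmod (h (z + of_real t * \<zeta>)))\<^sup>2)" if \<zeta>: "\<zeta> \<in> ball 0 A" for \<zeta>
  proof -
    define w where "w = z + of_real t * \<zeta>"
    define e where "e = R - cmod (z - z0)"
    have e0: "0 < e" using t0 tR R \<rho>pos by (metis e_def mult_pos_pos zero_less_mult_pos)
    have "cmod (w - z0) \<le> cmod (z - z0) + t * cmod \<zeta>"
      using norm_triangle_ineq[of "z - z0" "of_real t * \<zeta>"] t0 by (simp add: w_def norm_mult algebra_simps)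
    \<comment> \<open>\<open>\<rho>0 * A \<le> R / 2\<close> keeps the rescaled disc within half the
      distance \<open>e\<close> from \<open>z\<close> to the boundary.\<close>
    moreover have "t * cmod \<zeta> < e / 2"
    proof -
      have "t * cmod \<zeta> < t * A" using \<zeta> t0 by simp
      moreover have "t * A * R \<le> e / 2 * R"
      proof -
        have "\<rho> * A \<le> \<rho>0 * A" using \<rho> A by (intro mult_right_mono) auto
        then have "\<rho> * A \<le> R / 2" using \<rho>0(3) by linarith
        then have "(\<rho> * A) * e \<le> R / 2 * e" using e0 by (intro mult_right_mono) auto
        moreover have "t * A * R = (\<rho> * A) * e"
        proof -
          have "t * A * R = t * R * A" by (simp only: mult_ac)
          also have "\<dots> = \<rho> * e * A" unfolding tR e_def ..
          finally show ?thesis by (simp only: mult_ac)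
        qed
        moreover have "R / 2 * e = e / 2 * R" by simp
        ultimately show ?thesis by linarith
      qed
      then have "t * A \<le> e / 2" using R by simp
      ultimately show ?thesis by linarith
    qed
    ultimately have far: "e / 2 < R - cmod (w - z0)" by (simp add: e_def)
    then have win: "w \<in> ball z0 R" using e0 by (simp add: dist_norm norm_minus_commute)
    \<comment> \<open>Chosen so that \<open>(\<rho>', w)\<close> has scale \<open>t / 2\<close>.
      Since \<open>w\<close> is farther than \<open>e / 2\<close> from the boundary,
      \<open>\<rho>' < \<rho>\<close>, and by minimality the condition fails there. Halving the
      scale is the source of \<open>2 ^ (k + 1)\<close>.\<close>
    define \<rho>' where "\<rho>' = t / 2 / (1 - cmod (w - z0) / R)"
    have q0: "0 < 1 - cmod (w - z0) / R" using far e0 R by (simp add: field_simps)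
    have "\<rho>' < \<rho>"
    proof -
      have "t * R / 2 = \<rho> * (e / 2)" using tR by (simp add: e_def)
      also have "\<dots> < \<rho> * (R - cmod (w - z0))" using far \<rho>pos by simp
      finally have "t / 2 < \<rho> * (1 - cmod (w - z0) / R)" using R by (simp add: field_simps)
      then show ?thesis unfolding \<rho>'_def pos_divide_less_eq[OF q0] .
    qed
    then have "(\<rho>', w) \<notin> S" using pmin[of "(\<rho>', w)"] by (auto simp: pz)
    moreover have "(\<rho>', w) \<in> K"
      using \<open>\<rho>' < \<rho>\<close> \<rho> win t0 q0 by (auto simp: K_def \<rho>'_def)
    ultimately have "\<Phi> (\<rho>', w) < 0" by (auto simp: S_def)
    moreover have "x / q * q = x" if "q \<noteq> 0" for x q :: real using that by simp
    then have "s (\<rho>', w) = t / 2" using q0 unfolding s_def \<rho>'_def fst_conv snd_conv by (metis less_irrefl)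
    ultimately have "(t / 2) ^ (k + 1) * cmod (deriv h w) < 1 + (t / 2) ^ (2 * k) * (cmod (h w))\<^sup>2"
      by (simp add: \<Phi>_def)
    also have "\<dots> \<le> 1 + t ^ (2 * k) * (cmod (h w))\<^sup>2"
      using t0 by (intro add_left_mono mult_right_mono power_mono) auto
    finally have "t ^ (k + 1) * cmod (deriv h w) \<le> 2 ^ (k + 1) * (1 + t ^ (2 * k) * (cmod (h w))\<^sup>2)"
      by (simp add: power_divide field_simps)
    then show ?thesis using win by (simp add: w_def)
  qed
  show thesis by (rule that[OF t0]) (use main \<Phi>p in auto)
qed

text \<open>The growth bound needs a nearby point with \<open>cmod (H b) \<le> 1\<close>. If
  \<open>cball 0 2\<close> contained none, Cauchy's estimate for \<open>1/H\<close> would give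
  \<open>cmod (deriv H 0) \<le> (cmod (H 0))\<^sup>2 / 2\<close>, against the normalisation
  \<open>H0\<close>.\<close>

lemma spherical_derivative_bound_imp_exp_bound_normalized:
  assumes hol: "H holomorphic_on ball 0 A" and A: "2 < A"
    and sph: "\<And>z. z \<in> ball 0 A \<Longrightarrow> cmod (deriv H z) \<le> M * (1 + (cmod (H z))\<^sup>2)"
    and H0: "1 + (cmod (H 0))\<^sup>2 \<le> cmod (deriv H 0)"
    and z: "2 * cmod z + 2 < A" and M: "0 \<le> M"
  shows "cmod (H z) \<le> exp (4 * M * (cmod z + 2))"
proof -
  have "\<exists>b. cmod b \<le> 2 \<and> cmod (H b) \<le> 1"
  proof (rule ccontr)
    assume "\<nexists>b. cmod b \<le> 2 \<and> cmod (H b) \<le> 1"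
    then have gt: "1 < cmod (H b)" if "cmod b \<le> 2" for b using that by force
    then have nz: "H b \<noteq> 0" if "cmod b \<le> 2" for b using gt[OF that] by auto
    have hol2: "H holomorphic_on cball 0 2" using hol by (rule holomorphic_on_subset) (use A in auto)
    have "cmod ((deriv ^^ 1) (\<lambda>z. 1 / H z) 0) \<le> fact 1 * 1 / 2 ^ 1"
    proof (rule Cauchy_inequality)
      show "(\<lambda>z. 1 / H z) holomorphic_on ball 0 2"
        by (intro holomorphic_intros holomorphic_on_subset[OF hol2]) (use nz in auto)
      show "continuous_on (cball 0 2) (\<lambda>z. 1 / H z)"
        by (intro continuous_intros holomorphic_on_imp_continuous_on[OF hol2]) (use nz in auto)
      fix w :: complex assume "cmod (0 - w) = 2"
      then show "cmod (1 / H w) \<le> 1" using gt[of w] by (simp add: norm_divide divide_le_eq)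
    qed auto
    moreover have "(H has_field_derivative deriv H 0) (at 0)"
      using hol A by (intro holomorphic_derivI) auto
    then have "((\<lambda>z. 1 / H z) has_field_derivative - deriv H 0 / (H 0 * H 0)) (at 0)"
      using DERIV_divide[OF DERIV_const[of 1], of H "deriv H 0" 0 UNIV] nz[of 0] by simp
    then have "deriv (\<lambda>z. 1 / H z) 0 = - deriv H 0 / (H 0 * H 0)" by (rule DERIV_imp_deriv)
    ultimately have "cmod (deriv H 0) / (cmod (H 0))\<^sup>2 \<le> 1 / 2"
      by (simp add: norm_divide norm_mult power2_eq_square)
    then have "cmod (deriv H 0) \<le> (cmod (H 0))\<^sup>2 / 2" using nz[of 0] by (simp add: field_simps)
    then show False using H0 zero_le_power2[of "cmod (H 0)"] by linarith
  qed
  then obtain b where b: "cmod b \<le> 2" "cmod (H b) \<le> 1" by blast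
  have d: "dist z b \<le> cmod z + 2" using norm_triangle_ineq4[of z b] b(1) by (simp add: dist_norm)
  have "cmod (H z) \<le> exp (4 * M * dist z b)"
    by (rule spherical_derivative_bound_imp_exp_bound[OF hol sph b(2)]) (use d z in auto)
  also have "\<dots> \<le> exp (4 * M * (cmod z + 2))" using d M by (simp add: mult_left_mono)
  finally show ?thesis .
qed

section \<open>Compactness: diagonal subsequences, limits and omitted values\<close>

lemma diagonal_uniform_limit:
  fixes f :: "nat \<Rightarrow> 'a \<Rightarrow> 'b::metric_space" and K :: "nat \<Rightarrow> 'a set"
    and A :: "nat \<Rightarrow> ('a \<Rightarrow> 'b) \<Rightarrow> bool"
  assumes sub: "\<And>m s. strict_mono (s :: nat \<Rightarrow> nat) \<Longrightarrow>
    \<exists>r. strict_mono r \<and> (\<exists>g. A m g \<and> uniform_limit (K m) (\<lambda>n. f (s (r n))) g sequentially)"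
  obtains d where "strict_mono (d :: nat \<Rightarrow> nat)"
    "\<forall>m. \<exists>g. A m g \<and> uniform_limit (K m) (\<lambda>n. f (d n)) g sequentially"
proof -
  define P where "P m s \<longleftrightarrow> (\<exists>g. A m g \<and> uniform_limit (K m) (\<lambda>n. f (s n)) g sequentially)"
    for m :: nat and s :: "nat \<Rightarrow> nat"
  interpret subseqs P by unfold_locales (use sub in \<open>simp add: P_def o_def\<close>)
  have stable: "P m (s \<circ> r)" if "strict_mono r" "P m s" for r s m
    using that(2) filterlim_compose[OF _ filterlim_subseq[OF that(1)]] unfolding P_def o_def by blast
  have "\<exists>g. A m g \<and> uniform_limit (K m) (\<lambda>n. f (diagseq n)) g sequentially" for m
  proof -
    \<comment> \<open>The diagonal sequence inherits \<open>P m\<close> after dropping its first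
      \<open>Suc m\<close> terms; uniform convergence ignores this shift.\<close>
    have "P m (diagseq \<circ> (+) (Suc m))" by (rule diagseq_holds) (rule stable)
    then obtain g where g: "A m g" and ul: "uniform_limit (K m) (\<lambda>n. f (diagseq (Suc m + n))) g sequentially"
      unfolding P_def by auto
    have "\<forall>\<^sub>F n in sequentially. \<forall>x\<in>K m. dist (f (diagseq n) x) (g x) < e" if "0 < e" for e
    proof -
      have "\<forall>\<^sub>F n in sequentially. \<forall>x\<in>K m. dist (f (diagseq (n + Suc m)) x) (g x) < e"
        using ul that unfolding uniform_limit_iff by (simp add: add.commute)
      then show ?thesis by (rule eventually_sequentially_seg[THEN iffD1])
    qed
    then show ?thesis using g unfolding uniform_limit_iff by blast
  qed
  then show thesis using that[OF subseq_diagseq] by blast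
qed

text \<open>On the disc of radius \<open>m\<close> only the functions of index at least
  \<open>m\<close> are controlled, so Montel's theorem is applied to tails and the limits are glued
  through pointwise limits. The bound is the same for all \<open>n\<close> and passes to the
  limit.\<close>

lemma Montel_expanding_balls:
  fixes H :: "nat \<Rightarrow> complex \<Rightarrow> complex"
  assumes hol: "\<And>n. H n holomorphic_on ball 0 (real n)"
    and bd: "\<And>n z. z \<in> ball 0 (real n) \<Longrightarrow> cmod (H n z) \<le> exp (C * (1 + cmod z))" and C: "0 \<le> C"
  obtains L r where "exp_type L" "strict_mono (r :: nat \<Rightarrow> nat)"
    "\<And>m. uniform_limit (cball 0 (real m)) (H \<circ> r) L sequentially"
proof -
  have sub: "\<exists>r. strict_mono r \<and> (\<exists>L. L holomorphic_on ball 0 (real m) \<and>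
      uniform_limit (cball 0 (real m - 1)) (\<lambda>n. H (s (r n))) L sequentially)"
    if s: "strict_mono (s :: nat \<Rightarrow> nat)" for m s
  proof -
    define F where "F n = H (s (n + m))" for n
    have big: "real m \<le> real (s (n + m))" for n
      using seq_suble[OF s, of "n + m"] by simp
    have Fhol: "F n holomorphic_on ball 0 (real m)" for n
      unfolding F_def by (rule holomorphic_on_subset[OF hol]) (use big[of n] in auto)
    have Fbd: "cmod (F n z) \<le> exp (C * (1 + real m))" if "z \<in> ball 0 (real m)" for n z
    proof -
      have "z \<in> ball 0 (real (s (n + m)))" using that big[of n] by simp
      then have "cmod (F n z) \<le> exp (C * (1 + cmod z))" unfolding F_def by (rule bd)
      also have "\<dots> \<le> exp (C * (1 + real m))" using that C by (simp add: mult_left_mono)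
      finally show ?thesis .
    qed
    have "\<exists>B. \<forall>h\<in>range F. \<forall>z\<in>K. cmod (h z) \<le> B" if "K \<subseteq> ball 0 (real m)" for K
      using Fbd that by blast
    then obtain g r where g: "g holomorphic_on ball 0 (real m)" and r: "strict_mono (r :: nat \<Rightarrow> nat)"
      and ul: "\<And>K. \<lbrakk>compact K; K \<subseteq> ball 0 (real m)\<rbrakk> \<Longrightarrow> uniform_limit K (F \<circ> r) g sequentially"
      using Montel[of "ball 0 (real m)" "range F" F] Fhol by (metis (no_types, lifting) open_ball order_refl rangeE)
    have "strict_mono (\<lambda>n. r n + m)" using r by (simp add: strict_mono_def)
    moreover have "uniform_limit (cball 0 (real m - 1)) (F \<circ> r) g sequentially"
      by (rule ul) auto
    then have "uniform_limit (cball 0 (real m - 1)) (\<lambda>n. H (s (r n + m))) g sequentially"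
      by (simp add: F_def o_def)
    ultimately show ?thesis using g by blast
  qed
  \<comment> \<open>The closed disc of radius \<open>real m - 1\<close> is a compact subset of the
    open disc of radius \<open>m\<close>; for \<open>m = 0\<close> it is empty.\<close>
  obtain d where d: "strict_mono (d :: nat \<Rightarrow> nat)"
    and Ld: "\<forall>m. \<exists>L. L holomorphic_on ball 0 (real m) \<and>
      uniform_limit (cball 0 (real m - 1)) (\<lambda>n. H (d n)) L sequentially"
    by (rule diagonal_uniform_limit[where A = "\<lambda>m L. L holomorphic_on ball 0 (real m)"
          and K = "\<lambda>m. cball 0 (real m - 1)", OF sub])
  from Ld obtain Lf where Lf: "\<And>m. Lf m holomorphic_on ball 0 (real m)"
    "\<And>m. uniform_limit (cball 0 (real m - 1)) (\<lambda>n. H (d n)) (Lf m) sequentially" by metis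
  define L where "L z = lim (\<lambda>n. H (d n) z)" for z
  have pt: "(\<lambda>n. H (d n) z) \<longlonglongrightarrow> Lf m z" if "z \<in> cball 0 (real m - 1)" for z m
    using tendsto_uniform_limitI[OF Lf(2) that] .
  have Leq: "L z = Lf m z" if "z \<in> cball 0 (real m - 1)" for z m
    unfolding L_def using pt[OF that] by (rule limI)
  have ptL: "(\<lambda>n. H (d n) z) \<longlonglongrightarrow> L z" for z
  proof -
    obtain m :: nat where "cmod z + 1 \<le> real m" using real_arch_simple by blast
    then have "z \<in> cball 0 (real m - 1)" by simp
    then show ?thesis using pt Leq by metis
  qed
  have "L holomorphic_on ball 0 (real m - 1)" for m
    by (rule holomorphic_transform[OF holomorphic_on_subset[OF Lf(1)[of m]]]) (auto intro!: Leq[symmetric])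
  moreover have "\<exists>m. z \<in> ball 0 (real m - 1)" for z :: complex
  proof -
    obtain m :: nat where "cmod z + 1 < real m" using reals_Archimedean2 by blast
    then show ?thesis by (intro exI[of _ m]) simp
  qed
  ultimately have "L holomorphic_on UNIV"
    by (metis (no_types, lifting) UNIV_I at_within_open field_differentiable_at_within holomorphic_on_def open_ball)
  moreover have "cmod (L z) \<le> exp (C * (1 + cmod z))" for z
  proof (rule LIMSEQ_le_const2[OF tendsto_norm[OF ptL]])
    obtain N :: nat where N: "cmod z < real N" using reals_Archimedean2 by blast
    have "cmod (H (d n) z) \<le> exp (C * (1 + cmod z))" if "N \<le> n" for n
      using seq_suble[OF d, of n] that N by (intro bd) auto
    then show "\<exists>N. \<forall>n\<ge>N. cmod (H (d n) z) \<le> exp (C * (1 + cmod z))" by blast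
  qed
  ultimately have "exp_type L" unfolding exp_type_def by blast
  moreover have "uniform_limit (cball 0 (real m)) (H \<circ> d) L sequentially" for m
  proof -
    have "uniform_limit (cball 0 (real m)) (\<lambda>n. H (d n)) (Lf (Suc m)) sequentially"
      using Lf(2)[of "Suc m"] by simp
    moreover have "L z = Lf (Suc m) z" if "z \<in> cball 0 (real m)" for z
      using Leq[of z "Suc m"] that by simp
    ultimately show ?thesis unfolding uniform_limit_iff o_def by simp
  qed
  ultimately show thesis using that[of L d] d by blast
qed

text \<open>Hurwitz's theorem for the \<open>k\<close>-th derivative of \<open>1 / H j\<close> minus
  \<open>c\<close>, near a point where \<open>L\<close> does not vanish. A constant limit is
  excluded, since the next derivative of \<open>1 / L\<close> would vanish on a ball and
  \<open>L\<close> would be constant.\<close>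

lemma reciprocal_deriv_omits_limit:
  assumes hol: "\<And>n. \<forall>\<^sub>F j in sequentially. H j holomorphic_on ball 0 (real n)"
    and om: "\<And>n. \<forall>\<^sub>F j in sequentially. \<forall>z\<in>ball 0 (real n). H j z \<noteq> 0 \<longrightarrow> (deriv ^^ k) (\<lambda>z. 1 / H j z) z \<noteq> c"
    and L: "L holomorphic_on UNIV" "\<not> L constant_on UNIV"
    and ul: "\<And>m. uniform_limit (cball 0 (real m)) H L sequentially"
    and z: "L z \<noteq> 0"
  shows "(deriv ^^ k) (\<lambda>z. 1 / L z) z \<noteq> c"
proof
  assume eq: "(deriv ^^ k) (\<lambda>z. 1 / L z) z = c"
  have "z \<in> {z. L z \<noteq> 0}" using z by simp
  then have "\<exists>e>0. cball z e \<subseteq> {z. L z \<noteq> 0}"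
    using open_nonzero_set[OF L(1)] unfolding open_contains_cball by (rule bspec[rotated])
  then obtain r0 where r0: "0 < r0" "cball z r0 \<subseteq> {z. L z \<noteq> 0}" by (elim exE conjE)
  \<comment> \<open>Half the radius, so that Cauchy's estimate applies on discs of radius
    \<open>r\<close> about every point of \<open>ball z r\<close>.\<close>
  define r where "r = r0 / 2"
  have r: "0 < r" "ball z r \<subseteq> cball z r0" using r0 by (auto simp: r_def)
  have contL: "continuous_on (cball z r0) L" 
    by (rule continuous_on_subset[OF holomorphic_on_imp_continuous_on[OF L(1)]]) simp
  obtain b where b: "0 < b" "\<And>w. w \<in> cball z r0 \<Longrightarrow> b \<le> cmod (L w)"
  proof -
    have "\<exists>x\<in>cball z r0. \<forall>y\<in>cball z r0. cmod (L x) \<le> cmod (L y)"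
      using r0 by (intro continuous_attains_inf continuous_on_norm contL) auto
    then obtain x where "x \<in> cball z r0" "\<And>y. y \<in> cball z r0 \<Longrightarrow> cmod (L x) \<le> cmod (L y)" by blast
    then show thesis using that[of "cmod (L x)"] r0 by auto
  qed
  obtain m :: nat where m: "cmod z + r0 < real m" using reals_Archimedean2 by blast
  have subm: "cball z r0 \<subseteq> ball 0 (real m)"
  proof
    fix w assume "w \<in> cball z r0"
    then show "w \<in> ball 0 (real m)" using m norm_triangle_ineq[of z "w - z"]
      by (simp add: dist_norm norm_minus_commute)
  qed
  have ulz: "uniform_limit (cball z r0) H L sequentially"
    using ul[of m] by (rule uniform_limit_on_subset) (use subm in auto)
  have "\<forall>\<^sub>F j in sequentially. \<forall>w\<in>cball z r0. dist (H j w) (L w) < b"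
    using ulz b(1) unfolding uniform_limit_iff by blast
  then have "\<forall>\<^sub>F j in sequentially. \<forall>w\<in>cball z r0. H j w \<noteq> 0"
  proof eventually_elim
    case (elim j)
    show ?case
    proof
      fix w assume w: "w \<in> cball z r0"
      then show "H j w \<noteq> 0" using elim b(2)[OF w] by (force simp: dist_norm)
    qed
  qed
  then have "\<forall>\<^sub>F j in sequentially. (\<forall>w\<in>cball z r0. H j w \<noteq> 0) \<and> H j holomorphic_on ball 0 (real m) \<and>
      (\<forall>z\<in>ball 0 (real m). H j z \<noteq> 0 \<longrightarrow> (deriv ^^ k) (\<lambda>z. 1 / H j z) z \<noteq> c)"
    using hol[of m] om[of m] by eventually_elim blast
  then obtain N where N: "\<And>j w. N \<le> j \<Longrightarrow> w \<in> cball z r0 \<Longrightarrow> H j w \<noteq> 0"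
     "\<And>j. N \<le> j \<Longrightarrow> H j holomorphic_on ball 0 (real m)"
     "\<And>j w. N \<le> j \<Longrightarrow> w \<in> ball 0 (real m) \<Longrightarrow> H j w \<noteq> 0 \<Longrightarrow> (deriv ^^ k) (\<lambda>z. 1 / H j z) w \<noteq> c"
    unfolding eventually_sequentially by blast
  define g where "g j w = 1 / H (j + N) w" for j w
  define gL where "gL w = 1 / L w" for w
  have ghol: "g j holomorphic_on cball z r0" for j unfolding g_def
    by (intro holomorphic_intros holomorphic_on_subset[OF N(2) subm]) (use N(1) in auto)
  have gLhol: "gL holomorphic_on cball z r0" unfolding gL_def
    by (intro holomorphic_intros holomorphic_on_subset[OF L(1)]) (use r0 in auto)
  have "uniform_limit (cball z r0) (\<lambda>j w. 1 / H j w) (\<lambda>w. 1 / L w) sequentially"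
    by (rule uniform_lim_divide[OF uniform_limit_const ulz _ b(2) b(1)])
       (auto intro!: boundedI[of _ 1])
  then have ulg0: "\<forall>\<^sub>F j in sequentially. \<forall>w\<in>cball z r0. dist (1 / H j w) (1 / L w) < e" if "0 < e" for e
    using that unfolding uniform_limit_iff by simp
  have ulg: "\<forall>\<^sub>F j in sequentially. \<forall>w\<in>cball z r0. dist (g j w) (gL w) < e" if e: "0 < e" for e
  proof -
    obtain M where "\<And>j. M \<le> j \<Longrightarrow> \<forall>w\<in>cball z r0. dist (1 / H j w) (1 / L w) < e"
      using ulg0[OF e] unfolding eventually_sequentially by blast
    then show ?thesis unfolding g_def gL_def by (intro eventually_sequentiallyI[of M]) simp
  qed
  have sub2: "cball w r \<subseteq> cball z r0" if "w \<in> ball z r" for w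
  proof
    fix v assume "v \<in> cball w r"
    then show "v \<in> cball z r0" using that dist_triangle[of z v w] by (simp add: r_def)
  qed
  have ulim: "uniform_limit (ball z r) (\<lambda>j. (deriv ^^ k) (g j)) ((deriv ^^ k) gL) sequentially"
  proof (rule uniform_limitI)
    fix e :: real assume e: "0 < e"
    define e' where "e' = e * r ^ k / (2 * fact k)"
    have e': "0 < e'" using e r by (simp add: e'_def)
    show "\<forall>\<^sub>F j in sequentially. \<forall>w\<in>ball z r. dist ((deriv ^^ k) (g j) w) ((deriv ^^ k) gL w) < e"
      using ulg[OF e']
    proof eventually_elim
      case (elim j)
      show ?case
      proof
        fix w assume w: "w \<in> ball z r"
        have h1: "g j holomorphic_on cball w r" and h2: "gL holomorphic_on cball w r"
          using ghol gLhol sub2[OF w] holomorphic_on_subset by blast+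
        have "cmod ((deriv ^^ k) (\<lambda>w. g j w - gL w) w) \<le> fact k * e' / r ^ k"
        proof (rule Cauchy_inequality)
          show "(\<lambda>w. g j w - gL w) holomorphic_on ball w r"
            by (intro holomorphic_intros holomorphic_on_subset[OF h1] holomorphic_on_subset[OF h2]) auto
          show "continuous_on (cball w r) (\<lambda>w. g j w - gL w)"
            by (intro continuous_intros holomorphic_on_imp_continuous_on h1 h2)
          fix v assume "cmod (w - v) = r"
          then have "v \<in> cball z r0" using sub2[OF w] by (auto simp: dist_norm)
          then show "cmod (g j v - gL v) \<le> e'" using elim by (force simp: dist_norm)
        qed (use r in auto)
        also have "(deriv ^^ k) (\<lambda>w. g j w - gL w) w = (deriv ^^ k) (g j) w - (deriv ^^ k) gL w"
          by (rule higher_deriv_diff[of _ "ball w r"])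
             (use h1 h2 r in \<open>auto intro: holomorphic_on_subset\<close>)
        also have "fact k * e' / r ^ k = e / 2" using r by (simp add: e'_def)
        finally show "dist ((deriv ^^ k) (g j) w) ((deriv ^^ k) gL w) < e" using e by (simp add: dist_norm)
      qed
    qed
  qed
  have ghd: "(deriv ^^ k) (g j) holomorphic_on ball z r" "(deriv ^^ k) gL holomorphic_on ball z r" for j
    by (rule holomorphic_higher_deriv[OF holomorphic_on_subset[OF ghol r(2)] open_ball],
        rule holomorphic_higher_deriv[OF holomorphic_on_subset[OF gLhol r(2)] open_ball])
  have nconst: "\<not> (\<lambda>w. (deriv ^^ k) gL w - c) constant_on ball z r"
  proof
    assume "(\<lambda>w. (deriv ^^ k) gL w - c) constant_on ball z r"
    then obtain a where a: "\<And>w. w \<in> ball z r \<Longrightarrow> (deriv ^^ k) gL w - c = a"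
      unfolding constant_on_def by blast
    have "(deriv ^^ Suc k) (\<lambda>z. 1 / L z) w = 0" if w: "w \<in> ball z r" for w
    proof -
      have "deriv ((deriv ^^ k) gL) w = deriv (\<lambda>_. a + c) w"
        by (rule deriv_cong_ev)
           (use a w in \<open>auto simp: eventually_nhds algebra_simps intro!: exI[of _ "ball z r"]\<close>)
      then show ?thesis by (simp add: gL_def[abs_def])
    qed
    then have "L constant_on UNIV"
      using r r0 by (intro entire_with_polynomial_inverse_constant[OF L(1) r(1), of z "Suc k"]) auto
    then show False using L(2) by blast
  qed
  have "(deriv ^^ k) gL z - c \<noteq> 0"
  proof (rule Hurwitz_no_zeros[of "ball z r" "\<lambda>j w. (deriv ^^ k) (g j) w - c" "\<lambda>w. (deriv ^^ k) gL w - c"])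
    show "(\<lambda>w. (deriv ^^ k) (g j) w - c) holomorphic_on ball z r" "(\<lambda>w. (deriv ^^ k) gL w - c) holomorphic_on ball z r" for j
      by (intro holomorphic_intros ghd)+
    show "uniform_limit K (\<lambda>j w. (deriv ^^ k) (g j) w - c) (\<lambda>w. (deriv ^^ k) gL w - c) sequentially"
      if "compact K" "K \<subseteq> ball z r" for K
      by (intro uniform_limit_intros uniform_limit_on_subset[OF ulim that(2)])
    show "(deriv ^^ k) (g j) w - c \<noteq> 0" if "w \<in> ball z r" for j w
    proof -
      have "w \<in> cball z r0" using that r by auto
      then have "(deriv ^^ k) (\<lambda>z. 1 / H (j + N) z) w \<noteq> c" using N(1)[of "j + N" w] subm by (intro N(3)) auto
      then show ?thesis by (simp add: g_def[abs_def])
    qed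
  qed (use r nconst in auto)
  then show False using eq by (simp add: gL_def[abs_def])
qed

lemma spherical_derivative_locally_bounded:
  fixes \<H> :: "(complex \<Rightarrow> complex) set"
  assumes D: "open D" "z0 \<in> D" and k: "2 \<le> k" and c: "c \<noteq> 0"
    and hol: "\<And>h. h \<in> \<H> \<Longrightarrow> h holomorphic_on D"
    and om: "\<And>h z. \<lbrakk>h \<in> \<H>; z \<in> D; h z \<noteq> 0\<rbrakk> \<Longrightarrow> (deriv ^^ k) (\<lambda>z. 1 / h z) z \<noteq> c"
  shows "\<exists>r>0. \<exists>M. ball z0 r \<subseteq> D \<and>
    (\<forall>h\<in>\<H>. \<forall>z\<in>ball z0 r. cmod (deriv h z) \<le> M * (1 + (cmod (h z))\<^sup>2))"
proof (rule ccontr)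
  assume contra: "\<not> ?thesis"
  obtain R where R: "0 < R" "cball z0 R \<subseteq> D" using D open_contains_cball by blast
  \<comment> \<open>For \<open>cmod z < n\<close> this gives \<open>2 * cmod z + 2 < A n\<close>,
    the room that the growth bound asks for.\<close>
  define A where "A n = 2 * real n + 4" for n
  define B where "B n = (2 / min 1 (R / (2 * A n))) ^ (k + 1)" for n
  define Q where "Q n h z t \<longleftrightarrow> h \<in> \<H> \<and> 0 < t \<and> (\<forall>\<zeta>\<in>ball 0 (A n). z + of_real t * \<zeta> \<in> ball z0 R) \<and>
    t ^ (k + 1) * cmod (deriv h z) \<ge> 1 + t ^ (2 * k) * (cmod (h z))\<^sup>2 \<and>
    (\<forall>\<zeta>\<in>ball 0 (A n). t ^ (k + 1) * cmod (deriv h (z + of_real t * \<zeta>))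
       \<le> 2 ^ (k + 1) * (1 + t ^ (2 * k) * (cmod (h (z + of_real t * \<zeta>)))\<^sup>2))"
    for n :: nat and h z and t :: real
  have "\<exists>h z t. Q n h z t" for n
  proof -
    have sub: "ball z0 (R / 2) \<subseteq> D" using R by auto
    have "\<exists>h\<in>\<H>. \<exists>z\<in>ball z0 (R / 2). \<not> cmod (deriv h z) \<le> B n * (1 + (cmod (h z))\<^sup>2)"
      using contra R sub by (meson half_gt_zero)
    then obtain h z1 where h: "h \<in> \<H>" and z1: "z1 \<in> ball z0 (R / 2)"
      and big: "B n * (1 + (cmod (h z1))\<^sup>2) \<le> cmod (deriv h z1)" by force
    have A: "0 < A n" by (simp add: A_def)
    obtain z t where "0 < t" "\<forall>\<zeta>\<in>ball 0 (A n). z + of_real t * \<zeta> \<in> ball z0 R"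
      "t ^ (k + 1) * cmod (deriv h z) \<ge> 1 + t ^ (2 * k) * (cmod (h z))\<^sup>2"
      "\<forall>\<zeta>\<in>ball 0 (A n). t ^ (k + 1) * cmod (deriv h (z + of_real t * \<zeta>))
         \<le> 2 ^ (k + 1) * (1 + t ^ (2 * k) * (cmod (h (z + of_real t * \<zeta>)))\<^sup>2)"
      by (rule Zalcman_Pang_rescaling[OF D(1) R(2) hol[OF h] R(1) A z1 big[unfolded B_def]])
    then show ?thesis using h unfolding Q_def by blast
  qed
  then obtain h Z t where Q: "\<And>n. Q n (h n) (Z n) (t n)" by metis
  have hH: "h n \<in> \<H>" and t: "0 < t n" for n using Q unfolding Q_def by blast+
  define H where "H n \<zeta> = of_real (t n) ^ k * h n (of_real (t n) * \<zeta> + Z n)" for n \<zeta>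
  have inD: "of_real (t n) * \<zeta> + Z n \<in> D" if "\<zeta> \<in> ball 0 (A n)" for n \<zeta>
  proof -
    have "Z n + of_real (t n) * \<zeta> \<in> ball z0 R" using Q[of n] that unfolding Q_def by blast
    then have "Z n + of_real (t n) * \<zeta> \<in> cball z0 R" by auto
    then show ?thesis using R(2) by (metis add.commute subsetD)
  qed
  have dH: "(H n has_field_derivative of_real (t n) ^ (k + 1) * deriv (h n) (of_real (t n) * \<zeta> + Z n)) (at \<zeta>)"
    if \<zeta>: "\<zeta> \<in> ball 0 (A n)" for n \<zeta>
  proof -
    have d1: "(h n has_field_derivative deriv (h n) (of_real (t n) * \<zeta> + Z n)) (at (of_real (t n) * \<zeta> + Z n))"
      using hol[OF hH] D(1) inD[OF \<zeta>] by (rule holomorphic_derivI)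
    have "((\<lambda>\<zeta>. of_real (t n) * \<zeta> + Z n) has_field_derivative of_real (t n)) (at \<zeta>)"
      by (auto intro!: derivative_eq_intros)
    from DERIV_cmult[OF DERIV_chain2[OF d1 this], of "of_real (t n) ^ k"]
    show ?thesis unfolding H_def by (simp add: mult_ac)
  qed
  have Hhol: "H n holomorphic_on ball 0 (A n)" for n
    unfolding holomorphic_on_def field_differentiable_def
    using dH by (meson has_field_derivative_at_within)
  have nH: "(cmod (H n \<zeta>))\<^sup>2 = t n ^ (2 * k) * (cmod (h n (of_real (t n) * \<zeta> + Z n)))\<^sup>2" for n \<zeta>
    using t[of n] by (simp add: H_def norm_mult norm_power power_mult_distrib power_mult mult.commute[of 2])
  have ndH: "cmod (deriv (H n) \<zeta>) = t n ^ (k + 1) * cmod (deriv (h n) (of_real (t n) * \<zeta> + Z n))"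
    if "\<zeta> \<in> ball 0 (A n)" for n \<zeta>
    using t[of n] unfolding DERIV_imp_deriv[OF dH[OF that]] by (simp add: norm_mult norm_power)
  have sph: "cmod (deriv (H n) \<zeta>) \<le> 2 ^ (k + 1) * (1 + (cmod (H n \<zeta>))\<^sup>2)" if "\<zeta> \<in> ball 0 (A n)" for n \<zeta>
    using Q[of n] that unfolding ndH[OF that] nH Q_def by (metis add.commute)
  have A0: "0 \<in> ball 0 (A n)" for n by (simp add: A_def)
  have H0: "1 + (cmod (H n 0))\<^sup>2 \<le> cmod (deriv (H n) 0)" for n
    using Q[of n] unfolding ndH[OF A0] nH Q_def by simp
  \<comment> \<open>The factor \<open>t n ^ k\<close> in \<open>H n\<close> cancels the one produced
    by the chain rule.\<close>
  have omH: "(deriv ^^ k) (\<lambda>\<zeta>. 1 / H n \<zeta>) \<zeta> \<noteq> c" if \<zeta>: "\<zeta> \<in> ball 0 (A n)" and nz: "H n \<zeta> \<noteq> 0" for n \<zeta>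
  proof -
    define T where "T = {w \<in> D. h n w \<noteq> 0}"
    define S where "S = {\<zeta> \<in> ball 0 (A n). H n \<zeta> \<noteq> 0}"
    have "open T" unfolding T_def
      using continuous_open_preimage[OF holomorphic_on_imp_continuous_on[OF hol[OF hH]] D(1), of "- {0}"]
      by (simp add: vimage_def Int_def open_Compl)
    moreover have "open S" unfolding S_def
      using continuous_open_preimage[OF holomorphic_on_imp_continuous_on[OF Hhol] open_ball, of "- {0}"]
      by (simp add: vimage_def Int_def open_Compl)
    moreover have ST: "of_real (t n) * w + Z n \<in> T" if "w \<in> S" for w
      using that inD by (auto simp: S_def T_def H_def)
    moreover have invT: "(\<lambda>w. 1 / h n w) holomorphic_on T"
      by (intro holomorphic_intros holomorphic_on_subset[OF hol[OF hH]]) (auto simp: T_def)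
    moreover have \<zeta>S: "\<zeta> \<in> S" using \<zeta> nz by (simp add: S_def)
    ultimately have e1: "(deriv ^^ k) (\<lambda>w. 1 / h n (of_real (t n) * w + Z n)) \<zeta>
        = of_real (t n) ^ k * (deriv ^^ k) (\<lambda>w. 1 / h n w) (of_real (t n) * \<zeta> + Z n)"
      by (intro higher_deriv_compose_linear'[where f = "\<lambda>w. 1 / h n w"]) auto
    have lin: "(\<lambda>w. of_real (t n) * w + Z n) holomorphic_on S" by (intro holomorphic_intros)
    have "(\<lambda>w. 1 / h n (of_real (t n) * w + Z n)) holomorphic_on S"
      using holomorphic_on_compose_gen[OF lin invT] ST by (auto simp: o_def)
    then have "(deriv ^^ k) (\<lambda>w. (1 / of_real (t n) ^ k) * (1 / h n (of_real (t n) * w + Z n))) \<zeta>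
        = (1 / of_real (t n) ^ k) * (deriv ^^ k) (\<lambda>w. 1 / h n (of_real (t n) * w + Z n)) \<zeta>"
      using \<open>open S\<close> \<zeta>S by (intro higher_deriv_cmult[of _ S]) auto
    moreover have "(\<lambda>\<zeta>. 1 / H n \<zeta>) = (\<lambda>w. (1 / of_real (t n) ^ k) * (1 / h n (of_real (t n) * w + Z n)))"
      by (simp add: H_def)
    ultimately have "(deriv ^^ k) (\<lambda>\<zeta>. 1 / H n \<zeta>) \<zeta> = (deriv ^^ k) (\<lambda>w. 1 / h n w) (of_real (t n) * \<zeta> + Z n)"
      unfolding e1 using t[of n] by simp
    then show ?thesis using om[OF hH, of "of_real (t n) * \<zeta> + Z n" n] ST[OF \<zeta>S] by (simp add: T_def)
  qed
  define C :: real where "C = 8 * 2 ^ (k + 1)"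
  have bd: "cmod (H n z) \<le> exp (C * (1 + cmod z))" if z: "z \<in> ball 0 (real n)" for n z
  proof -
    have "cmod (H n z) \<le> exp (4 * 2 ^ (k + 1) * (cmod z + 2))"
      by (rule spherical_derivative_bound_imp_exp_bound_normalized[OF Hhol _ sph H0])
         (use z in \<open>auto simp: A_def\<close>)
    also have "4 * 2 ^ (k + 1) * (cmod z + 2) \<le> C * (1 + cmod z)"
    proof -
      have "4 * 2 ^ (k + 1) * (cmod z + 2) \<le> 4 * 2 ^ (k + 1) * (2 * (1 + cmod z))"
        by (intro mult_left_mono) auto
      then show ?thesis by (simp add: C_def)
    qed
    finally show ?thesis by simp
  qed
  have C0: "0 \<le> C" by (simp add: C_def)
  have Hhol': "H n holomorphic_on ball 0 (real n)" for n
    by (rule holomorphic_on_subset[OF Hhol]) (auto simp: A_def)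
  obtain L r where L: "exp_type L" and r: "strict_mono (r :: nat \<Rightarrow> nat)"
    and ul: "\<And>m. uniform_limit (cball 0 (real m)) (H \<circ> r) L sequentially"
    using Montel_expanding_balls[OF Hhol' bd C0] by metis
  have Lhol: "L holomorphic_on UNIV" using exp_type_holomorphic[OF L] .
  have rA: "ball 0 (real n) \<subseteq> ball 0 (A (r j))" if "n \<le> j" for n j
    using seq_suble[OF r, of j] that by (auto simp: A_def)
  have evhol: "\<forall>\<^sub>F j in sequentially. (H \<circ> r) j holomorphic_on ball 0 (real n)" for n
    using eventually_ge_at_top[of n]
    by eventually_elim (use holomorphic_on_subset[OF Hhol rA] in auto)
  \<comment> \<open>The derivatives at the origin have modulus at least 1 by \<open>H0\<close>, and
    this survives in the limit.\<close>
  have nc: "\<not> L constant_on UNIV"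
  proof
    assume "L constant_on UNIV"
    then obtain a where "L = (\<lambda>_. a)" unfolding constant_on_def by auto
    then have "deriv L 0 = 0" by simp
    moreover have "(\<lambda>j. deriv ((H \<circ> r) j) 0) \<longlonglongrightarrow> deriv L 0"
      by (rule deriv_complex_uniform_limit[OF uniform_limit_on_subset[OF ul[of 1]] evhol[of 1]]) auto
    then have "1 \<le> cmod (deriv L 0)"
    proof (rule LIMSEQ_le_const[OF tendsto_norm])
      have "1 \<le> cmod (deriv ((H \<circ> r) j) 0)" for j
        using H0[of "r j"] zero_le_power2[of "cmod (H (r j) 0)"] unfolding o_def by linarith
      then show "\<exists>N. \<forall>n\<ge>N. 1 \<le> cmod (deriv ((H \<circ> r) n) 0)" by blast
    qed
    ultimately show False by simp
  qed
  have "(deriv ^^ k) (\<lambda>z. 1 / L z) z \<noteq> c" if "L z \<noteq> 0" for z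
  proof (rule reciprocal_deriv_omits_limit[OF evhol _ Lhol nc ul that])
    fix n
    show "\<forall>\<^sub>F j in sequentially. \<forall>z\<in>ball 0 (real n). (H \<circ> r) j z \<noteq> 0 \<longrightarrow> (deriv ^^ k) (\<lambda>z. 1 / (H \<circ> r) j z) z \<noteq> c"
      using eventually_ge_at_top[of n]
    proof eventually_elim
      case (elim j)
      show ?case unfolding o_def
      proof (intro ballI impI)
        fix z assume "z \<in> ball 0 (real n)" and nz: "H (r j) z \<noteq> 0"
        then have "z \<in> ball 0 (A (r j))" using rA[OF elim] by blast
        then show "(deriv ^^ k) (\<lambda>z. 1 / H (r j) z) z \<noteq> c" using nz by (rule omH)
      qed
    qed
  qed
  then show False using exp_type_reciprocal_deriv_omits_imp_constant[OF L k c] nc by blast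
qed

section \<open>The spherical metric\<close>

text \<open>A diagonal sequence over a compact exhaustion of \<open>D\<close>. The target is a
  normed space because maps into the sphere are handled through its embedding.\<close>

lemma Arzela_Ascoli_locally_uniform:
  fixes \<psi> :: "nat \<Rightarrow> complex \<Rightarrow> 'b::{real_normed_vector,heine_borel}"
  assumes D: "open D" and bd: "\<And>n z. z \<in> D \<Longrightarrow> norm (\<psi> n z) \<le> M"
    and eq: "\<And>z e. \<lbrakk>z \<in> D; 0 < e\<rbrakk> \<Longrightarrow> \<exists>d>0. \<forall>n. \<forall>w\<in>D. dist z w < d \<longrightarrow> dist (\<psi> n z) (\<psi> n w) < e"
  obtains g r where "strict_mono (r :: nat \<Rightarrow> nat)"
    "\<And>z. z \<in> D \<Longrightarrow> \<exists>\<delta>>0. ball z \<delta> \<subseteq> D \<and> uniform_limit (ball z \<delta>) (\<lambda>n. \<psi> (r n)) g sequentially"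
proof -
  obtain K where K: "\<And>n. compact (K n)" "\<And>n::nat. K n \<subseteq> D"
    "\<And>X. \<lbrakk>compact X; X \<subseteq> D\<rbrakk> \<Longrightarrow> \<exists>N. \<forall>n\<ge>N. X \<subseteq> K n"
    using open_Union_compact_subsets[OF D] by metis
  have sub: "\<exists>r. strict_mono r \<and> (\<exists>g. True \<and> uniform_limit (K m) (\<lambda>n. \<psi> (s (r n))) g sequentially)"
    for m and s :: "nat \<Rightarrow> nat"
  proof (rule Arzela_Ascoli[of "K m" "\<lambda>n. \<psi> (s n)" M])
    show "norm (\<psi> (s n) x) \<le> M" if "x \<in> K m" for n x using bd K(2) that by blast
    show "\<exists>d>0. \<forall>n y. y \<in> K m \<and> norm (x - y) < d \<longrightarrow> norm (\<psi> (s n) x - \<psi> (s n) y) < e"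
      if x: "x \<in> K m" and e: "0 < e" for x e
    proof -
      have "x \<in> D" using x K(2) by blast
      from eq[OF this e] obtain d where "0 < d" "\<forall>n. \<forall>w\<in>D. dist x w < d \<longrightarrow> dist (\<psi> n x) (\<psi> n w) < e" by blast
      then show ?thesis using K(2) unfolding dist_norm by blast
    qed
    fix g r assume "strict_mono (r :: nat \<Rightarrow> nat)"
      and "\<And>e. 0 < e \<Longrightarrow> \<exists>N. \<forall>n x. n \<ge> N \<and> x \<in> K m \<longrightarrow> norm (\<psi> (s (r n)) x - g x) < e"
    then show ?thesis
      unfolding uniform_limit_iff eventually_sequentially dist_norm by blast
  qed (rule K(1))
  obtain d where d: "strict_mono (d :: nat \<Rightarrow> nat)"
    and gd: "\<forall>m. \<exists>g. True \<and> uniform_limit (K m) (\<lambda>n. \<psi> (d n)) g sequentially"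
    by (rule diagonal_uniform_limit[where A = "\<lambda>_ _. True", OF sub])
  from gd obtain gK where gK: "\<And>m. uniform_limit (K m) (\<lambda>n. \<psi> (d n)) (gK m) sequentially" by metis
  define g where "g z = lim (\<lambda>n. \<psi> (d n) z)" for z
  have geq: "gK m z = g z" if "z \<in> K m" for m z
    using tendsto_uniform_limitI[OF gK that] unfolding g_def by (rule limI[symmetric])
  have "\<exists>\<delta>>0. ball z \<delta> \<subseteq> D \<and> uniform_limit (ball z \<delta>) (\<lambda>n. \<psi> (d n)) g sequentially" if "z \<in> D" for z
  proof -
    obtain \<delta> where \<delta>: "0 < \<delta>" "cball z \<delta> \<subseteq> D" using D \<open>z \<in> D\<close> open_contains_cball by blast
    obtain N where N: "cball z \<delta> \<subseteq> K N" using K(3)[OF compact_cball \<delta>(2)] by blast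
    have "uniform_limit (K N) (\<lambda>n. \<psi> (d n)) g sequentially"
      using gK[of N] geq[of _ N] unfolding uniform_limit_iff by simp
    then have "uniform_limit (ball z \<delta>) (\<lambda>n. \<psi> (d n)) g sequentially"
      by (rule uniform_limit_on_subset) (use N in auto)
    then show ?thesis using \<delta> ball_subset_cball by blast
  qed
  then show thesis using that[OF d] by blast
qed

text \<open>The point with homogeneous coordinates \<open>(a : b)\<close>, which avoids a case distinction at poles.\<close>
definition homog_stereo :: "complex \<times> complex \<Rightarrow> complex \<times> real" where
  "homog_stereo p = (of_real (2 / ((cmod (fst p))\<^sup>2 + (cmod (snd p))\<^sup>2)) * (fst p * cnj (snd p)),
     ((cmod (fst p))\<^sup>2 - (cmod (snd p))\<^sup>2) / ((cmod (fst p))\<^sup>2 + (cmod (snd p))\<^sup>2))"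

lemma homog_stereo_finite:
  assumes "b \<noteq> 0" shows "homog_stereo (a, b) = stereo (Some (a / b))"
proof -
  let ?n = "(cmod a)\<^sup>2 + (cmod b)\<^sup>2"
  have b: "0 < (cmod b)\<^sup>2" using assms by simp
  then have n: "0 < ?n" by (simp add: add_nonneg_pos)
  have q: "1 + (cmod (a / b))\<^sup>2 = ?n / (cmod b)\<^sup>2"
    using b by (simp add: norm_divide power_divide add_divide_distrib)
  have "of_real (2 / (1 + (cmod (a / b))\<^sup>2)) * (a / b) = of_real (2 * (cmod b)\<^sup>2 / ?n) * (a / b)"
    unfolding q by simp
  also have "\<dots> = of_real (2 / ?n) * (of_real ((cmod b)\<^sup>2) * (a / b))" by simp
  also have "of_real ((cmod b)\<^sup>2) * (a / b) = a * cnj b"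
    unfolding complex_norm_square using assms by simp
  finally have 1: "of_real (2 / (1 + (cmod (a / b))\<^sup>2)) * (a / b) = of_real (2 / ?n) * (a * cnj b)" .
  have "((cmod (a / b))\<^sup>2 - 1) / ((cmod (a / b))\<^sup>2 + 1) = ((cmod a)\<^sup>2 - (cmod b)\<^sup>2) / ?n"
    using b n by (simp add: norm_divide power_divide divide_simps)
  then show ?thesis using 1 by (simp add: homog_stereo_def)
qed

lemma homog_stereo_infinity: "a \<noteq> 0 \<Longrightarrow> homog_stereo (a, 0) = stereo None"
  by (simp add: homog_stereo_def)

text \<open>The region is compact and excludes \<open>(0, 0)\<close>, the only point where the
  formula is singular.\<close>

lemma uniformly_continuous_homog_stereo:
  assumes "0 < \<beta>"
  shows "uniformly_continuous_on {p. cmod (fst p) \<le> B \<and> cmod (snd p) \<le> B \<and> \<beta> \<le> (cmod (fst p))\<^sup>2 + (cmod (snd p))\<^sup>2} homog_stereo"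
proof (rule compact_uniformly_continuous)
  let ?K = "{p :: complex \<times> complex. cmod (fst p) \<le> B \<and> cmod (snd p) \<le> B \<and> \<beta> \<le> (cmod (fst p))\<^sup>2 + (cmod (snd p))\<^sup>2}"
  have eq: "?K = (cball 0 B \<times> cball 0 B) \<inter> {p. \<beta> \<le> (cmod (fst p))\<^sup>2 + (cmod (snd p))\<^sup>2}" by auto
  have "closed {p :: complex \<times> complex. \<beta> \<le> (cmod (fst p))\<^sup>2 + (cmod (snd p))\<^sup>2}"
    by (intro closed_Collect_le continuous_intros)
  then show "compact ?K" unfolding eq
    by (intro compact_Int_closed compact_Times compact_cball)
  show "continuous_on ?K homog_stereo" unfolding homog_stereo_def
    by (intro continuous_intros) (use assms in auto)
qed

lemma norm_stereo: "norm (stereo p) = 1"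
proof (cases p)
  case (Some z)
  let ?m = "(cmod z)\<^sup>2"
  have n: "0 < 1 + ?m" by (simp add: add_pos_nonneg)
  have "norm (of_real (2 / (1 + ?m)) * z) = 2 / (1 + ?m) * cmod z"
    using n by (simp only: norm_mult norm_of_real) simp
  then have "(norm (of_real (2 / (1 + ?m)) * z))\<^sup>2 + ((?m - 1) / (?m + 1))\<^sup>2
      = (2 / (1 + ?m) * cmod z)\<^sup>2 + ((?m - 1) / (1 + ?m))\<^sup>2" by (simp only: add.commute)
  also have "\<dots> = (4 * ?m + (?m - 1)\<^sup>2) / (1 + ?m)\<^sup>2"
    by (simp add: power_mult_distrib power_divide add_divide_distrib)
  also have "4 * ?m + (?m - 1)\<^sup>2 = (1 + ?m)\<^sup>2" by (simp add: power2_eq_square algebra_simps)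
  also have "(1 + ?m)\<^sup>2 / (1 + ?m)\<^sup>2 = 1" using n by simp
  finally show ?thesis unfolding Some stereo.simps norm_Pair by (simp only: real_norm_def power2_abs real_sqrt_one)
qed (simp add: norm_Pair)

text \<open>Inverse stereographic projection. Arzela-Ascoli yields a limit in the ambient space,
  while normality asks for one with values in \<open>complex option\<close>.\<close>

lemma stereo_surj:
  assumes "norm v = 1" obtains p where "stereo p = v"
proof -
  obtain x t where v: "v = (x, t)" by (cases v)
  have n: "(cmod x)\<^sup>2 + t\<^sup>2 = 1" using assms by (simp add: v norm_Pair)
  show thesis
  proof (cases "t = 1")
    case True
    then have "x = 0" using n by simp
    then show thesis using that[of None] True v by simp
  next
    case False
    define z where "z = x / of_real (1 - t)"
    have t: "1 - t \<noteq> 0" using False by simp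
    have m: "(cmod z)\<^sup>2 = (1 + t) / (1 - t)"
    proof -
      have "(cmod z)\<^sup>2 = (cmod x)\<^sup>2 / (1 - t)\<^sup>2"
        by (simp add: z_def norm_divide power_divide del: of_real_diff)
      also have "(cmod x)\<^sup>2 = (1 + t) * (1 - t)" using n by (simp add: power2_eq_square algebra_simps)
      finally show ?thesis using t by (simp add: power2_eq_square)
    qed
    have q: "1 + (cmod z)\<^sup>2 = 2 / (1 - t)" unfolding m using t by (simp add: field_simps)
    have "of_real (2 / (1 + (cmod z)\<^sup>2)) * z = x"
    proof -
      have "2 / (1 + (cmod z)\<^sup>2) = 1 - t" unfolding q using t by simp
      then show ?thesis using t by (simp add: z_def del: of_real_diff)
    qed
    moreover have "((cmod z)\<^sup>2 - 1) / ((cmod z)\<^sup>2 + 1) = t"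
    proof -
      have "(cmod z)\<^sup>2 - 1 = 2 * t / (1 - t)" unfolding m using t by (simp add: field_simps)
      then show ?thesis using q t by (simp add: add.commute)
    qed
    ultimately show thesis using that[of "Some z"] v by simp
  qed
qed

text \<open>For unit vectors the squared chord is 2 minus twice the cosine of the angle. The
  threshold is the chord of the angle \<open>e'\<close>, cut off at 1 to stay where
  \<open>arccos\<close> inverts \<open>cos\<close>.\<close>

lemma spherical_dist_less:
  assumes "0 < e"
  obtains d where "0 < d" "\<And>p q. dist (stereo p) (stereo q) < d \<Longrightarrow> spherical_dist p q < e"
proof -
  define e' where "e' = min e 1"
  have e': "0 < e'" "e' \<le> e" "e' \<le> pi" using assms pi_gt3 by (auto simp: e'_def)
  have c: "cos e' < 1" using cos_monotone_0_pi[of 0 e'] e' by simp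
  show thesis
  proof (rule that[of "sqrt (2 * (1 - cos e'))"])
    show "0 < sqrt (2 * (1 - cos e'))" using c by simp
    fix p q assume "dist (stereo p) (stereo q) < sqrt (2 * (1 - cos e'))"
    then have "(dist (stereo p) (stereo q))\<^sup>2 < 2 * (1 - cos e')"
      using c by (metis real_sqrt_less_iff real_sqrt_power real_sqrt_unique zero_le_dist real_sqrt_abs abs_of_nonneg)
    moreover have "(dist (stereo p) (stereo q))\<^sup>2 = 2 - 2 * (stereo p \<bullet> stereo q)"
      using dot_norm_neg[of "stereo p" "stereo q"] by (simp add: dist_norm norm_stereo)
    ultimately have "cos e' < stereo p \<bullet> stereo q" by simp
    moreover have "stereo p \<bullet> stereo q \<le> 1"
      using norm_cauchy_schwarz[of "stereo p" "stereo q"] by (simp add: norm_stereo)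
    moreover have "-1 \<le> cos e'" by simp
    ultimately have "arccos (stereo p \<bullet> stereo q) < arccos (cos e')" by (intro arccos_less_arccos)
    also have "\<dots> = e'" using e' by (intro arccos_cos) auto
    finally show "spherical_dist p q < e" using e' by (simp add: spherical_dist_def)
  qed
qed

text \<open>The reason is that \<open>1/(1 + |h|\<^sup>2)\<close> is \<open>M\<close>-Lipschitz.\<close>
lemma spherical_derivative_bound_dichotomy:
  assumes hol: "h holomorphic_on ball z0 r"
    and sph: "\<And>z. z \<in> ball z0 r \<Longrightarrow> cmod (deriv h z) \<le> M * (1 + (cmod (h z))\<^sup>2)"
    and d: "0 < d" "d \<le> r" "M * d \<le> 1 / 10"
  shows "(\<forall>z\<in>ball z0 d. cmod (h z) \<le> 2) \<or> (\<forall>z\<in>ball z0 d. 1 / 2 \<le> cmod (h z))"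
proof -
  define x where "x z = 1 / (1 + (cmod (h z))\<^sup>2)" for z
  have z0: "z0 \<in> ball z0 r" using d by simp
  have M: "0 \<le> M"
  proof -
    have "0 \<le> M * (1 + (cmod (h z0))\<^sup>2)" using sph[OF z0] norm_ge_zero order_trans by blast
    moreover have "0 < 1 + (cmod (h z0))\<^sup>2" by (simp add: add_pos_nonneg)
    ultimately show ?thesis by (simp add: zero_le_mult_iff)
  qed
  have lip: "\<bar>x z - x z0\<bar> \<le> 1 / 10" if z: "z \<in> ball z0 d" for z
  proof -
    define c where "c = z - z0"
    have cd: "cmod c \<le> d" using z by (simp add: c_def dist_norm norm_minus_commute)
    define \<gamma> where "\<gamma> s = z0 + of_real s * c" for s :: real
    \<comment> \<open>Along the segment from \<open>z0\<close> to \<open>z\<close> the squared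
      modulus is differentiable even at zeros of \<open>h\<close>, so the mean value theorem applies
      to \<open>1 / (1 + q)\<close>.\<close>
    define q where "q s = h (\<gamma> s) \<bullet> h (\<gamma> s)" for s
    define q' where "q' s = 2 * (h (\<gamma> s) \<bullet> (deriv h (\<gamma> s) * c))" for s
    have \<gamma>in: "\<gamma> s \<in> ball z0 r" if "0 \<le> s" "s \<le> 1" for s
    proof -
      have "dist z0 (\<gamma> s) = s * cmod c" using that by (simp add: \<gamma>_def dist_norm norm_mult)
      also have "\<dots> \<le> cmod c" using that by (simp add: mult_left_le_one_le)
      also have "\<dots> < d" using z by (simp add: c_def dist_norm norm_minus_commute)
      finally show ?thesis using d by simp
    qed
    have qd: "(q has_real_derivative q' s) (at s)" if s: "0 \<le> s" "s \<le> 1" for s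
    proof -
      have hd: "(h has_field_derivative deriv h (\<gamma> s)) (at (\<gamma> s))"
        using hol \<gamma>in[OF s] by (intro holomorphic_derivI) auto
      have "(\<gamma> has_vector_derivative c) (at s)" unfolding \<gamma>_def
        by (auto intro!: derivative_eq_intros)
      from field_vector_diff_chain_at[OF this hd]
      have "((\<lambda>s. h (\<gamma> s)) has_vector_derivative (deriv h (\<gamma> s) * c)) (at s)"
        by (simp add: o_def mult.commute)
      then have "((\<lambda>s. h (\<gamma> s)) has_derivative (\<lambda>t. t *\<^sub>R (deriv h (\<gamma> s) * c))) (at s)"
        by (simp add: has_vector_derivative_def)
      from has_derivative_inner[OF this this]
      have "(q has_derivative (\<lambda>t. q' s * t)) (at s)"
        unfolding q_def q'_def by (simp add: inner_commute algebra_simps)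
      then show ?thesis by (simp add: has_field_derivative_def)
    qed
    have q0: "0 \<le> q s" for s by (simp add: q_def)
    have xd: "((\<lambda>s. 1 / (1 + q s)) has_real_derivative - q' s / (1 + q s)\<^sup>2) (at s)" if s: "0 \<le> s" "s \<le> 1" for s
    proof -
      have "1 + q s \<noteq> 0" using q0[of s] by linarith
      from DERIV_divide[OF DERIV_const[of 1] DERIV_add[OF DERIV_const[of 1] qd[OF s]] this]
      show ?thesis by (simp add: power2_eq_square)
    qed
    obtain \<xi> where \<xi>: "0 < \<xi>" "\<xi> < 1" "1 / (1 + q 1) - 1 / (1 + q 0) = (1 - 0) * (- q' \<xi> / (1 + q \<xi>)\<^sup>2)"
      using MVT2[of 0 1 "\<lambda>s. 1 / (1 + q s)" "\<lambda>s. - q' s / (1 + q s)\<^sup>2"] xd by auto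
    have "\<bar>q' \<xi>\<bar> \<le> 2 * (cmod (h (\<gamma> \<xi>)) * (cmod (deriv h (\<gamma> \<xi>)) * cmod c))"
      unfolding q'_def using Cauchy_Schwarz_ineq2[of "h (\<gamma> \<xi>)" "deriv h (\<gamma> \<xi>) * c"]
      by (simp add: norm_mult abs_mult)
    also have "\<dots> \<le> 2 * (cmod (h (\<gamma> \<xi>)) * (M * (1 + q \<xi>) * d))"
    proof -
      have "cmod (deriv h (\<gamma> \<xi>)) \<le> M * (1 + q \<xi>)"
        using sph[OF \<gamma>in[of \<xi>]] \<xi> by (simp add: q_def power2_norm_eq_inner)
      then show ?thesis using cd M q0 by (intro mult_left_mono mult_mono) auto
    qed
    also have "\<dots> = (2 * cmod (h (\<gamma> \<xi>))) * ((1 + q \<xi>) * (M * d))" by simp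
    \<comment> \<open>One factor \<open>1 + q \<xi>\<close> comes from the hypothesis, the other
      from \<open>2 * x \<le> 1 + x^2\<close>; they cancel the square in the derivative of
      \<open>1 / (1 + q)\<close>.\<close>
    also have "\<dots> \<le> (1 + q \<xi>) * ((1 + q \<xi>) * (M * d))"
    proof (rule mult_right_mono)
      have "0 \<le> (1 - cmod (h (\<gamma> \<xi>)))\<^sup>2" by simp
      then show "2 * cmod (h (\<gamma> \<xi>)) \<le> 1 + q \<xi>"
        by (simp add: q_def power2_norm_eq_inner[symmetric] power2_diff)
    qed (use M d q0[of \<xi>] in auto)
    also have "\<dots> \<le> (1 + q \<xi>) * ((1 + q \<xi>) * (1 / 10))"
      using d q0[of \<xi>] by (intro mult_left_mono) auto
    finally have "\<bar>q' \<xi>\<bar> \<le> (1 + q \<xi>)\<^sup>2 * (1 / 10)" by (simp add: power2_eq_square)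
    moreover have "0 < (1 + q \<xi>)\<^sup>2" using q0[of \<xi>] by (simp add: add_pos_nonneg)
    ultimately have "\<bar>q' \<xi> / (1 + q \<xi>)\<^sup>2\<bar> \<le> 1 / 10" by (simp add: abs_divide divide_le_eq)
    moreover have "x z - x z0 = - q' \<xi> / (1 + q \<xi>)\<^sup>2"
      using \<xi>(3) by (simp add: x_def q_def \<gamma>_def c_def power2_norm_eq_inner)
    ultimately show ?thesis by simp
  qed
  have pos: "0 < 1 + (cmod (h z))\<^sup>2" for z by (simp add: add_pos_nonneg)
  show ?thesis
  proof (cases "cmod (h z0) \<le> 1")
    case True
    then have "(cmod (h z0))\<^sup>2 \<le> 1" by (simp add: power_le_one)
    then have "1 / 2 \<le> x z0" using pos[of z0] by (simp add: x_def field_simps)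
    have "cmod (h z) \<le> 2" if "z \<in> ball z0 d" for z
    proof -
      have "2 / 5 \<le> x z" using lip[OF that, unfolded abs_le_iff] \<open>1 / 2 \<le> x z0\<close> by linarith
      then have "(cmod (h z))\<^sup>2 \<le> 2\<^sup>2" using pos[of z] by (simp add: x_def field_simps)
      then show ?thesis by (rule power2_le_imp_le) simp
    qed
    then show ?thesis by blast
  next
    case False
    then have "1 \<le> (cmod (h z0))\<^sup>2" by (simp add: one_le_power)
    then have "x z0 \<le> 1 / 2" using pos[of z0] by (simp add: x_def field_simps)
    have "1 / 2 \<le> cmod (h z)" if "z \<in> ball z0 d" for z
    proof -
      have "x z \<le> 3 / 5" using lip[OF that, unfolded abs_le_iff] \<open>x z0 \<le> 1 / 2\<close> by linarith
      then have "(1 / 2)\<^sup>2 \<le> (cmod (h z))\<^sup>2" using pos[of z] by (simp add: x_def field_simps power2_eq_square)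
      then show ?thesis by (rule power2_le_imp_le) simp
    qed
    then show ?thesis by blast
  qed
qed

section \<open>The family of the theorem\<close>

text \<open>At a pole \<open>f\<close> has the dummy value 0, so the quotient would be wrong there;
  0 is the value that removes the singularity.\<close>

definition pole_reciprocal :: "(complex \<Rightarrow> complex) \<Rightarrow> (complex \<Rightarrow> complex) \<Rightarrow> complex \<Rightarrow> complex" where
  "pole_reciprocal f p z = (if is_pole f z then 0 else 1 / (f z - p z))"

lemma not_is_pole_analytic: "f analytic_on {z} \<Longrightarrow> \<not> is_pole f z"
  unfolding analytic_at by (elim exE conjE, rule not_is_pole_holomorphic)

text \<open>\<open>has_zero_in\<close> ignores poles, so a nonzero value can be inferred only once
  the difference is known to be regular at the point.\<close>

lemma omits_value_at_regular_point:
  assumes D: "open D" and f: "f nicely_meromorphic_on D" and p: "p holomorphic_on D"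
    and nz: "\<not> has_zero_in (\<lambda>z. f z - p z) D" and z: "z \<in> D" "\<not> is_pole f z"
  shows "f analytic_on {z}" "f z - p z \<noteq> 0"
proof -
  show 1: "f analytic_on {z}" using nicely_meromorphic_on_imp_analytic_at[OF f z] .
  have "p analytic_on {z}" using p D z analytic_at by blast
  with 1 have "(\<lambda>z. f z - p z) analytic_on {z}" by (rule analytic_on_diff)
  then have "\<not> is_pole (\<lambda>z. f z - p z) z" by (rule not_is_pole_analytic)
  then show "f z - p z \<noteq> 0" using nz z(1) unfolding has_zero_in_def by blast
qed

text \<open>A pole of \<open>f\<close> is isolated, and subtracting the continuous \<open>p\<close>
  leaves it a pole. The reciprocal tends to 0 there, and Riemann's theorem on removable
  singularities applies.\<close>

lemma pole_reciprocal_holomorphic: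
  assumes D: "open D" and f: "f nicely_meromorphic_on D" and p: "p holomorphic_on D"
    and nz: "\<not> has_zero_in (\<lambda>z. f z - p z) D"
  shows "pole_reciprocal f p holomorphic_on D"
proof -
  note reg = omits_value_at_regular_point[OF D f p nz]
  have near: "pole_reciprocal f p holomorphic_on U"
    if U: "U \<subseteq> D" "f holomorphic_on U" "open U" for U
  proof (rule holomorphic_transform[of "\<lambda>z. 1 / (f z - p z)"])
    have np: "\<not> is_pole f w" if "w \<in> U" for w using not_is_pole_holomorphic[OF U(3) that U(2)] .
    show "(\<lambda>z. 1 / (f z - p z)) holomorphic_on U"
      by (intro holomorphic_intros U(2) holomorphic_on_subset[OF p U(1)]) (use reg(2) np U(1) in blast)
    show "1 / (f w - p w) = pole_reciprocal f p w" if "w \<in> U" for w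
      using np[OF that] by (simp add: pole_reciprocal_def)
  qed
  have "pole_reciprocal f p analytic_on {z}" if z: "z \<in> D" for z
  proof (cases "is_pole f z")
    case False
    then obtain U where U: "open U" "z \<in> U" "f holomorphic_on U"
      using reg(1)[OF z] unfolding analytic_at by blast
    have "pole_reciprocal f p holomorphic_on U \<inter> D"
      by (rule near) (use U D in \<open>auto intro: holomorphic_on_subset\<close>)
    then show ?thesis unfolding analytic_at using U D z by blast
  next
    case True
    have "isolated_singularity_at f z"
      using f z unfolding nicely_meromorphic_on_def meromorphic_on_altdef by (auto simp: isolated_singularity_at_def)
    then obtain r0 where r0: "0 < r0" "f analytic_on ball z r0 - {z}"
      unfolding isolated_singularity_at_def by blast
    obtain r1 where r1: "0 < r1" "ball z r1 \<subseteq> D" using D z openE by blast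
    define r where "r = min r0 r1"
    have r: "0 < r" "ball z r \<subseteq> D" using r0 r1 by (auto simp: r_def)
    have "f holomorphic_on ball z r - {z}"
      using r0(2) by (rule holomorphic_on_subset[OF analytic_imp_holomorphic]) (auto simp: r_def)
    then have hol: "pole_reciprocal f p holomorphic_on ball z r - {z}"
      by (intro near) (use r in \<open>auto intro: open_delete\<close>)
    have "isCont p z" using p D z holomorphic_on_imp_continuous_on continuous_on_eq_continuous_at by blast
    then have "(p \<longlongrightarrow> p z) (at z)" by (simp add: isCont_def)
    moreover have "filterlim f at_infinity (at z)" using True by (simp add: is_pole_def)
    ultimately have "filterlim (\<lambda>w. f w + - p w) at_infinity (at z)"
      by (intro tendsto_add_filterlim_at_infinity') (auto intro: tendsto_minus)
    then have "((\<lambda>w. inverse (f w + - p w)) \<longlongrightarrow> 0) (at z)"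
      using filterlim_compose[OF tendsto_inverse_0] by blast
    moreover have "\<forall>\<^sub>F w in at z. inverse (f w + - p w) = pole_reciprocal f p w"
      unfolding eventually_at
    proof (intro exI[of _ r] conjI ballI impI r)
      fix w assume "w \<in> UNIV" "w \<noteq> z \<and> dist w z < r"
      then have w: "w \<in> ball z r - {z}" by (simp add: dist_commute)
      have "\<not> is_pole f w"
        using \<open>f holomorphic_on ball z r - {z}\<close> w by (intro not_is_pole_holomorphic[of "ball z r - {z}"]) (auto intro: open_delete)
      then show "inverse (f w + - p w) = pole_reciprocal f p w"
        by (simp add: pole_reciprocal_def inverse_eq_divide)
    qed
    ultimately have "(pole_reciprocal f p \<longlongrightarrow> 0) (at z)" by (rule Lim_transform_eventually)
    moreover have "pole_reciprocal f p z = 0" using True by (simp add: pole_reciprocal_def)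
    ultimately have "(pole_reciprocal f p \<longlongrightarrow> pole_reciprocal f p z) (at z within ball z r)"
      by (metis Lim_at_imp_Lim_at_within)
    then have "pole_reciprocal f p holomorphic_on ball z r"
      by (intro no_isolated_singularity'[of "{z}", OF _ hol open_ball]) simp_all
    then show ?thesis unfolding analytic_at using r by (intro exI[of _ "ball z r"]) auto
  qed
  then have "pole_reciprocal f p analytic_on D" using analytic_on_analytic_at by blast
  then show ?thesis by (rule analytic_imp_holomorphic)
qed

lemma higher_pderiv_nonzero:
  fixes p :: "complex poly"
  assumes "p \<noteq> 0" "j \<le> degree p"
  shows "(pderiv ^^ j) p \<noteq> 0 \<and> degree ((pderiv ^^ j) p) = degree p - j"
  using assms(2)
proof (induction j)
  case (Suc j)
  then have "(pderiv ^^ j) p \<noteq> 0" "degree ((pderiv ^^ j) p) = degree p - j" by auto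
  then show ?case using Suc.prems by (auto simp: degree_pderiv pderiv_eq_0_iff)
qed (use assms in auto)

lemma higher_deriv_poly_degree:
  fixes p :: "complex poly"
  assumes "0 < degree p"
  obtains a where "a \<noteq> 0" "\<And>z. (deriv ^^ degree p) (poly p) z = a"
proof -
  have 1: "(deriv ^^ j) (poly p) = poly ((pderiv ^^ j) p)" for j
  proof (induction j)
    case (Suc j)
    have "deriv (poly ((pderiv ^^ j) p)) = poly (pderiv ((pderiv ^^ j) p))"
      by (rule ext) (rule DERIV_imp_deriv[OF poly_DERIV])
    then show ?case using Suc by simp
  qed simp
  have "p \<noteq> 0" using assms by auto
  then have "(pderiv ^^ degree p) p \<noteq> 0" "degree ((pderiv ^^ degree p) p) = 0"
    using higher_pderiv_nonzero[of p "degree p"] by auto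
  then obtain a where "(pderiv ^^ degree p) p = [:a:]" "a \<noteq> 0" using degree_eq_zeroE by (metis pCons_0_0)
  then show thesis using that[of a] 1[of "degree p"] by simp
qed

text \<open>Off the poles \<open>f - Q = (f - P) + (P - Q)\<close>, and the \<open>l\<close>-th
  derivative of the last summand is the constant \<open>a\<close>; so the \<open>l\<close>-th
  derivative of \<open>f - P\<close> avoids \<open>- a\<close>.\<close>

lemma pole_reciprocal_higher_deriv_omits:
  assumes D: "open D" and f: "f nicely_meromorphic_on D"
    and nz: "\<not> has_zero_in (\<lambda>z. f z - poly P z) D"
    and nz': "\<not> has_zero_in ((deriv ^^ l) (\<lambda>z. f z - poly Q z)) D"
    and a: "\<And>z. (deriv ^^ l) (poly (P - Q)) z = a"
    and z: "z \<in> D" "pole_reciprocal f (poly P) z \<noteq> 0"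
  shows "(deriv ^^ l) (\<lambda>z. 1 / pole_reciprocal f (poly P) z) z \<noteq> - a"
proof -
  have np: "\<not> is_pole f z" using z(2) by (auto simp: pole_reciprocal_def)
  have Phol: "poly P holomorphic_on A" "poly Q holomorphic_on A" "poly (P - Q) holomorphic_on A" for A
    by (intro holomorphic_intros)+
  note reg = omits_value_at_regular_point[OF D f Phol(1) nz]
  obtain V where V: "open V" "z \<in> V" "f holomorphic_on V"
    using reg(1)[OF z(1) np] unfolding analytic_at by blast
  define U where "U = V \<inter> D"
  have U: "open U" "z \<in> U" "f holomorphic_on U" "U \<subseteq> D"
    using V D z by (auto simp: U_def intro: holomorphic_on_subset)
  have npU: "\<not> is_pole f w" if "w \<in> U" for w using not_is_pole_holomorphic[OF U(1) that U(3)] .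
  have ghol: "(\<lambda>w. f w - poly P w) holomorphic_on U" by (intro holomorphic_intros U(3))
  have eqg: "1 / pole_reciprocal f (poly P) w = f w - poly P w" if "w \<in> U" for w
    using npU[OF that] by (simp add: pole_reciprocal_def)
  have ghol': "(\<lambda>w. 1 / pole_reciprocal f (poly P) w) holomorphic_on U"
    by (rule holomorphic_transform[OF ghol]) (simp add: eqg)
  have fQ: "(\<lambda>w. f w - poly Q w) holomorphic_on U" by (intro holomorphic_intros U(3))
  have "(deriv ^^ l) (\<lambda>w. f w - poly Q w) holomorphic_on U" by (rule holomorphic_higher_deriv[OF fQ U(1)])
  then have "\<not> is_pole ((deriv ^^ l) (\<lambda>w. f w - poly Q w)) z"
    using U(1,2) not_is_pole_holomorphic by blast
  then have "(deriv ^^ l) (\<lambda>w. f w - poly Q w) z \<noteq> 0" using nz' z(1) unfolding has_zero_in_def by blast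
  moreover have "(deriv ^^ l) (\<lambda>w. f w - poly Q w) z
      = (deriv ^^ l) (\<lambda>w. 1 / pole_reciprocal f (poly P) w + poly (P - Q) w) z"
    by (rule higher_deriv_transform_within_open[OF fQ _ U(1,2)])
       (auto intro!: holomorphic_intros ghol' simp: eqg)
  moreover have "\<dots> = (deriv ^^ l) (\<lambda>w. 1 / pole_reciprocal f (poly P) w) z + (deriv ^^ l) (poly (P - Q)) z"
    by (rule higher_deriv_add[OF ghol' Phol(3) U(1,2)])
  ultimately show ?thesis using a by (simp add: add_eq_0_iff2)
qed

text \<open>\<open>f = p + 1/h\<close> has homogeneous coordinates \<open>(1 + p h : h)\<close>,
  which become \<open>(1 : 0)\<close> at a pole.\<close>

lemma stereo_sphere_val:
  assumes D: "open D" and f: "f nicely_meromorphic_on D" and p: "p holomorphic_on D"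
    and nz: "\<not> has_zero_in (\<lambda>z. f z - p z) D" and z: "z \<in> D"
  shows "stereo (sphere_val f z) = homog_stereo (1 + p z * pole_reciprocal f p z, pole_reciprocal f p z)"
proof (cases "is_pole f z")
  case True
  then show ?thesis by (simp add: sphere_val_def pole_reciprocal_def homog_stereo_infinity)
next
  case False
  have "f z - p z \<noteq> 0" using omits_value_at_regular_point(2)[OF D f p nz z False] .
  then have h: "pole_reciprocal f p z \<noteq> 0" "(1 + p z * pole_reciprocal f p z) / pole_reciprocal f p z = f z"
    using False by (auto simp: pole_reciprocal_def field_simps)
  show ?thesis using homog_stereo_finite[OF h(1), of "1 + p z * pole_reciprocal f p z"] False h(2)
    by (simp add: sphere_val_def)
qed

section \<open>Equicontinuity of the family as maps into the sphere\<close>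

lemma homog_stereo_scale:
  assumes "b \<noteq> 0" shows "homog_stereo (a, b) = homog_stereo (a / b, 1)"
  unfolding homog_stereo_finite[OF assms] homog_stereo_finite[OF one_neq_zero] div_by_1 ..

text \<open>By the dichotomy, on a disc of uniform size \<open>h\<close> is either bounded by 2 or
  at least 1/2 in modulus. The coordinates \<open>(1 + p h, h)\<close> in the first case and
  \<open>(1/h + p, 1)\<close> in the second stay in a compact set away from \<open>(0, 0)\<close>
  and vary little, so uniform continuity of \<open>homog_stereo\<close> applies.\<close>

lemma equicontinuous_homog_stereo:
  fixes \<H> :: "(complex \<Rightarrow> complex) set" and p :: "complex \<Rightarrow> complex"
  assumes hol: "\<And>h. h \<in> \<H> \<Longrightarrow> h holomorphic_on ball z0 r"
    and sph: "\<And>h z. \<lbrakk>h \<in> \<H>; z \<in> ball z0 r\<rbrakk> \<Longrightarrow> cmod (deriv h z) \<le> M * (1 + (cmod (h z))\<^sup>2)"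
    and r: "0 < r" and p: "continuous_on (ball z0 r) p" and e: "0 < e"
  obtains d where "0 < d" "d \<le> r" "\<And>h z. \<lbrakk>h \<in> \<H>; z \<in> ball z0 d\<rbrakk> \<Longrightarrow>
    dist (homog_stereo (1 + p z0 * h z0, h z0)) (homog_stereo (1 + p z * h z, h z)) < e"
proof -
  define M' where "M' = \<bar>M\<bar> + 1"
  have M': "0 < M'" "M \<le> M'" by (auto simp: M'_def)
  define B where "B = cmod (p z0) + 1"
  have B: "1 \<le> B" by (simp add: B_def)
  define C where "C = 1 + 2 * B + 2"
  \<comment> \<open>A lower bound for \<open>|1 + p h|^2 + |h|^2\<close>: if
    \<open>B * |h| \<le> 1/2\<close> the first term is at least 1/4, otherwise the second is at
    least \<open>(1 / (2 * B))^2\<close>.\<close>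
  define \<beta> where "\<beta> = 1 / (4 * B\<^sup>2)"
  have \<beta>: "0 < \<beta>" "\<beta> \<le> 1 / 4"
    using B by (auto simp: \<beta>_def frac_le divide_le_eq one_le_power)
  define K where "K = {q :: complex \<times> complex. cmod (fst q) \<le> C \<and> cmod (snd q) \<le> C \<and> \<beta> \<le> (cmod (fst q))\<^sup>2 + (cmod (snd q))\<^sup>2}"
  have "uniformly_continuous_on K homog_stereo" unfolding K_def by (rule uniformly_continuous_homog_stereo[OF \<beta>(1)])
  then obtain \<delta> where \<delta>: "0 < \<delta>" "\<And>q q'. \<lbrakk>q \<in> K; q' \<in> K; dist q' q < \<delta>\<rbrakk> \<Longrightarrow> dist (homog_stereo q') (homog_stereo q) < e"
    using e unfolding uniformly_continuous_on_def by blast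
  define \<epsilon> where "\<epsilon> = min 1 (\<delta> / 6)"
  have \<epsilon>: "0 < \<epsilon>" "\<epsilon> \<le> 1" "6 * \<epsilon> \<le> \<delta>" using \<delta>(1) by (auto simp: \<epsilon>_def)
  obtain d1 where d1: "0 < d1" "\<And>z. z \<in> ball z0 r \<Longrightarrow> dist z z0 < d1 \<Longrightarrow> dist (p z) (p z0) < \<epsilon>"
    using p \<epsilon>(1) r unfolding continuous_on_iff by (metis centre_in_ball)
  \<comment> \<open>The bounds serve, in order, the given disc, the continuity of \<open>p\<close>,
    the dichotomy and the Lipschitz estimate. The 5 is \<open>1 + 2\<^sup>2\<close>, from
    \<open>|h| \<le> 2\<close> or \<open>|1/h| \<le> 2\<close>.\<close>
  define d where "d = min (min r d1) (min (1 / (10 * M')) (\<epsilon> / (5 * M' * B)))"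
  have d0: "0 < d" using r d1 M' \<epsilon> B by (auto simp: d_def)
  have dr: "d \<le> r" and dd1: "d \<le> d1" and dM: "M * d \<le> 1 / 10" and d\<epsilon>: "5 * M' * d * B \<le> \<epsilon>"
  proof -
    show "d \<le> r" "d \<le> d1" by (auto simp: d_def)
    have "M * d \<le> M' * d" using M' d0 by (intro mult_right_mono) auto
    also have "\<dots> \<le> M' * (1 / (10 * M'))" using M' by (intro mult_left_mono) (auto simp: d_def)
    finally show "M * d \<le> 1 / 10" using M' by simp
    have "5 * M' * B * d \<le> 5 * M' * B * (\<epsilon> / (5 * M' * B))" using M' B by (intro mult_left_mono) (auto simp: d_def)
    then show "5 * M' * d * B \<le> \<epsilon>" using M' B by (simp add: mult_ac)
  qed
  have pz: "cmod (p z) \<le> B" "cmod (p z - p z0) \<le> \<epsilon>" if "z \<in> ball z0 d" for z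
  proof -
    have "dist (p z) (p z0) < \<epsilon>" using that dr dd1 by (intro d1(2)) (auto simp: dist_commute)
    then show 1: "cmod (p z - p z0) \<le> \<epsilon>" by (simp add: dist_norm)
    show "cmod (p z) \<le> B" using norm_triangle_ineq2[of "p z" "p z0"] 1 \<epsilon>(2) by (simp add: B_def)
  qed
  have lip: "cmod (g z - g z0) * B \<le> \<epsilon>" if g: "g holomorphic_on ball z0 d"
    "\<And>z. z \<in> ball z0 d \<Longrightarrow> cmod (deriv g z) \<le> 5 * M'" and z: "z \<in> ball z0 d" for g z
  proof -
    have "cmod (g z - g z0) \<le> 5 * M' * cmod (z - z0)"
    proof (rule field_differentiable_bound[of "ball z0 d" g "deriv g"])
      show "(g has_field_derivative deriv g w) (at w within ball z0 d)" if "w \<in> ball z0 d" for w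
        using holomorphic_derivI[OF g(1) open_ball that] by (rule has_field_derivative_at_within)
    qed (use g z d0 in auto)
    also have "\<dots> \<le> 5 * M' * d" using z M' by (intro mult_left_mono) (auto simp: dist_norm norm_minus_commute)
    finally have "cmod (g z - g z0) * B \<le> 5 * M' * d * B" using B by (intro mult_right_mono) auto
    then show ?thesis using d\<epsilon> by linarith
  qed
  have closeK: "dist (homog_stereo q0) (homog_stereo q) < e"
    if "q0 \<in> K" "q \<in> K" "cmod (fst q0 - fst q) \<le> 3 * \<epsilon>" "cmod (snd q0 - snd q) \<le> \<epsilon>" for q0 q
  proof (rule \<delta>(2)[OF that(2,1)])
    have "dist q0 q \<le> dist (fst q0) (fst q) + dist (snd q0) (snd q)"
      unfolding dist_prod_def by (rule sqrt_sum_squares_le_sum) auto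
    also have "\<dots> \<le> 4 * \<epsilon>" using that by (simp add: dist_norm)
    also have "\<dots> < \<delta>" using \<epsilon> by linarith
    finally show "dist q0 q < \<delta>" .
  qed
  have "dist (homog_stereo (1 + p z0 * h z0, h z0)) (homog_stereo (1 + p z * h z, h z)) < e"
    if h: "h \<in> \<H>" and z: "z \<in> ball z0 d" for h z
  proof -
    have hhol: "h holomorphic_on ball z0 d" using hol[OF h] by (rule holomorphic_on_subset) (use dr in auto)
    have sphd: "cmod (deriv h w) \<le> M' * (1 + (cmod (h w))\<^sup>2)" if "w \<in> ball z0 d" for w
    proof -
      have "cmod (deriv h w) \<le> M * (1 + (cmod (h w))\<^sup>2)" using sph[OF h, of w] that dr by auto
      also have "\<dots> \<le> M' * (1 + (cmod (h w))\<^sup>2)" using M' by (intro mult_right_mono) auto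
      finally show ?thesis .
    qed
    have z0: "z0 \<in> ball z0 d" using d0 by simp
    have dich: "(\<forall>z\<in>ball z0 d. cmod (h z) \<le> 2) \<or> (\<forall>z\<in>ball z0 d. 1 / 2 \<le> cmod (h z))"
      by (rule spherical_derivative_bound_dichotomy[OF hol[OF h] sph[OF h] d0 dr dM])
    then show ?thesis
    proof
      assume le2: "\<forall>z\<in>ball z0 d. cmod (h z) \<le> 2"
      have inK: "(1 + p w * h w, h w) \<in> K" if w: "w \<in> ball z0 d" for w
      proof -
        have ph: "cmod (p w * h w) \<le> B * cmod (h w)" using pz(1)[OF w] by (simp add: norm_mult mult_right_mono)
        also have "\<dots> \<le> B * 2" using le2 w B by (intro mult_left_mono) auto
        finally have "cmod (1 + p w * h w) \<le> C" using norm_triangle_ineq[of 1 "p w * h w"] by (simp add: C_def)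
        moreover have "cmod (h w) \<le> C" using le2 w B by (force simp: C_def)
        moreover have "\<beta> \<le> (cmod (1 + p w * h w))\<^sup>2 + (cmod (h w))\<^sup>2"
        proof (cases "B * cmod (h w) \<le> 1 / 2")
          case True
          then have "1 / 2 \<le> cmod (1 + p w * h w)"
            using norm_triangle_ineq4[of "1 + p w * h w" "p w * h w"] ph by simp
          then have "(1 / 2)\<^sup>2 \<le> (cmod (1 + p w * h w))\<^sup>2" by (rule power_mono) simp
          moreover have "(1 / 2)\<^sup>2 = (1 / 4 :: real)" by (simp add: power2_eq_square)
          ultimately show ?thesis using \<beta>(2) zero_le_power2[of "cmod (h w)"] by linarith
        next
          case False
          then have "1 / (2 * B) \<le> cmod (h w)" using B by (simp add: field_simps)
          then have "(1 / (2 * B))\<^sup>2 \<le> (cmod (h w))\<^sup>2" using B by (intro power_mono) auto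
          moreover have "(1 / (2 * B))\<^sup>2 = \<beta>" by (simp add: \<beta>_def power_divide power_mult_distrib)
          ultimately show ?thesis using zero_le_power2[of "cmod (1 + p w * h w)"] by linarith
        qed
        ultimately show ?thesis by (simp add: K_def)
      qed
      have dh: "cmod (deriv h w) \<le> 5 * M'" if w: "w \<in> ball z0 d" for w
      proof -
        have "(cmod (h w))\<^sup>2 \<le> 2\<^sup>2" using le2 w by (intro power_mono) auto
        then have "M' * (1 + (cmod (h w))\<^sup>2) \<le> M' * 5" using M' by (intro mult_left_mono) auto
        then show ?thesis using sphd[OF w] by simp
      qed
      have L: "cmod (h z - h z0) * B \<le> \<epsilon>" by (rule lip[OF hhol dh z])
      have "cmod (h z - h z0) * 1 \<le> cmod (h z - h z0) * B" using B by (intro mult_left_mono) auto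
      then have 1: "cmod (h z0 - h z) \<le> \<epsilon>" using L by (simp add: norm_minus_commute)
      have "p z0 * h z0 - p z * h z = (p z0 - p z) * h z0 + p z * (h z0 - h z)" by (simp add: algebra_simps)
      then have "cmod (p z0 * h z0 - p z * h z) \<le> cmod (p z0 - p z) * cmod (h z0) + cmod (p z) * cmod (h z0 - h z)"
        using norm_triangle_ineq[of "(p z0 - p z) * h z0" "p z * (h z0 - h z)"] by (simp add: norm_mult)
      also have "\<dots> \<le> \<epsilon> * 2 + B * cmod (h z0 - h z)"
        using pz[OF z] le2 z0 \<epsilon> B by (intro add_mono mult_mono) (auto simp: norm_minus_commute)
      also have "\<dots> \<le> 3 * \<epsilon>" using L by (simp add: norm_minus_commute mult.commute)
      finally have 2: "cmod (p z0 * h z0 - p z * h z) \<le> 3 * \<epsilon>" .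
      show ?thesis using closeK[OF inK[OF z0] inK[OF z]] 1 2 by simp
    next
      assume ge: "\<forall>z\<in>ball z0 d. 1 / 2 \<le> cmod (h z)"
      then have nz: "h w \<noteq> 0" if "w \<in> ball z0 d" for w using that by force
      define g where "g w = 1 / h w" for w
      have ghol: "g holomorphic_on ball z0 d" unfolding g_def by (intro holomorphic_intros hhol) (use nz in auto)
      have scale: "homog_stereo (1 + p w * h w, h w) = homog_stereo (g w + p w, 1)" if "w \<in> ball z0 d" for w
        using homog_stereo_scale[OF nz[OF that], of "1 + p w * h w"] nz[OF that]
        by (simp add: g_def add_divide_distrib)
      have g2: "cmod (g w) \<le> 2" if w: "w \<in> ball z0 d" for w
        using ge w nz[OF w] by (force simp: g_def norm_divide divide_le_eq)
      have inK: "(g w + p w, 1) \<in> K" if w: "w \<in> ball z0 d" for w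
      proof -
        have "cmod (g w + p w) \<le> C"
          using norm_triangle_ineq[of "g w" "p w"] g2[OF w] pz(1)[OF w] B by (simp add: C_def)
        moreover have "\<beta> \<le> (cmod (g w + p w))\<^sup>2 + 1" using \<beta>(2) zero_le_power2[of "cmod (g w + p w)"] by linarith
        ultimately show ?thesis using B by (simp add: K_def C_def)
      qed
      have dg: "cmod (deriv g w) \<le> 5 * M'" if w: "w \<in> ball z0 d" for w
      proof -
        have "(h has_field_derivative deriv h w) (at w)" using hhol w by (intro holomorphic_derivI) auto
        from DERIV_divide[OF DERIV_const[of 1] this nz[OF w]]
        have "(g has_field_derivative - deriv h w / (h w * h w)) (at w)" unfolding g_def by simp
        then have "deriv g w = - deriv h w / (h w * h w)" by (rule DERIV_imp_deriv)
        then have "cmod (deriv g w) = cmod (deriv h w) / (cmod (h w))\<^sup>2"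
          by (simp add: norm_divide norm_mult power2_eq_square)
        also have "\<dots> \<le> M' * (1 + (cmod (h w))\<^sup>2) / (cmod (h w))\<^sup>2"
          using sphd[OF w] by (intro divide_right_mono) auto
        also have "\<dots> = M' * (1 + (cmod (g w))\<^sup>2)"
          using nz[OF w] by (simp add: g_def norm_divide field_simps)
        also have "\<dots> \<le> M' * (1 + 2\<^sup>2)"
          using M' g2[OF w] by (intro mult_left_mono add_left_mono power_mono) auto
        finally show ?thesis by simp
      qed
      have L: "cmod (g z - g z0) * B \<le> \<epsilon>" by (rule lip[OF ghol dg z])
      have "cmod (g z - g z0) * 1 \<le> cmod (g z - g z0) * B" using B by (intro mult_left_mono) auto
      then have 1: "cmod (g z0 - g z) \<le> \<epsilon>" using L by (simp add: norm_minus_commute)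
      have "cmod ((g z0 + p z0) - (g z + p z)) \<le> cmod (g z0 - g z) + cmod (p z0 - p z)"
        using norm_triangle_ineq[of "g z0 - g z" "p z0 - p z"] by (simp add: algebra_simps)
      also have "\<dots> \<le> 3 * \<epsilon>" using 1 pz(2)[OF z] \<epsilon> by (simp add: norm_minus_commute)
      finally show ?thesis unfolding scale[OF z] scale[OF z0]
        using closeK[OF inK[OF z0] inK[OF z]] \<epsilon> by simp
    qed
  qed
  then show thesis using that[OF d0 dr] by blast
qed

theorem theorem1p9:
  fixes D :: "complex set" and P Q :: "complex poly" and l :: nat
    and \<F> :: "(complex \<Rightarrow> complex) set"
  assumes "open D" and "connected D" and "D \<noteq> {}"
    and "1 \<le> degree P" and "degree P < degree Q" and "degree Q = l"
    and "\<F> = {f. f nicely_meromorphic_on D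
               \<and> \<not> has_zero_in (\<lambda>z. f z - poly P z) D
               \<and> \<not> has_zero_in ((deriv ^^ l) (\<lambda>z. f z - poly Q z)) D}"
  shows "normal_family_on \<F> D"
  unfolding normal_family_on_def
proof (intro allI impI)
  fix F :: "nat \<Rightarrow> complex \<Rightarrow> complex" assume F: "\<forall>n. F n \<in> \<F>"
  note D = assms(1)
  have Fn: "F n nicely_meromorphic_on D" "\<not> has_zero_in (\<lambda>z. F n z - poly P z) D"
    "\<not> has_zero_in ((deriv ^^ l) (\<lambda>z. F n z - poly Q z)) D" for n
    using F assms(7) by auto
  have Phol: "poly P holomorphic_on A" for A by (intro holomorphic_intros)
  have l: "2 \<le> l" using assms(4-6) by simp
  \<comment> \<open>As \<open>Q\<close> has the larger degree, the \<open>l\<close>-th derivative of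
    \<open>P - Q\<close> is a nonzero constant \<open>a\<close>; its negative is the omitted
    value.\<close>
  have degPQ: "degree (P - Q) = l" using assms(5,6) degree_add_eq_right[of P "- Q"] by simp
  obtain a where a: "a \<noteq> 0" "\<And>z. (deriv ^^ l) (poly (P - Q)) z = a"
    using higher_deriv_poly_degree[of "P - Q"] degPQ l by auto
  define h where "h n = pole_reciprocal (F n) (poly P)" for n
  have hhol: "h n holomorphic_on D" for n
    unfolding h_def by (rule pole_reciprocal_holomorphic[OF D Fn(1) Phol Fn(2)])
  have hom: "(deriv ^^ l) (\<lambda>z. 1 / h n z) z \<noteq> - a" if "z \<in> D" "h n z \<noteq> 0" for n z
    using pole_reciprocal_higher_deriv_omits[OF D Fn a(2), of z n] that by (simp add: h_def[abs_def])
  define \<psi> where "\<psi> n z = stereo (sphere_val (F n) z)" for n z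
  have \<psi>: "\<psi> n z = homog_stereo (1 + poly P z * h n z, h n z)" if "z \<in> D" for n z
    unfolding \<psi>_def h_def by (rule stereo_sphere_val[OF D Fn(1) Phol Fn(2) that])
  have equi: "\<exists>d>0. \<forall>n. \<forall>w\<in>D. dist z w < d \<longrightarrow> dist (\<psi> n z) (\<psi> n w) < e" if z: "z \<in> D" and e: "0 < e" for z e
  proof -
    have "\<exists>r>0. \<exists>M. ball z r \<subseteq> D \<and>
      (\<forall>k\<in>range h. \<forall>w\<in>ball z r. cmod (deriv k w) \<le> M * (1 + (cmod (k w))\<^sup>2))"
      by (rule spherical_derivative_locally_bounded[OF D z l, of "- a"]) (use a hhol hom in auto)
    then obtain r M where r: "0 < r" "ball z r \<subseteq> D"
      and M: "\<forall>k\<in>range h. \<forall>w\<in>ball z r. cmod (deriv k w) \<le> M * (1 + (cmod (k w))\<^sup>2)" by blast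
    obtain d where d: "0 < d" "d \<le> r" "\<And>k w. \<lbrakk>k \<in> range h; w \<in> ball z d\<rbrakk> \<Longrightarrow>
      dist (homog_stereo (1 + poly P z * k z, k z)) (homog_stereo (1 + poly P w * k w, k w)) < e"
    proof (rule equicontinuous_homog_stereo[of "range h" z r M "poly P" e])
      show "k holomorphic_on ball z r" if "k \<in> range h" for k
        using that hhol holomorphic_on_subset[OF _ r(2)] by blast
    qed (use M r e in \<open>auto intro!: continuous_intros\<close>)
    have "dist (\<psi> n z) (\<psi> n w) < e" if "w \<in> D" "dist z w < d" for n w
      using d(3)[of "h n" w] that z by (simp add: \<psi>)
    then show ?thesis using d(1) by blast
  qed
  obtain g r where r: "strict_mono (r :: nat \<Rightarrow> nat)"
    and g: "\<And>z. z \<in> D \<Longrightarrow> \<exists>\<delta>>0. ball z \<delta> \<subseteq> D \<and> uniform_limit (ball z \<delta>) (\<lambda>n. \<psi> (r n)) g sequentially"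
  proof (rule Arzela_Ascoli_locally_uniform[OF D, of \<psi> 1])
    show "norm (\<psi> n z) \<le> 1" for n z by (simp add: \<psi>_def norm_stereo)
  qed (use equi in blast)+
  \<comment> \<open>Limits of points of the unit sphere stay on it, so each \<open>g z\<close> is
    the image of a point of the Riemann sphere; these points form the limit map.\<close>
  have "norm (g z) = 1" if z: "z \<in> D" for z
  proof -
    obtain \<delta> where \<delta>: "0 < \<delta>" "uniform_limit (ball z \<delta>) (\<lambda>n. \<psi> (r n)) g sequentially" using g[OF z] by blast
    have "(\<lambda>n. \<psi> (r n) z) \<longlonglongrightarrow> g z" using tendsto_uniform_limitI[OF \<delta>(2)] \<delta>(1) by simp
    then have "(\<lambda>n. norm (\<psi> (r n) z)) \<longlonglongrightarrow> norm (g z)" by (rule tendsto_norm)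
    then show ?thesis by (simp add: \<psi>_def norm_stereo LIMSEQ_const_iff)
  qed
  then have "\<exists>p. stereo p = g z" if "z \<in> D" for z using stereo_surj that by metis
  then obtain G where G: "\<And>z. z \<in> D \<Longrightarrow> stereo (G z) = g z" by metis
  have "converges_loc_unif_spherical (\<lambda>n. F (r n)) G D"
    unfolding converges_loc_unif_spherical_def
  proof
    fix z assume "z \<in> D"
    then obtain \<delta> where \<delta>: "0 < \<delta>" "ball z \<delta> \<subseteq> D" "uniform_limit (ball z \<delta>) (\<lambda>n. \<psi> (r n)) g sequentially"
      using g by blast
    show "\<exists>s>0. \<forall>\<epsilon>>0. \<exists>N. \<forall>n\<ge>N. \<forall>w\<in>ball z s \<inter> D. spherical_dist (sphere_val (F (r n)) w) (G w) < \<epsilon>"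
    proof (intro exI[of _ \<delta>] conjI allI impI \<delta>(1))
      fix \<epsilon> :: real assume "0 < \<epsilon>"
      then obtain d where d: "0 < d" "\<And>p q. dist (stereo p) (stereo q) < d \<Longrightarrow> spherical_dist p q < \<epsilon>"
        using spherical_dist_less by blast
      obtain N where N: "\<And>n w. N \<le> n \<Longrightarrow> w \<in> ball z \<delta> \<Longrightarrow> dist (\<psi> (r n) w) (g w) < d"
        using \<delta>(3) d(1) unfolding uniform_limit_iff eventually_sequentially by blast
      have "spherical_dist (sphere_val (F (r n)) w) (G w) < \<epsilon>" if "N \<le> n" "w \<in> ball z \<delta> \<inter> D" for n w
        using N[of n w] that G[of w] by (intro d(2)) (auto simp: \<psi>_def)
      then show "\<exists>N. \<forall>n\<ge>N. \<forall>w\<in>ball z \<delta> \<inter> D. spherical_dist (sphere_val (F (r n)) w) (G w) < \<epsilon>" by blast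
    qed
  qed
  then show "\<exists>(r :: nat \<Rightarrow> nat) g. strict_mono r \<and> converges_loc_unif_spherical (\<lambda>n. F (r n)) g D"
    using r by blast
qed

end
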